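(* Let $\mathbb G$ be a group of Heisenberg type with $m=\dim V_1$ and $k=\dim V_2$, and let $0<s<1$. For every $(z,\sigma)\in\mathbb G$ and every $y>0$ one has $$\mathscr L_s\Big(\big((|z|^2+y^2)^2+16|\sigma|^2\big)^{-\frac{m+2k-2s}4}\Big)=\frac{\Gamma\left(\frac{m+2+2s}4\right)\Gamma\left(\frac{m+2k+2s}4\right)}{\Gamma\left(\frac{m+2-2s}4\right)\Gamma\left(\frac{m+2k-2s}4\right)}\,(4y)^{2s}\,\big((|z|^2+y^2)^2+16|\sigma|^2\big)^{-\frac{m+2k+2s}4},$$ where $\mathscr L_s$ acts in the variable $(z,\sigma)$ with $y$ fixed.
   Context: Group of Heisenberg type. Let $\mathfrak g=V_1\oplus V_2$ be a (real, finite-dimensional) Lie algebra with $[V_1,V_1]=V_2$, $[V_1,V_2]=\{0\}$, endowed with an inner product $\langle\cdot,\cdot\rangle$ with norm $|\cdot|$ (and $V_1\perp V_2$), $m=\dim V_1$, $k=\dim V_2\ge 1$. The Kaplan map $J:V_2\to \mathrm{End}(V_1)$ is defined by $\langle J(\sigma)z,\zeta\rangle=\langle[z,\zeta],\sigma\rangle$ for $z,\zeta\in V_1$, $\sigma\in V_2$. The simply connected Lie group $\mathbb G$ with Lie algebra $\mathfrak g$ is of Heisenberg type if $J(\sigma)^2=-|\sigma|^2\,\mathbb I_{V_1}$ for every $\sigma\in V_2$ (then $m$ is even). Fixing orthonormal bases $\{e_1,\dots,e_m\}$ of $V_1$ and $\{\varepsilon_1,\dots,\varepsilon_k\}$ of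 $V_2$, one identifies $g=\exp(z+\sigma)\in\mathbb G$ with its logarithmic coordinates $(z,\sigma)\in\mathbb R^m\times\mathbb R^k$. The group law is $$(z,\sigma)\circ(\zeta,\tau)=\Big(z+\zeta,\ \sigma+\tau+\tfrac12\sum_{\ell=1}^k\langle J(\varepsilon_\ell)z,\zeta\rangle\varepsilon_\ell\Big),$$ with identity $(0,0)$ and $(z,\sigma)^{-1}=(-z,-\sigma)$; $dg=dz\,d\sigma$ is Lebesgue (Haar) measure. The operator $\mathscr L_s$. Let $X_j$ be the left-invariant vector fields on $\mathbb G$ with $X_j(e)=e_j$, let $\mathscr L=\sum_{j=1}^mX_j^2$ be the horizontal Laplacian, and $\Delta_\sigma$ the Euclidean Laplacian in $\sigma\in\mathbb R^k$. For $0<s<1$ the conformal fractional horizontal Laplacian is given spectrally by $$\mathscr L_s=2^s(-\Delta_\sigma)^{s/2}\,\frac{\Gamma\big(-\frac12\mathscr L(-\Delta_\sigma)^{-1/2}+\frac{1+s}2\big)}{\Gamma\big(-\frac12\mathscr L(-\Delta_\sigma)^{-1/2}+\frac{1-s}2\big)}.$$ It has the following equivalent pointwise representation, which is the meaning of $\mathscr L_su(g)$ to be used here for smooth functions $u$ with suitable decay at infinity, such as the one in the claim: $$\mathscr L_su(g)=-\frac{s}{\Gamma(1-s)}\int_0^\infty\frac1{t^{1+s}}\big[P_{(-s),t}u(g)-u(g)\big]\,dt,$$ where $P_{(-s),t}u(g)=\int_{\mathbb G}\mathscr K_{(-s)}\big((g')^{-1}\circ g,t\big)u(g')\,dg'$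 and $$\mathscr K_{(-s)}((z,\sigma),t)=\frac{2^k}{(4\pi t)^{\frac m2+k}}\int_{\mathbb R^k}e^{-\frac it\langle\sigma,\lambda\rangle}\Big(\frac{|\lambda|}{\sinh|\lambda|}\Big)^{\frac m2+1+s}e^{-\frac{|z|^2}{4t}\frac{|\lambda|}{\tanh|\lambda|}}\,d\lambda .$$ *)

theory Defs
  imports "HOL-Analysis.Analysis"
begin

definition lie_bracket :: "('g::real_vector \<Rightarrow> 'g \<Rightarrow> 'g) \<Rightarrow> bool" where
  "lie_bracket br \<longleftrightarrow>
     bilinear br \<and> (\<forall>x. br x x = 0) \<and>
     (\<forall>x y z. br x (br y z) + br y (br z x) + br z (br x y) = 0)"

text \<open>
  The first layer V1 and the second layer V2 are arbitrary Euclidean spaces \<open>'v\<close> and \<open>'w\<close>. The Lie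
  algebra is the product \<open>'v \<times> 'w\<close>, whose inner product makes the two layers orthogonal;
  \<open>br\<close> is its bracket. Here k \<open>\<ge>\<close> 1 is automatic, since every Euclidean space type has positive
  dimension. Logarithmic coordinates identify the simply connected group with the same product.
\<close>

definition layer1 :: "('v::zero \<times> 'w::zero) set" where
  "layer1 = UNIV \<times> {0}"

definition layer2 :: "('v::zero \<times> 'w::zero) set" where
  "layer2 = {0} \<times> UNIV"

definition kaplan ::
  "('v::euclidean_space \<times> 'w::euclidean_space \<Rightarrow> 'v \<times> 'w \<Rightarrow> 'v \<times> 'w) \<Rightarrow> 'w \<Rightarrow> 'v \<Rightarrow> 'v" where
  "kaplan br \<sigma> z = (THE w. \<forall>\<zeta>. w \<bullet> \<zeta> = br (z, 0) (\<zeta>, 0) \<bullet> (0, \<sigma>))"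

lemma inner_kaplan:
  assumes "bilinear br"
  shows "kaplan br \<sigma> z \<bullet> \<zeta> = br (z, 0) (\<zeta>, 0) \<bullet> (0, \<sigma>)"
proof -
  define f where "f = (\<lambda>\<zeta>. br (z, 0) (\<zeta>, 0) \<bullet> (0, \<sigma>))"
  have br: "linear (br (z, 0))"
    using assms by (simp add: bilinear_def)
  have lin: "linear f"
  proof (rule linearI)
    fix a b :: 'a
    have "br (z, 0) (a + b, 0) = br (z, 0) (a, 0) + br (z, 0) (b, 0)"
      using linear_add[OF br, of "(a, 0)" "(b, 0)"] by simp
    then show "f (a + b) = f a + f b"
      by (simp add: f_def inner_add_left)
  next
    fix c :: real and a :: 'a
    have "br (z, 0) (c *\<^sub>R a, 0) = c *\<^sub>R br (z, 0) (a, 0)"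
      using linear_scale[OF br, of c "(a, 0)"] by simp
    then show "f (c *\<^sub>R a) = c *\<^sub>R f a"
      by (simp add: f_def)
  qed
  have adj: "adjoint f 1 \<bullet> x = f x" for x
    using adjoint_works[OF lin, of x 1] by (simp add: inner_commute)
  have "\<exists>!w. \<forall>x. w \<bullet> x = f x"
  proof (rule ex1I[of _ "adjoint f 1"])
    show "\<forall>x. adjoint f 1 \<bullet> x = f x"
      using adj by blast
    show "w = adjoint f 1" if "\<forall>x. w \<bullet> x = f x" for w
      using that adj vector_eq_rdot[of w "adjoint f 1"] by simp
  qed
  from theI'[OF this] show ?thesis
    unfolding kaplan_def f_def by blast
qed

text \<open>\<open>[V1, V1]\<close> is the linear span of the brackets, as usual.\<close>

definition heisenberg_type ::
  "('v::euclidean_space \<times> 'w::euclidean_space \<Rightarrow> 'v \<times> 'w \<Rightarrow> 'v \<times> 'w) \<Rightarrow> bool" where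
  "heisenberg_type br \<longleftrightarrow>
     lie_bracket br \<and>
     span {br x y | x y. x \<in> layer1 \<and> y \<in> layer1} = layer2 \<and>
     (\<forall>x\<in>layer1. \<forall>y\<in>layer2. br x y = 0) \<and>
     (\<forall>\<sigma> z. kaplan br \<sigma> (kaplan br \<sigma> z) = - (norm \<sigma>)\<^sup>2 *\<^sub>R z)"

definition group_mult ::
  "('v::euclidean_space \<times> 'w::euclidean_space \<Rightarrow> 'v \<times> 'w \<Rightarrow> 'v \<times> 'w)
    \<Rightarrow> 'v \<times> 'w \<Rightarrow> 'v \<times> 'w \<Rightarrow> 'v \<times> 'w" where
  "group_mult br = (\<lambda>(z, \<sigma>) (\<zeta>, \<tau>).
     (z + \<zeta>, \<sigma> + \<tau> + (1/2) *\<^sub>R (\<Sum>\<epsilon>\<in>Basis. (kaplan br \<epsilon> z \<bullet> \<zeta>) *\<^sub>R \<epsilon>)))"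

definition group_inv :: "'v::euclidean_space \<times> 'w::euclidean_space \<Rightarrow> 'v \<times> 'w" where
  "group_inv = (\<lambda>(z, \<sigma>). (- z, - \<sigma>))"

text \<open>
  The integrand of the kernel with parameter \<open>-s\<close>. At the null set \<open>\<xi> = 0\<close> the quotients take the
  value 0 instead of their limit 1, which does not affect the integral.
\<close>

definition kernel_integrand ::
  "real \<Rightarrow> 'v::euclidean_space \<times> 'w::euclidean_space \<Rightarrow> real \<Rightarrow> 'w \<Rightarrow> complex" where
  "kernel_integrand s = (\<lambda>(z, \<sigma>) t \<xi>.
     exp (- (\<i> / of_real t) * of_real (\<sigma> \<bullet> \<xi>)) *
     of_real ((norm \<xi> / sinh (norm \<xi>)) powr (real DIM('v) / 2 + 1 + s) *
              exp (- ((norm z)\<^sup>2 / (4 * t)) * (norm \<xi> / tanh (norm \<xi>)))))"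

definition kernel ::
  "real \<Rightarrow> 'v::euclidean_space \<times> 'w::euclidean_space \<Rightarrow> real \<Rightarrow> complex" where
  "kernel s g t =
     of_real (2 ^ DIM('w) / (4 * pi * t) powr (real DIM('v) / 2 + real DIM('w))) *
     (LINT \<xi>|lborel. kernel_integrand s g t \<xi>)"

definition P_op ::
  "('v::euclidean_space \<times> 'w::euclidean_space \<Rightarrow> 'v \<times> 'w \<Rightarrow> 'v \<times> 'w) \<Rightarrow> real \<Rightarrow> real
    \<Rightarrow> ('v \<times> 'w \<Rightarrow> complex) \<Rightarrow> 'v \<times> 'w \<Rightarrow> complex" where
  "P_op br s t u g =
     (LINT g'|lborel. kernel s (group_mult br (group_inv g') g) t * u g')"

definition frac_lap_integrand ::
  "('v::euclidean_space \<times> 'w::euclidean_space \<Rightarrow> 'v \<times> 'w \<Rightarrow> 'v \<times> 'w) \<Rightarrow> real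
    \<Rightarrow> ('v \<times> 'w \<Rightarrow> complex) \<Rightarrow> 'v \<times> 'w \<Rightarrow> real \<Rightarrow> complex" where
  "frac_lap_integrand br s u g t = of_real (1 / t powr (1 + s)) * (P_op br s t u g - u g)"

definition frac_lap ::
  "('v::euclidean_space \<times> 'w::euclidean_space \<Rightarrow> 'v \<times> 'w \<Rightarrow> 'v \<times> 'w) \<Rightarrow> real
    \<Rightarrow> ('v \<times> 'w \<Rightarrow> complex) \<Rightarrow> 'v \<times> 'w \<Rightarrow> complex" where
  "frac_lap br s u g =
     - of_real (s / Gamma (1 - s)) * (LINT t:{0<..}|lborel. frac_lap_integrand br s u g t)"

text \<open>
  Divergent Bochner integrals evaluate to 0; this predicate says that every integral occurring in
  \<open>frac_lap br s u g\<close> converges absolutely, so that its value is meaningful.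
\<close>

definition frac_lap_converges ::
  "('v::euclidean_space \<times> 'w::euclidean_space \<Rightarrow> 'v \<times> 'w \<Rightarrow> 'v \<times> 'w) \<Rightarrow> real
    \<Rightarrow> ('v \<times> 'w \<Rightarrow> complex) \<Rightarrow> 'v \<times> 'w \<Rightarrow> bool" where
  "frac_lap_converges br s u g \<longleftrightarrow>
     (\<forall>t>0. \<forall>h::'v \<times> 'w. integrable lborel (kernel_integrand s h t)) \<and>
     (\<forall>t>0. integrable lborel (\<lambda>g'. kernel s (group_mult br (group_inv g') g) t * u g')) \<and>
     set_integrable lborel {0<..} (frac_lap_integrand br s u g)"

end

(*
  Write l = |\<mu>| for the frequency dual to \<sigma>, R = |z|^2 + y^2, q = m/2 + 1 - s. Up to a constant, the
  Fourier transform in \<sigma> of u is the integral over the forward light cone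
    cone q R l = \<integral>_{V > l} (V^2 - l^2)^(q/2 - 1) exp (- V R / 4) dV,
  both directions being Gaussian integrals after writing u and the cone integral as mixtures of
  Gaussians. In terms of V = l coth (l \<tau>) the integrand is a twisted heat kernel at time \<tau>, hence the
  kernel at time t, with parameter w = l coth (l t), acts on it by v \<mapsto> V = (w v + l^2)/(w + v), which is
  the addition formula for coth. The substitution turns the z-convolution into multiplication of the
  cone density by t^(1+s) (w^2 - l^2) (w - V)^(s-1) exp (- A/(w - V)), A = (y^2/4)(V^2 - l^2). As
  dw = - (w^2 - l^2) dt, the remaining t-integral is the regularised integral
    \<integral>_0^\<infinity> x^(s-1) (exp (- A/x) - 1) dx = - \<Gamma>(1-s)/s A^s,
  and multiplication by A^s raises q by 2 s, that is, replaces s by -s.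
*)
theory Submission
  imports Defs "HOL-Probability.Probability" "HOL-Real_Asymp.Real_Asymp"
begin

section \<open>Gaussian and Gamma integrals\<close>

text \<open>The group geometry enters through a phase: in the z-convolution the bracket contributes
  a character \<open>cis (\<eta> \<bullet> x)\<close> with \<eta> = - J(\<mu>) z / 2, orthogonal to
  z and of norm l |z| / 2. Completing the square gives the exponent - (|z|^2 / 4) (w v + l^2) / (w +
  v), where the term l^2 comes from |\<eta>|^2. The same step dictates the exponent of u: the powers
  of w^2 - l^2 from kernel, density, Gaussian integral and Jacobian add up to 1 exactly when q = m/2
  + 1 - s. The obstacle is absolute convergence. The t-integrand is the cone density integrated
  against a difference of two functions, each of order t^(- s - 1) at t = 0, so t, \<mu> and V can
  be interchanged only for the difference. Its absolute t-integral is at most Gamma (1 - s) / s A^s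
  + 2 V^s / s; the first term raises q, the second is absorbed by replacing R by R / 2, and both
  lead back to cone integrals. Positive integrals are computed in [0, \<infinity>], so convergence
  and value come together, and both Fourier transforms are explicit, without an inversion
  theorem.\<close>

lemma nn_integral_change_of_variables_1:
  fixes f F g g' :: "real \<Rightarrow> real"
  assumes S: "S \<in> sets borel"
    and der: "\<And>x. x \<in> S \<Longrightarrow> (g has_field_derivative g' x) (at x)"
    and inj: "inj_on g S"
    and im: "g ` S = T" and T: "T \<in> sets borel"
    and f[measurable]: "f \<in> borel_measurable borel"
    and f0: "\<And>y. y \<in> T \<Longrightarrow> 0 \<le> f y"
    and F[measurable]: "F \<in> borel_measurable borel"
    and eq: "\<And>x. x \<in> S \<Longrightarrow> F x = \<bar>g' x\<bar> * f (g x)"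
  shows "(\<integral>\<^sup>+x. ennreal (indicator S x * F x) \<partial>lborel) = (\<integral>\<^sup>+y. ennreal (indicator T y * f y) \<partial>lborel)"
proof -
  note [measurable] = S T
  have F0: "0 \<le> F x" if "x \<in> S" for x
    using that eq f0 im by auto
  \<comment> \<open>Being stated for every b, the equivalence transfers integrability and value at
    once. \<open>F\<close> is a Borel function that agrees with the transformed integrand on S,
    which is all a set integral sees.\<close>
  have key: "(\<lambda>x. \<bar>g' x\<bar> * f (g x)) absolutely_integrable_on S \<and>
           integral S (\<lambda>x. \<bar>g' x\<bar> * f (g x)) = b
     \<longleftrightarrow> f absolutely_integrable_on (g ` S) \<and> integral (g ` S) f = b" for b
    by (rule has_absolute_integral_change_of_variables_1')
       (use S der inj in \<open>auto intro: has_field_derivative_at_within\<close>)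
  have absF: "(\<lambda>x. \<bar>g' x\<bar> * f (g x)) absolutely_integrable_on S \<longleftrightarrow> F absolutely_integrable_on S"
    unfolding set_integrable_def by (intro Bochner_Integration.integrable_cong) (auto simp: indicator_def eq)
  have intF: "integral S (\<lambda>x. \<bar>g' x\<bar> * f (g x)) = integral S F"
    by (intro integral_cong) (simp add: eq)
  have key': "F absolutely_integrable_on S \<and> integral S F = b
     \<longleftrightarrow> f absolutely_integrable_on T \<and> integral T f = b" for b
    using key[of b] absF intF im by auto
  have conv: "h absolutely_integrable_on A \<longleftrightarrow> integrable lborel (\<lambda>x. indicator A x * h x)"
    if "h \<in> borel_measurable borel" "A \<in> sets borel" for h :: "real \<Rightarrow> real" and A
    using that unfolding set_integrable_def by (simp add: integrable_completion)
  have convI: "integral A h = (LINT x|lborel. indicator A x * h x)"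
    if "h \<in> borel_measurable borel" "A \<in> sets borel" "integrable lborel (\<lambda>x. indicator A x * h x)"
    for h :: "real \<Rightarrow> real" and A
    using set_borel_integral_eq_integral(2)[of A h] that
    by (simp add: set_integrable_def set_lebesgue_integral_def)
  have nnF: "\<And>x. 0 \<le> indicator S x * F x" using F0 by (auto simp: indicator_def)
  have nnf: "\<And>x. 0 \<le> indicator T x * f x" using f0 by (auto simp: indicator_def)
  \<comment> \<open>If one side is not integrable, neither is the other, and by nonnegativity both
    integrals are \<infinity>. Finiteness can therefore be read off from either side later
    on.\<close>
  show ?thesis
  proof (cases "integrable lborel (\<lambda>x. indicator S x * F x)")
    case True
    then have "F absolutely_integrable_on S" by (simp add: conv S)
    with key' have *: "f absolutely_integrable_on T" "integral T f = integral S F" by auto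
    then have i: "integrable lborel (\<lambda>x. indicator T x * f x)" by (simp add: conv T)
    show ?thesis
      using *(2) convI[OF F S True] convI[OF f T i]
      by (simp add: nn_integral_eq_integral[OF True] nn_integral_eq_integral[OF i] nnF nnf)
  next
    case False
    then have "\<not> F absolutely_integrable_on S" by (simp add: conv S)
    with key' have "\<not> f absolutely_integrable_on T" by auto
    then have F2: "\<not> integrable lborel (\<lambda>x. indicator T x * f x)" by (simp add: conv T)
    have "(\<integral>\<^sup>+x. ennreal (indicator S x * F x) \<partial>lborel) = \<infinity>"
    proof (rule ccontr)
      assume "\<not> ?thesis"
      then have "integrable lborel (\<lambda>x. indicator S x * F x)"
        by (intro integrableI_nonneg) (auto simp: nnF less_top)
      with False show False by simp
    qed
    moreover have "(\<integral>\<^sup>+x. ennreal (indicator T x * f x) \<partial>lborel) = \<infinity>"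
    proof (rule ccontr)
      assume "\<not> ?thesis"
      then have "integrable lborel (\<lambda>x. indicator T x * f x)"
        by (intro integrableI_nonneg) (auto simp: nnf less_top)
      with F2 show False by simp
    qed
    ultimately show ?thesis by simp
  qed
qed

text \<open>A rescaled characteristic function of the standard normal law: the choice
  \<open>c\<^sup>2 = 1 / (2 * A)\<close> turns the density at x / c into exp (- A x^2) up to the
  factor 1 / sqrt (2 pi).\<close>

lemma gauss_char_1:
  fixes A t :: real assumes A: "A > 0"
  shows "has_bochner_integral lborel (\<lambda>x. complex_of_real (exp (- A * x\<^sup>2)) * cis (t * x))
     (complex_of_real (sqrt (pi / A) * exp (- t\<^sup>2 / (4 * A))))"
proof -
  define c where "c = 1 / sqrt (2 * A)"
  have c: "c > 0" "c\<^sup>2 = 1 / (2 * A)" using A by (auto simp: c_def power_divide)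
  have dens: "std_normal_density x = (1 / sqrt (2 * pi)) * exp (- x\<^sup>2 / 2)" for x
    by (simp add: std_normal_density_def)
  have int: "integrable lborel (\<lambda>x. std_normal_density x *\<^sub>R cis (s * x))" for s
    by (rule Bochner_Integration.integrable_bound[OF integrable_normal_density[of 1 0]])
       (auto simp: cis_conv_exp)
  have "char std_normal_distribution s = (LINT x|lborel. std_normal_density x *\<^sub>R cis (s * x))" for s
    unfolding char_def by (subst integral_density) (auto simp: cis_conv_exp)
  then have v: "(LINT x|lborel. std_normal_density x *\<^sub>R cis (s * x)) = exp (- (s\<^sup>2) / 2)" for s
    using char_std_normal_distribution by metis
  have hb: "has_bochner_integral lborel (\<lambda>x. std_normal_density x *\<^sub>R cis ((t * c) * x)) (exp (- ((t * c)\<^sup>2) / 2))"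
    using int[of "t * c"] v[of "t * c"] by (simp add: has_bochner_integral_iff)
  have "has_bochner_integral lborel (\<lambda>x. std_normal_density (0 + (1/c) * x) *\<^sub>R cis ((t * c) * (0 + (1/c) * x)))
          (exp (- ((t * c)\<^sup>2) / 2) /\<^sub>R \<bar>1 / c\<bar>)"
    using hb lborel_has_bochner_integral_real_affine_iff[of "1/c" "\<lambda>x. std_normal_density x *\<^sub>R cis ((t * c) * x)"
         "complex_of_real (exp (- ((t * c)\<^sup>2) / 2))" 0] c by (simp add: scaleR_conv_of_real)
  then have "has_bochner_integral lborel (\<lambda>x. complex_of_real (sqrt (2 * pi)) * (std_normal_density (x / c) *\<^sub>R cis (t * x)))
      (complex_of_real (sqrt (2 * pi)) * (exp (- ((t * c)\<^sup>2) / 2) /\<^sub>R \<bar>1 / c\<bar>))"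
    using c by (intro has_bochner_integral_mult_right) simp
  also have "(\<lambda>x. complex_of_real (sqrt (2 * pi)) * (std_normal_density (x / c) *\<^sub>R cis (t * x)))
      = (\<lambda>x. complex_of_real (exp (- A * x\<^sup>2)) * cis (t * x))"
    using c A by (auto simp: dens scaleR_conv_of_real power_divide fun_eq_iff simp flip: of_real_mult)
  also have "complex_of_real (sqrt (2 * pi)) * (exp (- ((t * c)\<^sup>2) / 2) /\<^sub>R \<bar>1 / c\<bar>)
     = complex_of_real (sqrt (2 * pi) * c * exp (- ((t * c)\<^sup>2) / 2))"
    using c by (simp add: scaleR_conv_of_real)
  also have "sqrt (2 * pi) * c = sqrt (pi / A)" by (simp add: c_def real_sqrt_mult real_sqrt_divide)
  also have "- ((t * c)\<^sup>2) / 2 = - t\<^sup>2 / (4 * A)" using A by (simp add: power_mult_distrib c)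
  finally show ?thesis .
qed

text \<open>Gaussian and character both factor over an orthonormal basis, so the integral is a
  product of one-dimensional ones; \<open>lborel_eq\<close> presents Lebesgue measure as the image
  of the product measure.\<close>

lemma gauss_char:
  fixes \<eta> :: "'a::euclidean_space" assumes A: "A > 0"
  shows "has_bochner_integral lborel (\<lambda>x. complex_of_real (exp (- A * (norm x)\<^sup>2)) * cis (\<eta> \<bullet> x))
     (complex_of_real ((pi / A) powr (real DIM('a) / 2) * exp (- (norm \<eta>)\<^sup>2 / (4 * A))))"
proof -
  interpret product_sigma_finite "\<lambda>_. lborel :: real measure" ..
  define f where "f = (\<lambda>b x. complex_of_real (exp (- A * x\<^sup>2)) * cis ((\<eta> \<bullet> b) * x))"
  have f: "has_bochner_integral lborel (f b) (complex_of_real (sqrt (pi / A) * exp (- (\<eta> \<bullet> b)\<^sup>2 / (4 * A))))" for b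
    unfolding f_def by (rule gauss_char_1[OF A])
  have intf: "integrable lborel (f b)" for b using f by (auto simp: has_bochner_integral_iff)
  have pr: "(\<Prod>b\<in>Basis. f b (x b)) = complex_of_real (exp (- A * (norm (\<Sum>b\<in>Basis. x b *\<^sub>R b :: 'a))\<^sup>2)) * cis (\<eta> \<bullet> (\<Sum>b\<in>Basis. x b *\<^sub>R b))"
    for x :: "'a \<Rightarrow> real"
  proof -
    have n: "(norm (\<Sum>b\<in>Basis. x b *\<^sub>R b :: 'a))\<^sup>2 = (\<Sum>b\<in>Basis. (x b)\<^sup>2)"
      unfolding power2_norm_eq_inner by (subst euclidean_inner) (simp add: power2_eq_square)
    have c: "cis (sum g I) = (\<Prod>b\<in>I. cis (g b))" if "finite I" for g :: "'a \<Rightarrow> real" and I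
      using that by induction (auto simp: cis_mult[symmetric])
    have "(\<Prod>b\<in>Basis. complex_of_real (exp (- A * (x b)\<^sup>2))) = complex_of_real (exp (\<Sum>b\<in>Basis. - A * (x b)\<^sup>2))"
      by (simp add: exp_sum)
    then show ?thesis
      unfolding f_def n prod.distrib
      by (simp add: inner_sum_right c sum_distrib_left sum_negf mult.commute)
  qed
  have "integrable (Pi\<^sub>M Basis (\<lambda>_. lborel)) (\<lambda>x. \<Prod>b\<in>(Basis::'a set). f b (x b))"
    by (intro product_integrable_prod intf) simp
  moreover have "integral\<^sup>L (Pi\<^sub>M Basis (\<lambda>_. lborel)) (\<lambda>x. \<Prod>b\<in>(Basis::'a set). f b (x b)) = (\<Prod>b\<in>(Basis::'a set). integral\<^sup>L lborel (f b))"
    by (intro product_integral_prod intf) simp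
  moreover have "(\<Prod>b\<in>(Basis::'a set). integral\<^sup>L lborel (f b)) = complex_of_real ((pi / A) powr (real DIM('a) / 2) * exp (- (norm \<eta>)\<^sup>2 / (4 * A)))"
  proof -
    have fb: "integral\<^sup>L lborel (f b) = complex_of_real (sqrt (pi / A) * exp (- (\<eta> \<bullet> b)\<^sup>2 / (4 * A)))" for b
      using f[of b] by (rule has_bochner_integral_integral_eq)
    have "(\<Prod>b\<in>(Basis::'a set). integral\<^sup>L lborel (f b)) = complex_of_real (\<Prod>b\<in>(Basis::'a set). sqrt (pi / A) * exp (- (\<eta> \<bullet> b)\<^sup>2 / (4 * A)))"
      by (simp only: fb of_real_prod)
    also have "(\<Prod>b\<in>(Basis::'a set). sqrt (pi / A) * exp (- (\<eta> \<bullet> b)\<^sup>2 / (4 * A)))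
       = sqrt (pi / A) ^ DIM('a) * exp (\<Sum>b\<in>(Basis::'a set). - (\<eta> \<bullet> b)\<^sup>2 / (4 * A))"
      by (simp add: prod.distrib exp_sum)
    also have "(\<Sum>b\<in>(Basis::'a set). - (\<eta> \<bullet> b)\<^sup>2 / (4 * A)) = - (norm \<eta>)\<^sup>2 / (4 * A)"
      unfolding power2_norm_eq_inner
      by (subst euclidean_inner) (simp add: sum_divide_distrib[symmetric] sum_negf power2_eq_square)
    also have "sqrt (pi / A) ^ DIM('a) = (pi / A) powr (real DIM('a) / 2)"
      using A by (simp add: powr_half_sqrt[symmetric] powr_powr flip: powr_realpow)
    finally show ?thesis .
  qed
  ultimately have "has_bochner_integral (Pi\<^sub>M Basis (\<lambda>_. lborel))
      (\<lambda>x. complex_of_real (exp (- A * (norm (\<Sum>b\<in>Basis. x b *\<^sub>R b :: 'a))\<^sup>2)) * cis (\<eta> \<bullet> (\<Sum>b\<in>Basis. x b *\<^sub>R b)))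
      (complex_of_real ((pi / A) powr (real DIM('a) / 2) * exp (- (norm \<eta>)\<^sup>2 / (4 * A))))"
    by (simp add: has_bochner_integral_iff pr)
  moreover have "(\<lambda>x. cis (\<eta> \<bullet> x)) \<in> borel_measurable borel"
    by (intro borel_measurable_continuous_onI continuous_intros)
  ultimately show ?thesis
    by (subst lborel_eq) (auto intro!: has_bochner_integral_distr)
qed

lemma nn_integral_powr_exp:
  fixes p c \<alpha> :: real assumes "p / \<alpha> > 0" "c > 0" "\<alpha> \<noteq> 0"
  shows "(\<integral>\<^sup>+x. ennreal (indicator {0<..} x * (x powr (p - 1) * exp (- c * x powr \<alpha>))) \<partial>lborel)
     = ennreal (Gamma (p / \<alpha>) * c powr (- p / \<alpha>) / \<bar>\<alpha>\<bar>)"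
proof -
  have "(\<integral>\<^sup>+x. ennreal (indicator {0<..} x * (\<bar>\<alpha>\<bar> * c powr (p / \<alpha>) * (x powr (p - 1) * exp (- c * x powr \<alpha>)))) \<partial>lborel)
    = (\<integral>\<^sup>+y. ennreal (indicator {0<..} y * (y powr (p / \<alpha> - 1) * exp (- y))) \<partial>lborel)"
  proof (rule nn_integral_change_of_variables_1[where g = "\<lambda>x. c * x powr \<alpha>" and g' = "\<lambda>x. c * (\<alpha> * x powr (\<alpha> - 1))"])
    show "((\<lambda>x. c * x powr \<alpha>) has_real_derivative c * (\<alpha> * x powr (\<alpha> - 1))) (at x)" if "x \<in> {0<..}" for x
      using that by (auto intro!: derivative_eq_intros)
    show "inj_on (\<lambda>x. c * x powr \<alpha>) {0<..}"
    proof (rule inj_onI)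
      fix x y :: real assume "x \<in> {0<..}" "y \<in> {0<..}" "c * x powr \<alpha> = c * y powr \<alpha>"
      then have "(x powr \<alpha>) powr (1 / \<alpha>) = (y powr \<alpha>) powr (1 / \<alpha>)" using assms by simp
      then show "x = y" using \<open>x \<in> _\<close> \<open>y \<in> _\<close> assms by (simp add: powr_powr)
    qed
    show "(\<lambda>x. c * x powr \<alpha>) ` {0<..} = {0<..}"
    proof (intro set_eqI iffI)
      fix y :: real assume "y \<in> {0<..}"
      then have "y = c * ((y / c) powr (1 / \<alpha>)) powr \<alpha>" "(y / c) powr (1 / \<alpha>) > 0"
        using assms by (auto simp: powr_powr)
      then show "y \<in> (\<lambda>x. c * x powr \<alpha>) ` {0<..}" by auto
    qed (use assms in auto)
    show "\<bar>\<alpha>\<bar> * c powr (p / \<alpha>) * (x powr (p - 1) * exp (- c * x powr \<alpha>)) =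
        \<bar>c * (\<alpha> * x powr (\<alpha> - 1))\<bar> * ((c * x powr \<alpha>) powr (p / \<alpha> - 1) * exp (- (c * x powr \<alpha>)))" if "x \<in> {0<..}" for x
    proof -
      have a1: "c * c powr (p / \<alpha> - 1) = c powr (p / \<alpha>)" using assms by (simp add: powr_diff)
      have a2: "x powr (\<alpha> - 1) * (x powr \<alpha>) powr (p / \<alpha> - 1) = x powr (p - 1)"
        using that assms by (simp add: powr_powr powr_add[symmetric] algebra_simps)
      show ?thesis
        using that assms by (simp add: powr_mult abs_mult a1[symmetric] a2[symmetric] mult_ac)
    qed
  qed auto
  also have "\<dots> = (\<integral>\<^sup>+y. ennreal (indicator {0..} y * y powr (p / \<alpha> - 1) / exp y) \<partial>lborel)"
    by (intro nn_integral_cong) (auto simp: indicator_def exp_minus field_simps)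
  also have "\<dots> = ennreal (Gamma (p / \<alpha>))"
    by (rule Gamma_conv_nn_integral_real[symmetric]) (use assms in auto)
  finally have e: "(\<integral>\<^sup>+x. ennreal (indicator {0<..} x * (\<bar>\<alpha>\<bar> * c powr (p / \<alpha>) * (x powr (p - 1) * exp (- c * x powr \<alpha>)))) \<partial>lborel) = ennreal (Gamma (p / \<alpha>))" .
  have "(\<integral>\<^sup>+x. ennreal (indicator {0<..} x * (x powr (p - 1) * exp (- c * x powr \<alpha>))) \<partial>lborel)
     = (\<integral>\<^sup>+x. ennreal (c powr (- p / \<alpha>) / \<bar>\<alpha>\<bar>) * ennreal (indicator {0<..} x * (\<bar>\<alpha>\<bar> * c powr (p / \<alpha>) * (x powr (p - 1) * exp (- c * x powr \<alpha>)))) \<partial>lborel)"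
    using assms by (intro nn_integral_cong) (auto simp: ennreal_mult[symmetric] powr_minus field_simps indicator_def)
  also have "\<dots> = ennreal (c powr (- p / \<alpha>) / \<bar>\<alpha>\<bar>) * ennreal (Gamma (p / \<alpha>))"
    using e by (subst nn_integral_cmult) auto
  also have "\<dots> = ennreal (Gamma (p / \<alpha>) * c powr (- p / \<alpha>) / \<bar>\<alpha>\<bar>)"
    using assms by (simp add: ennreal_mult'[symmetric] Gamma_real_pos less_imp_le mult.commute)
  finally show ?thesis .
qed

lemma nn_integral_gauss:
  fixes A :: real assumes A: "A > 0"
  shows "(\<integral>\<^sup>+x. ennreal (exp (- A * (norm (x::'a::euclidean_space))\<^sup>2)) \<partial>lborel) = ennreal ((pi / A) powr (real DIM('a) / 2))"
proof -
  have "has_bochner_integral lborel (\<lambda>x::'a. complex_of_real (exp (- A * (norm x)\<^sup>2))) (complex_of_real ((pi / A) powr (real DIM('a) / 2)))"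
    using gauss_char[OF A, of "0::'a"] by simp
  then have "integrable lborel (\<lambda>x::'a. exp (- A * (norm x)\<^sup>2))"
     "(LINT x|lborel. exp (- A * (norm (x::'a))\<^sup>2)) = (pi / A) powr (real DIM('a) / 2)"
    unfolding has_bochner_integral_iff by (auto simp: complex_of_real_integrable_eq)
  then show ?thesis by (simp add: nn_integral_eq_integral)
qed

text \<open>The Cauchy-Schloemilch substitution x = b sqrt w - a / (2 sqrt w) maps the half-line
  onto the whole line and completes the square in the exponent, leaving a Gaussian integral. Its
  Jacobian has two terms, which contribute equally by the symmetry below.\<close>

lemma nn_integral_subordination:
  fixes a b :: real assumes a: "a > 0" and b: "b > 0"
  shows "(\<integral>\<^sup>+w. ennreal (indicator {0<..} w * (w powr (- 1 / 2) * exp (- b\<^sup>2 * w - a\<^sup>2 / (4 * w)))) \<partial>lborel)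
     = ennreal (sqrt pi * exp (- a * b) / b)"
proof -
  define E where "E = (\<lambda>w. exp (- b\<^sup>2 * w - a\<^sup>2 / (4 * w)))"
  have [measurable]: "E \<in> borel_measurable borel" by (simp add: E_def)
  have E0: "E w \<ge> 0" for w by (simp add: E_def)
  define X where "X = (\<integral>\<^sup>+w. ennreal (indicator {0<..} w * (b / (2 * sqrt w) * E w)) \<partial>lborel)"
  \<comment> \<open>The inversion w -> a^2 / (4 b^2 w) leaves \<open>E\<close> unchanged and
    exchanges the two terms of the Jacobian, so each accounts for half of the Gaussian
    integral.\<close>
  have X: "(\<integral>\<^sup>+w. ennreal (indicator {0<..} w * (a / (4 * w * sqrt w) * E w)) \<partial>lborel) = X"
    unfolding X_def
  proof (rule nn_integral_change_of_variables_1[where g = "\<lambda>w. a\<^sup>2 / (4 * b\<^sup>2 * w)" and g' = "\<lambda>w. - a\<^sup>2 / (4 * b\<^sup>2 * w\<^sup>2)"])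
    show "((\<lambda>w. a\<^sup>2 / (4 * b\<^sup>2 * w)) has_real_derivative - a\<^sup>2 / (4 * b\<^sup>2 * x\<^sup>2)) (at x)" if "x \<in> {0<..}" for x
      using that a b by (auto intro!: derivative_eq_intros simp: divide_simps) (simp_all add: power2_eq_square)
    show "inj_on (\<lambda>w. a\<^sup>2 / (4 * b\<^sup>2 * w)) {0<..}"
      using a b by (auto simp: inj_on_def)
    show "(\<lambda>w. a\<^sup>2 / (4 * b\<^sup>2 * w)) ` {0<..} = {0<..}"
    proof (intro set_eqI iffI)
      fix y :: real assume y: "y \<in> {0<..}"
      then have "y = a\<^sup>2 / (4 * b\<^sup>2 * (a\<^sup>2 / (4 * b\<^sup>2 * y)))" using a b by simp
      then show "y \<in> (\<lambda>w. a\<^sup>2 / (4 * b\<^sup>2 * w)) ` {0<..}" by (rule image_eqI) (use y a b in auto)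
    qed (use a b in auto)
    show "a / (4 * w * sqrt w) * E w = \<bar>- a\<^sup>2 / (4 * b\<^sup>2 * w\<^sup>2)\<bar> * (b / (2 * sqrt (a\<^sup>2 / (4 * b\<^sup>2 * w))) * E (a\<^sup>2 / (4 * b\<^sup>2 * w)))"
      if "w \<in> {0<..}" for w
    proof -
      have w: "w > 0" using that by simp
      have "E (a\<^sup>2 / (4 * b\<^sup>2 * w)) = E w" using a b w by (simp add: E_def field_simps)
      moreover have "a / (4 * w * sqrt w) = \<bar>- a\<^sup>2 / (4 * b\<^sup>2 * w\<^sup>2)\<bar> * (b / (2 * (a / (2 * b * sqrt w))))"
        using a b w real_sqrt_mult_self[of w] by (simp add: field_simps power2_eq_square)
      moreover have "sqrt (a\<^sup>2 / (4 * b\<^sup>2 * w)) = a / (2 * b * sqrt w)"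
        using a b w by (simp add: real_sqrt_divide real_sqrt_mult)
      ultimately show ?thesis by simp
    qed
  qed (use a b in \<open>auto simp: E_def\<close>)
  have "(\<integral>\<^sup>+w. ennreal (indicator {0<..} w * ((b / (2 * sqrt w) + a / (4 * w * sqrt w)) * exp (- (b * sqrt w - a / (2 * sqrt w))\<^sup>2))) \<partial>lborel)
     = (\<integral>\<^sup>+x. ennreal (indicator UNIV x * exp (- x\<^sup>2)) \<partial>lborel)"
  proof (rule nn_integral_change_of_variables_1[where g = "\<lambda>w. b * sqrt w - a / (2 * sqrt w)" and g' = "\<lambda>w. b / (2 * sqrt w) + a / (4 * w * sqrt w)"])
    show "((\<lambda>w. b * sqrt w - a / (2 * sqrt w)) has_real_derivative b / (2 * sqrt x) + a / (4 * x * sqrt x)) (at x)" if "x \<in> {0<..}" for x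
      using that by (auto intro!: derivative_eq_intros) (simp add: field_simps)
    show "inj_on (\<lambda>w. b * sqrt w - a / (2 * sqrt w)) {0<..}"
    proof (rule inj_onI)
      fix x y :: real assume xy: "x \<in> {0<..}" "y \<in> {0<..}" "b * sqrt x - a / (2 * sqrt x) = b * sqrt y - a / (2 * sqrt y)"
      then have p: "sqrt x > 0" "sqrt y > 0" by auto
      have "(sqrt x - sqrt y) * (b + a / (2 * (sqrt x * sqrt y))) = 0"
      proof -
        have "(u - v) * (b + a / (2 * (u * v))) = (b * u - a / (2 * u)) - (b * v - a / (2 * v))"
          if "u > 0" "v > 0" for u v :: real
          using that by (simp add: field_simps)
        from this[OF p] xy(3) show ?thesis by simp
      qed
      moreover have "b + a / (2 * (sqrt x * sqrt y)) > 0" using a b p by (intro add_pos_pos) auto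
      ultimately show "x = y" by auto
    qed
    show "(\<lambda>w. b * sqrt w - a / (2 * sqrt w)) ` {0<..} = UNIV"
    proof (intro set_eqI iffI UNIV_I)
      fix x :: real
      \<comment> \<open>The positive root of b u^2 - x u - a / 2 = 0, that is, the value of sqrt w
        that is mapped to x.\<close>
      define u where "u = (x + sqrt (x\<^sup>2 + 2 * a * b)) / (2 * b)"
      have "\<bar>x\<bar> < sqrt (x\<^sup>2 + 2 * a * b)" using a b by (intro real_less_rsqrt) auto
      then have u: "u > 0" using b by (auto simp: u_def)
      have "2 * b * u - x = sqrt (x\<^sup>2 + 2 * a * b)" using b by (simp add: u_def)
      then have "(2 * b * u - x)\<^sup>2 = x\<^sup>2 + 2 * a * b" using a b by simp
      then have "4 * b * (b * u\<^sup>2) = 4 * b * (x * u + a / 2)"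
        by (simp add: power2_eq_square algebra_simps)
      then have "b * u\<^sup>2 = x * u + a / 2" using b by simp
      then have "x = b * sqrt (u\<^sup>2) - a / (2 * sqrt (u\<^sup>2))"
        using u by (simp add: field_simps power2_eq_square)
      then show "x \<in> (\<lambda>w. b * sqrt w - a / (2 * sqrt w)) ` {0<..}" using u by (intro image_eqI[of _ _ "u\<^sup>2"]) auto
    qed
    show "(b / (2 * sqrt w) + a / (4 * w * sqrt w)) * exp (- (b * sqrt w - a / (2 * sqrt w))\<^sup>2) =
        \<bar>b / (2 * sqrt w) + a / (4 * w * sqrt w)\<bar> * exp (- (b * sqrt w - a / (2 * sqrt w))\<^sup>2)" if "w \<in> {0<..}" for w
      using that a b by simp
  qed auto
  also have "(\<integral>\<^sup>+x. ennreal (indicator UNIV x * exp (- x\<^sup>2)) \<partial>lborel) = ennreal (sqrt pi)"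
    using nn_integral_gauss[of 1, where ?'a = real] by (simp add: powr_half_sqrt)
  finally have Y: "(\<integral>\<^sup>+w. ennreal (indicator {0<..} w * ((b / (2 * sqrt w) + a / (4 * w * sqrt w)) * exp (- (b * sqrt w - a / (2 * sqrt w))\<^sup>2))) \<partial>lborel) = ennreal (sqrt pi)" .
  have "ennreal (exp (- a * b)) * ennreal (sqrt pi) =
    (\<integral>\<^sup>+w. ennreal (exp (- a * b)) * ennreal (indicator {0<..} w * ((b / (2 * sqrt w) + a / (4 * w * sqrt w)) * exp (- (b * sqrt w - a / (2 * sqrt w))\<^sup>2))) \<partial>lborel)"
    by (subst nn_integral_cmult) (auto simp: Y)
  also have "\<dots> = (\<integral>\<^sup>+w. ennreal (indicator {0<..} w * (b / (2 * sqrt w) * E w)) + ennreal (indicator {0<..} w * (a / (4 * w * sqrt w) * E w)) \<partial>lborel)"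
  proof (intro nn_integral_cong)
    fix w :: real
    have "exp (- a * b) * exp (- (b * sqrt w - a / (2 * sqrt w))\<^sup>2) = E w" if "w > 0"
    proof -
      have "(b * u - a / (2 * u))\<^sup>2 = b\<^sup>2 * u\<^sup>2 - a * b + a\<^sup>2 / (4 * u\<^sup>2)" if "u > 0" for u :: real
        using that by (simp add: power2_eq_square field_simps)
      from this[of "sqrt w"] that have "(b * sqrt w - a / (2 * sqrt w))\<^sup>2 = b\<^sup>2 * w - a * b + a\<^sup>2 / (4 * w)"
        by simp
      then show ?thesis by (simp add: E_def mult_exp_exp)
    qed
    then have "exp (- a * b) * ((b / (2 * sqrt w) + a / (4 * w * sqrt w)) * exp (- (b * sqrt w - a / (2 * sqrt w))\<^sup>2))
       = b / (2 * sqrt w) * E w + a / (4 * w * sqrt w) * E w" if "w > 0"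
      using that by (simp add: algebra_simps)
    then show "ennreal (exp (- a * b)) * ennreal (indicator {0<..} w * ((b / (2 * sqrt w) + a / (4 * w * sqrt w)) * exp (- (b * sqrt w - a / (2 * sqrt w))\<^sup>2)))
      = ennreal (indicator {0<..} w * (b / (2 * sqrt w) * E w)) + ennreal (indicator {0<..} w * (a / (4 * w * sqrt w) * E w))"
      using a b by (cases "w > 0") (auto simp: ennreal_mult'[symmetric] E0 ennreal_plus[symmetric] simp del: ennreal_plus)
  qed
  also have "\<dots> = X + X"
    by (subst nn_integral_add) (simp_all only: X X_def[symmetric], simp_all)
  finally have XX: "X + X = ennreal (exp (- a * b) * sqrt pi)" by (simp add: ennreal_mult'[symmetric])
  have "(\<integral>\<^sup>+w. ennreal (indicator {0<..} w * (w powr (- 1 / 2) * E w)) \<partial>lborel)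
     = (\<integral>\<^sup>+w. ennreal (2 / b) * ennreal (indicator {0<..} w * (b / (2 * sqrt w) * E w)) \<partial>lborel)"
    using b by (intro nn_integral_cong)
       (auto simp: ennreal_mult'[symmetric] indicator_def powr_minus powr_half_sqrt field_simps)
  also have "\<dots> = ennreal (2 / b) * X"
    unfolding X_def by (subst nn_integral_cmult) auto
  also have "\<dots> = ennreal (1 / b) * (X + X)"
  proof -
    have "ennreal (2 / b) = ennreal (1 / b) * 2" using b by (metis ennreal_mult' ennreal_numeral mult.commute times_divide_eq_right mult_1_right zero_le_numeral)
    then show ?thesis by (simp add: mult.assoc mult_2)
  qed
  also have "\<dots> = ennreal (sqrt pi * exp (- a * b) / b)"
    using b by (simp add: XX ennreal_mult'[symmetric] mult.commute)
  finally show ?thesis unfolding E_def .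
qed

section \<open>Integrals over the light cone and their Fourier transform\<close>

text \<open>The factor 1 / sqrt pi comes from the subordination formula and Gamma (q / 2) / 2 from
  the radial integral of r^(q - 1) exp (- w r^2).\<close>

definition cone_const :: "real \<Rightarrow> real" where
  "cone_const q = Gamma (q / 2) / (2 * sqrt pi)"

text \<open>The factor 1 / 4 is the heat-kernel normalisation: for R = |z|^2 + y^2 the exponential
  contains the Gaussian exp (- v |z|^2 / 4).\<close>

definition cone_density :: "real \<Rightarrow> real \<Rightarrow> real \<Rightarrow> real \<Rightarrow> real" where
  "cone_density q R l v = indicator {l<..} v * ((v\<^sup>2 - l\<^sup>2) powr (q / 2 - 1) * exp (- v * (R / 4)))"

text \<open>For q, R, l > 0 this is, up to powers of l and R, the Macdonald function of order (q -
  1) / 2 at l R / 4.\<close>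

definition cone :: "real \<Rightarrow> real \<Rightarrow> real \<Rightarrow> real" where
  "cone q R l = (LINT v|lborel. cone_density q R l v)"

lemma cone_density_nonneg [simp]: "0 \<le> cone_density q R l v"
  by (simp add: cone_density_def)

lemma cone_density_measurable [measurable]:
  "(\<lambda>x. cone_density q (f x) (g x) (h x)) \<in> borel_measurable M"
  if [measurable]: "f \<in> borel_measurable M" "g \<in> borel_measurable M" "h \<in> borel_measurable M"
proof -
  have "(\<lambda>x. cone_density q (f x) (g x) (h x)) =
     (\<lambda>x. if g x < h x then ((h x)\<^sup>2 - (g x)\<^sup>2) powr (q / 2 - 1) * exp (- h x * (f x / 4)) else 0)"
    by (auto simp: cone_density_def fun_eq_iff)
  then show ?thesis by simp
qed

text \<open>Putting v = sqrt (r^2 + l^2) turns v^2 - l^2 into r^2 and produces exp (- (R / 4) B) /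
  B, which subordination writes as a mixture of exp (- w B^2). After Tonelli the r-integral is a
  Gamma integral. The constant R^2 / 64 is (R / 4)^2 / 4.\<close>

lemma nn_integral_cone_density:
  fixes q R l :: real assumes q: "q > 0" and R: "R > 0" and l: "l \<ge> 0"
  shows "(\<integral>\<^sup>+v. ennreal (cone_density q R l v) \<partial>lborel) =
    ennreal (cone_const q) * (\<integral>\<^sup>+w. ennreal (indicator {0<..} w * (w powr (- (q + 1) / 2) * exp (- (R\<^sup>2 / 64) / w) * exp (- w * l\<^sup>2))) \<partial>lborel)"
proof -
  define B where "B = (\<lambda>r. sqrt (r\<^sup>2 + l\<^sup>2))"
  have [measurable]: "B \<in> borel_measurable borel" by (simp add: B_def)
  have B: "r \<ge> 0 \<Longrightarrow> B r \<ge> l" "r > 0 \<Longrightarrow> B r > l" "r > 0 \<Longrightarrow> B r > 0" "(B r)\<^sup>2 = r\<^sup>2 + l\<^sup>2" for r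
    using l by (auto simp: B_def sum_power2_gt_zero_iff intro!: real_le_rsqrt real_less_rsqrt)
  have "(\<integral>\<^sup>+v. ennreal (cone_density q R l v) \<partial>lborel) =
     (\<integral>\<^sup>+r. ennreal (indicator {0<..} r * (r powr (q - 1) * exp (- (R / 4) * B r) / B r)) \<partial>lborel)"
    unfolding cone_density_def
  proof (rule nn_integral_change_of_variables_1[symmetric, where g = B and g' = "\<lambda>r. r / B r"])
    show "(B has_real_derivative r / B r) (at r)" if "r \<in> {0<..}" for r
      unfolding B_def using that by (auto intro!: derivative_eq_intros simp: sum_power2_gt_zero_iff field_simps)
        (metis add.commute not_sum_power2_lt_zero)
    show "inj_on B {0<..}"
    proof (rule inj_onI)
      fix x y assume "x \<in> {0<..}" "y \<in> {0<..}" "B x = B y"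
      then have "x\<^sup>2 = y\<^sup>2" using B(4) by (metis add_right_cancel)
      then show "x = y" using \<open>x \<in> _\<close> \<open>y \<in> _\<close> by auto
    qed
    show "B ` {0<..} = {l<..}"
    proof (intro set_eqI iffI)
      fix v assume v: "v \<in> {l<..}"
      then have p: "v\<^sup>2 - l\<^sup>2 > 0" using l by (simp add: power_strict_mono)
      then have "v = B (sqrt (v\<^sup>2 - l\<^sup>2))" using l v by (simp add: B_def)
      then show "v \<in> B ` {0<..}" using p by (intro image_eqI) auto
    qed (use B in auto)
    show "r powr (q - 1) * exp (- (R / 4) * B r) / B r =
         \<bar>r / B r\<bar> * (((B r)\<^sup>2 - l\<^sup>2) powr (q / 2 - 1) * exp (- B r * (R / 4)))" if "r \<in> {0<..}" for r
    proof -
      have "(r\<^sup>2) powr (q / 2 - 1) = r powr (q - 2)"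
        using that by (simp add: powr_powr flip: powr_numeral)
      moreover have "r * r powr (q - 2) = r powr (q - 1)"
        using that powr_add[of r 1 "q - 2"] by simp
      ultimately show ?thesis using B(3)[of r] that by (simp add: B(4)) (simp add: mult_ac)
    qed
  qed auto
  also have "\<dots> = (\<integral>\<^sup>+r. (\<integral>\<^sup>+w. ennreal (indicator {0<..} r * (r powr (q - 1) * (1 / sqrt pi))) *
       ennreal (indicator {0<..} w * (w powr (- 1 / 2) * exp (- (B r)\<^sup>2 * w - (R / 4)\<^sup>2 / (4 * w)))) \<partial>lborel) \<partial>lborel)"
  proof (intro nn_integral_cong)
    fix r :: real
    show "ennreal (indicator {0<..} r * (r powr (q - 1) * exp (- (R / 4) * B r) / B r)) =
      (\<integral>\<^sup>+w. ennreal (indicator {0<..} r * (r powr (q - 1) * (1 / sqrt pi))) *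
       ennreal (indicator {0<..} w * (w powr (- 1 / 2) * exp (- (B r)\<^sup>2 * w - (R / 4)\<^sup>2 / (4 * w)))) \<partial>lborel)"
    proof (cases "r > 0")
      case True
      show ?thesis
        using True R B(3)[OF True]
        by (subst nn_integral_cmult, simp, subst nn_integral_subordination) (auto simp: ennreal_mult'[symmetric])
    qed simp
  qed
  also have "\<dots> = (\<integral>\<^sup>+w. (\<integral>\<^sup>+r. ennreal (indicator {0<..} r * (r powr (q - 1) * (1 / sqrt pi))) *
       ennreal (indicator {0<..} w * (w powr (- 1 / 2) * exp (- (B r)\<^sup>2 * w - (R / 4)\<^sup>2 / (4 * w)))) \<partial>lborel) \<partial>lborel)"
    by (rule lborel_pair.Fubini') simp
  also have "\<dots> = (\<integral>\<^sup>+w. ennreal (cone_const q) * ennreal (indicator {0<..} w * (w powr (- (q + 1) / 2) * exp (- (R\<^sup>2 / 64) / w) * exp (- w * l\<^sup>2))) \<partial>lborel)"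
  proof (intro nn_integral_cong)
    fix w :: real
    show "(\<integral>\<^sup>+r. ennreal (indicator {0<..} r * (r powr (q - 1) * (1 / sqrt pi))) *
       ennreal (indicator {0<..} w * (w powr (- 1 / 2) * exp (- (B r)\<^sup>2 * w - (R / 4)\<^sup>2 / (4 * w)))) \<partial>lborel)
      = ennreal (cone_const q) * ennreal (indicator {0<..} w * (w powr (- (q + 1) / 2) * exp (- (R\<^sup>2 / 64) / w) * exp (- w * l\<^sup>2)))"
    proof (cases "w > 0")
      case True
      define c where "c = w powr (- 1 / 2) * exp (- (R\<^sup>2 / 64) / w) * exp (- w * l\<^sup>2) / sqrt pi"
      have "(\<integral>\<^sup>+r. ennreal (indicator {0<..} r * (r powr (q - 1) * (1 / sqrt pi))) *
       ennreal (indicator {0<..} w * (w powr (- 1 / 2) * exp (- (B r)\<^sup>2 * w - (R / 4)\<^sup>2 / (4 * w)))) \<partial>lborel)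
        = (\<integral>\<^sup>+r. ennreal c * ennreal (indicator {0<..} r * (r powr (q - 1) * exp (- w * r powr 2))) \<partial>lborel)"
      proof (intro nn_integral_cong)
        fix r :: real
        have "exp (- (B r)\<^sup>2 * w - (R / 4)\<^sup>2 / (4 * w)) = exp (- (R\<^sup>2 / 64) / w) * exp (- w * l\<^sup>2) * exp (- w * r\<^sup>2)"
          using True by (simp add: B(4) mult_exp_exp) (simp add: field_simps)
        then show "ennreal (indicator {0<..} r * (r powr (q - 1) * (1 / sqrt pi))) *
       ennreal (indicator {0<..} w * (w powr (- 1 / 2) * exp (- (B r)\<^sup>2 * w - (R / 4)\<^sup>2 / (4 * w))))
         = ennreal c * ennreal (indicator {0<..} r * (r powr (q - 1) * exp (- w * r powr 2)))"
          using True by (cases "r > 0") (auto simp: ennreal_mult'[symmetric] c_def)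
      qed
      also have "\<dots> = ennreal c * ennreal (Gamma (q / 2) * w powr (- q / 2) / \<bar>2\<bar>)"
        using q True by (subst nn_integral_cmult, simp, subst nn_integral_powr_exp) auto
      finally have "(\<integral>\<^sup>+r. ennreal (indicator {0<..} r * (r powr (q - 1) * (1 / sqrt pi))) *
       ennreal (indicator {0<..} w * (w powr (- 1 / 2) * exp (- (B r)\<^sup>2 * w - (R / 4)\<^sup>2 / (4 * w)))) \<partial>lborel) = ennreal c * ennreal (Gamma (q / 2) * w powr (- q / 2) / \<bar>2\<bar>)" .
      moreover have "\<dots> = ennreal (cone_const q * (w powr (- (q + 1) / 2) * exp (- (R\<^sup>2 / 64) / w) * exp (- w * l\<^sup>2)))"
      proof -
        have "w powr (- (q + 1) / 2) = w powr (- 1 / 2) * w powr (- q / 2)"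
          by (subst powr_add[symmetric]) (rule arg_cong[of _ _ "\<lambda>e. w powr e"], simp add: field_simps)
        then show ?thesis
          by (simp add: ennreal_mult'[symmetric] c_def cone_const_def) (simp add: mult_ac)
      qed
      moreover have "cone_const q \<ge> 0" using q by (simp add: cone_const_def Gamma_real_pos less_imp_le)
      ultimately show ?thesis using True by (simp add: ennreal_mult'[symmetric])
    qed simp
  qed
  also have "\<dots> = ennreal (cone_const q) * (\<integral>\<^sup>+w. ennreal (indicator {0<..} w * (w powr (- (q + 1) / 2) * exp (- (R\<^sup>2 / 64) / w) * exp (- w * l\<^sup>2))) \<partial>lborel)"
    by (subst nn_integral_cmult) auto
  finally show ?thesis .
qed

lemma cis_measurable [measurable]:
  "f \<in> borel_measurable M \<Longrightarrow> (\<lambda>x. cis (f x)) \<in> borel_measurable M"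
  by (rule measurable_compose[where g = cis]) (auto intro!: borel_measurable_continuous_onI continuous_intros)

text \<open>Fubini, with one Gaussian transform for each w. As the character has modulus 1,
  \<open>fin\<close> is precisely the absolute integrability of the double integrand.\<close>

lemma gauss_mixture_char:
  fixes \<phi> :: "real \<Rightarrow> real" and \<eta> :: "'a::euclidean_space"
  assumes [measurable]: "\<phi> \<in> borel_measurable borel" and \<phi>0: "\<And>w. w > 0 \<Longrightarrow> \<phi> w \<ge> 0"
    and fin: "(\<integral>\<^sup>+w. ennreal (indicator {0<..} w * (\<phi> w * (pi / w) powr (real DIM('a) / 2))) \<partial>lborel) < \<infinity>"
  shows "has_bochner_integral lborel
     (\<lambda>x. complex_of_real (LINT w|lborel. indicator {0<..} w * (\<phi> w * exp (- w * (norm x)\<^sup>2))) * cis (\<eta> \<bullet> x))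
     (complex_of_real (LINT w|lborel. indicator {0<..} w * (\<phi> w * (pi / w) powr (real DIM('a) / 2) * exp (- (norm \<eta>)\<^sup>2 / (4 * w)))))"
proof -
  define f where "f = (\<lambda>w (x::'a). complex_of_real (indicator {0<..} w * (\<phi> w * exp (- w * (norm x)\<^sup>2))) * cis (\<eta> \<bullet> x))"
  have [measurable]: "case_prod f \<in> borel_measurable (lborel \<Otimes>\<^sub>M lborel)"
    unfolding f_def by measurable
  have int: "integrable (lborel \<Otimes>\<^sub>M lborel) (case_prod f)"
  proof (rule integrableI_bounded)
    have "(\<integral>\<^sup>+ p. ennreal (norm (case_prod f p)) \<partial>(lborel \<Otimes>\<^sub>M lborel)) = (\<integral>\<^sup>+w. (\<integral>\<^sup>+x. ennreal (norm (f w x)) \<partial>lborel) \<partial>lborel)"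
      by (subst lborel.nn_integral_fst[symmetric]) auto
    also have "\<dots> = (\<integral>\<^sup>+w. ennreal (indicator {0<..} w * (\<phi> w * (pi / w) powr (real DIM('a) / 2))) \<partial>lborel)"
    proof (intro nn_integral_cong)
      fix w :: real
      show "(\<integral>\<^sup>+x. ennreal (norm (f w x)) \<partial>lborel) = ennreal (indicator {0<..} w * (\<phi> w * (pi / w) powr (real DIM('a) / 2)))"
      proof (cases "w > 0")
        case True
        then have "(\<integral>\<^sup>+x. ennreal (norm (f w x)) \<partial>lborel) = (\<integral>\<^sup>+x. ennreal (\<phi> w) * ennreal (exp (- w * (norm (x::'a))\<^sup>2)) \<partial>lborel)"
          by (intro nn_integral_cong) (simp add: f_def norm_mult \<phi>0 ennreal_mult'[symmetric])
        also have "\<dots> = ennreal (\<phi> w) * ennreal ((pi / w) powr (real DIM('a) / 2))"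
          by (subst nn_integral_cmult) (auto simp: nn_integral_gauss[OF True, simplified])
        finally show ?thesis using True by (simp add: \<phi>0 ennreal_mult')
      qed (simp add: f_def)
    qed
    finally show "(\<integral>\<^sup>+ p. ennreal (norm (case_prod f p)) \<partial>(lborel \<Otimes>\<^sub>M lborel)) < \<infinity>" using fin by simp
  qed simp
  have i: "integrable lborel (\<lambda>x. LINT w|lborel. f w x)"
    by (rule lborel_pair.integrable_snd[OF int])
  have inner: "(LINT x|lborel. f w x) = complex_of_real (indicator {0<..} w * (\<phi> w * (pi / w) powr (real DIM('a) / 2) * exp (- (norm \<eta>)\<^sup>2 / (4 * w))))" for w
  proof (cases "w > 0")
    case True
    have "(LINT x|lborel. f w x) = (LINT x|lborel. complex_of_real (\<phi> w) * (complex_of_real (exp (- w * (norm x)\<^sup>2)) * cis (\<eta> \<bullet> x)))"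
      using True by (intro Bochner_Integration.integral_cong) (simp_all add: f_def)
    also have "\<dots> = complex_of_real (\<phi> w) * complex_of_real ((pi / w) powr (real DIM('a) / 2) * exp (- (norm \<eta>)\<^sup>2 / (4 * w)))"
      by (subst integral_mult_right_zero, subst has_bochner_integral_integral_eq[OF gauss_char[OF True]]) simp
    finally show ?thesis using True by simp
  qed (simp add: f_def)
  have "(LINT x|lborel. LINT w|lborel. f w x) = (LINT w|lborel. LINT x|lborel. f w x)"
    by (rule lborel_pair.Fubini_integral[OF int])
  then have v: "(LINT x|lborel. LINT w|lborel. f w x) =
     complex_of_real (LINT w|lborel. indicator {0<..} w * (\<phi> w * (pi / w) powr (real DIM('a) / 2) * exp (- (norm \<eta>)\<^sup>2 / (4 * w))))"
    by (simp only: inner integral_complex_of_real)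
  have fe: "(LINT w|lborel. f w x) = complex_of_real (LINT w|lborel. indicator {0<..} w * (\<phi> w * exp (- w * (norm x)\<^sup>2))) * cis (\<eta> \<bullet> x)" for x
    unfolding f_def by (simp only: integral_mult_left_zero integral_complex_of_real)
  show ?thesis
    using i v unfolding fe by (simp only: has_bochner_integral_iff simp_thms)
qed

lemma nn_integral_powr_exp_inverse:
  fixes p c :: real assumes "p > 0" "c > 0"
  shows "(\<integral>\<^sup>+x. ennreal (indicator {0<..} x * (x powr (- p - 1) * exp (- c * x powr (-1)))) \<partial>lborel)
     = ennreal (Gamma p * c powr (- p))"
  using nn_integral_powr_exp[of "- p" "-1" c] assms by simp

text \<open>A modified Bessel function up to a factor; it represents the cone integral as a Gaussian mixture.\<close>

definition bessel_int :: "real \<Rightarrow> real \<Rightarrow> real \<Rightarrow> real" where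
  "bessel_int q R l = (LINT w|lborel. indicator {0<..} w * (w powr (- (q + 1) / 2) * exp (- (R\<^sup>2 / 64) / w) * exp (- w * l\<^sup>2)))"

lemma cone_eq_bessel_int:
  assumes "q > 0" "R > 0" "l \<ge> 0"
  shows "cone q R l = cone_const q * bessel_int q R l"
proof -
  have "cone q R l = enn2real (\<integral>\<^sup>+v. ennreal (cone_density q R l v) \<partial>lborel)"
    unfolding cone_def by (rule integral_eq_nn_integral) auto
  also have "\<dots> = cone_const q * enn2real (\<integral>\<^sup>+w. ennreal (indicator {0<..} w * (w powr (- (q + 1) / 2) * exp (- (R\<^sup>2 / 64) / w) * exp (- w * l\<^sup>2))) \<partial>lborel)"
    using assms by (subst nn_integral_cone_density) (auto simp: enn2real_mult cone_const_def Gamma_real_pos less_imp_le)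
  also have "enn2real (\<integral>\<^sup>+w. ennreal (indicator {0<..} w * (w powr (- (q + 1) / 2) * exp (- (R\<^sup>2 / 64) / w) * exp (- w * l\<^sup>2))) \<partial>lborel) = bessel_int q R l"
    unfolding bessel_int_def by (rule integral_eq_nn_integral[symmetric]) auto
  finally show ?thesis .
qed

lemma cone_const_pos [simp]: "q > 0 \<Longrightarrow> cone_const q > 0"
  by (simp add: cone_const_def Gamma_real_pos)

text \<open>Read off from the mixture: near w = 0 the factor exp (- c / w) beats every power, and
  for w > 1 the power is at most 1 while l > 0 gives exponential decay. The additional - 1 in the
  exponent on (0, 1] only brings the majorant into the form of
  \<open>nn_integral_powr_exp\<close>.\<close>

lemma integrable_cone_density:
  assumes q: "q > 0" and R: "R > 0" and l: "l > 0"
  shows "integrable lborel (cone_density q R l)"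
proof (rule integrableI_nonneg)
  define c where "c = R\<^sup>2 / 64"
  have c: "c > 0" using R by (simp add: c_def)
  have "(\<integral>\<^sup>+w. ennreal (indicator {0<..} w * (w powr (- (q + 1) / 2) * exp (- c / w) * exp (- w * l\<^sup>2))) \<partial>lborel)
     \<le> (\<integral>\<^sup>+w. ennreal (indicator {0<..} w * (w powr (- (q + 1) / 2 - 1) * exp (- c * w powr (-1)))) +
         ennreal (indicator {0<..} w * (w powr (1 - 1) * exp (- (l\<^sup>2) * w powr 1))) \<partial>lborel)"
  proof (intro nn_integral_mono)
    fix w :: real
    have "w powr (- (q + 1) / 2) * exp (- c / w) * exp (- w * l\<^sup>2) \<le> w powr (- (q + 1) / 2 - 1) * exp (- c / w) + exp (- (l\<^sup>2) * w)" if w: "w > 0"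
    proof (cases "w \<le> 1")
      case True
      have "w powr (- (q + 1) / 2) * exp (- c / w) * exp (- w * l\<^sup>2) \<le> w powr (- (q + 1) / 2 - 1) * exp (- c / w) * 1"
        using True w powr_mono'[of "- (q + 1) / 2 - 1" "- (q + 1) / 2" w] by (intro mult_mono) auto
      then show ?thesis by (simp add: add_increasing2)
    next
      case False
      have "w powr (- (q + 1) / 2) \<le> w powr 0" using False q by (intro powr_mono) auto
      then have "w powr (- (q + 1) / 2) * exp (- c / w) * exp (- w * l\<^sup>2) \<le> 1 * 1 * exp (- w * l\<^sup>2)"
        using w c by (intro mult_mono) auto
      then show ?thesis by (simp add: add_increasing mult.commute)
    qed
    then show "ennreal (indicator {0<..} w * (w powr (- (q + 1) / 2) * exp (- c / w) * exp (- w * l\<^sup>2)))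
       \<le> ennreal (indicator {0<..} w * (w powr (- (q + 1) / 2 - 1) * exp (- c * w powr (-1)))) +
         ennreal (indicator {0<..} w * (w powr (1 - 1) * exp (- (l\<^sup>2) * w powr 1)))"
      by (cases "w > 0") (auto simp: ennreal_plus[symmetric] powr_minus_divide simp del: ennreal_plus intro!: ennreal_leI)
  qed
  also have "\<dots> < \<infinity>"
  proof -
    have 1: "(- (q + 1) / 2) / (-1) > 0" using q by simp
    have 2: "(1::real) / 1 > 0" "l\<^sup>2 > 0" using l by auto
    show ?thesis
      by (subst nn_integral_add, simp, simp, subst nn_integral_powr_exp[OF 1 c], simp,
          subst nn_integral_powr_exp[OF 2]) simp_all
  qed
  finally have f: "(\<integral>\<^sup>+w. ennreal (indicator {0<..} w * (w powr (- (q + 1) / 2) * exp (- (R\<^sup>2 / 64) / w) * exp (- w * l\<^sup>2))) \<partial>lborel) < \<infinity>"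
    by (simp add: c_def)
  show "(\<integral>\<^sup>+v. ennreal (cone_density q R l v) \<partial>lborel) < \<infinity>"
    using q R l f by (subst nn_integral_cone_density) (auto simp: ennreal_mult_less_top)
qed auto

lemma nn_integral_cone:
  assumes q: "q > 0" and R: "R > 0" and l: "l > 0"
  shows "(\<integral>\<^sup>+v. ennreal (cone_density q R l v) \<partial>lborel) = ennreal (cone q R l)"
  using integrable_cone_density[OF assms] unfolding cone_def by (intro nn_integral_eq_integral) auto

lemma cone_nonneg [simp]: "0 \<le> cone q R l"
  unfolding cone_def by (intro integral_nonneg_AE) auto

lemma cone_measurable [measurable]:
  assumes [measurable]: "f \<in> borel_measurable M" "g \<in> borel_measurable M"
  shows "(\<lambda>x. cone q (f x) (g x)) \<in> borel_measurable M"
  unfolding cone_def by measurable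

text \<open>With \<alpha> = q + k - 1 and n = k + 1 this is 4^\<alpha> times Marcel Riesz's constant
  pi^((n - 2) / 2) 2^(\<alpha> - 1) Gamma (\<alpha> / 2) Gamma ((\<alpha> + 2 - n) / 2) for the
  light cone in dimension n; the factor 4^\<alpha> reflects R / 4 in the density.\<close>

definition riesz_const :: "real \<Rightarrow> real \<Rightarrow> real" where
  "riesz_const k q = cone_const q * Gamma ((q + k - 1) / 2) * pi powr (k / 2) * 8 powr (q + k - 1)"

text \<open>Transforming each Gaussian of the mixture leaves an inverse Gamma integral with
  parameter R^2 / 64 + |\<eta>|^2 / 4 = (R^2 + 16 |\<eta>|^2) / 64, the origin of the 16 in u. For q
  \<le> 1 the cone integral diverges at x = 0, but that is a null set.\<close>

lemma cone_char:
  fixes \<eta> :: "'a::euclidean_space"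
  assumes q: "q > 0" and R: "R > 0"
  shows "has_bochner_integral lborel (\<lambda>x. complex_of_real (cone q R (norm x)) * cis (\<eta> \<bullet> x))
     (complex_of_real (riesz_const (real DIM('a)) q * (R\<^sup>2 + 16 * (norm \<eta>)\<^sup>2) powr (- (q + real DIM('a) - 1) / 2)))"
proof -
  define k where "k = real DIM('a)"
  have k: "k \<ge> 1" using DIM_positive[where 'a='a] unfolding k_def by linarith
  define \<phi> where "\<phi> = (\<lambda>w::real. w powr (- (q + 1) / 2) * exp (- (R\<^sup>2 / 64) / w))"
  have [measurable]: "\<phi> \<in> borel_measurable borel" by (simp add: \<phi>_def)
  \<comment> \<open>Used with two values of s: s = |\<eta>|^2 is the transformed mixture, and s = 0
    supplies the finiteness condition of \<open>gauss_mixture_char\<close>.\<close>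
  have e: "indicator {0<..} w * (\<phi> w * (pi / w) powr (k / 2) * exp (- s / (4 * w))) =
      pi powr (k / 2) * (indicator {0<..} w * (w powr (- ((q + k - 1) / 2) - 1) * exp (- (R\<^sup>2 / 64 + s / 4) * w powr (-1))))" for w s
  proof (cases "w > 0")
    case True
    have f1: "(pi / w) powr (k / 2) = pi powr (k / 2) * w powr (- (k / 2))"
      using True by (simp add: powr_divide powr_minus_divide)
    have f2: "w powr (- (q + 1) / 2) * w powr (- (k / 2)) = w powr (- ((q + k - 1) / 2) - 1)"
      by (subst powr_add[symmetric]) (rule arg_cong[of _ _ "\<lambda>e. w powr e"], simp add: field_simps)
    have A: "w powr (- (q + 1) / 2) * (pi / w) powr (k / 2) = pi powr (k / 2) * w powr (- ((q + k - 1) / 2) - 1)"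
      unfolding f1 f2[symmetric] by (rule mult.left_commute)
    have B: "exp (- (R\<^sup>2 / 64) / w) * exp (- s / (4 * w)) = exp (- (R\<^sup>2 / 64 + s / 4) * w powr (-1))"
      using True by (simp add: mult_exp_exp powr_minus field_simps)
    have "\<phi> w * (pi / w) powr (k / 2) * exp (- s / (4 * w)) =
        (w powr (- (q + 1) / 2) * (pi / w) powr (k / 2)) * (exp (- (R\<^sup>2 / 64) / w) * exp (- s / (4 * w)))"
      by (simp add: \<phi>_def mult_ac)
    then show ?thesis unfolding A B using True by simp
  qed simp
  have nn: "(\<integral>\<^sup>+w. ennreal (indicator {0<..} w * (\<phi> w * (pi / w) powr (k / 2) * exp (- s / (4 * w)))) \<partial>lborel)
     = ennreal (pi powr (k / 2) * (Gamma ((q + k - 1) / 2) * (R\<^sup>2 / 64 + s / 4) powr (- ((q + k - 1) / 2))))" if "s \<ge> 0" for s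
  proof -
    have p: "R\<^sup>2 / 64 + s / 4 > 0" using R that by (intro add_pos_nonneg) auto
    show ?thesis
      unfolding e
      using q k p
      by (subst ennreal_mult', simp, subst nn_integral_cmult, simp, subst nn_integral_powr_exp_inverse)
         (auto simp: ennreal_mult'[symmetric])
  qed
  have val: "(LINT w|lborel. indicator {0<..} w * (\<phi> w * (pi / w) powr (k / 2) * exp (- s / (4 * w))))
     = pi powr (k / 2) * (Gamma ((q + k - 1) / 2) * (R\<^sup>2 / 64 + s / 4) powr (- ((q + k - 1) / 2)))" if "s \<ge> 0" for s
    using q k by (subst integral_eq_nn_integral, simp, simp add: \<phi>_def, subst nn[OF that])
       (auto simp: Gamma_real_pos less_imp_le)
  have be: "bessel_int q R l = (LINT w|lborel. indicator {0<..} w * (\<phi> w * exp (- w * l\<^sup>2)))" for l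
    by (simp only: bessel_int_def \<phi>_def)
  have "has_bochner_integral lborel
     (\<lambda>x. complex_of_real (LINT w|lborel. indicator {0<..} w * (\<phi> w * exp (- w * (norm x)\<^sup>2))) * cis (\<eta> \<bullet> x))
     (complex_of_real (LINT w|lborel. indicator {0<..} w * (\<phi> w * (pi / w) powr (real DIM('a) / 2) * exp (- (norm \<eta>)\<^sup>2 / (4 * w)))))"
    by (rule gauss_mixture_char) (use nn[of 0] in \<open>auto simp: k_def \<phi>_def\<close>)
  then have "has_bochner_integral lborel (\<lambda>x. complex_of_real (bessel_int q R (norm x)) * cis (\<eta> \<bullet> x))
     (complex_of_real (pi powr (k / 2) * (Gamma ((q + k - 1) / 2) * (R\<^sup>2 / 64 + (norm \<eta>)\<^sup>2 / 4) powr (- ((q + k - 1) / 2)))))"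
    by (simp only: be k_def[symmetric] val[OF zero_le_power2])
  then have "has_bochner_integral lborel (\<lambda>x. complex_of_real (cone_const q) * (complex_of_real (bessel_int q R (norm x)) * cis (\<eta> \<bullet> x)))
     (complex_of_real (cone_const q) * (complex_of_real (pi powr (k / 2) * (Gamma ((q + k - 1) / 2) * (R\<^sup>2 / 64 + (norm \<eta>)\<^sup>2 / 4) powr (- ((q + k - 1) / 2))))))"
    by (rule has_bochner_integral_mult_right)
  also have "(\<lambda>x. complex_of_real (cone_const q) * (complex_of_real (bessel_int q R (norm x)) * cis (\<eta> \<bullet> x))) =
     (\<lambda>x. complex_of_real (cone q R (norm x)) * cis (\<eta> \<bullet> x))"
    using q R by (simp add: cone_eq_bessel_int mult.assoc)
  also have "(R\<^sup>2 / 64 + (norm \<eta>)\<^sup>2 / 4) powr (- ((q + k - 1) / 2)) = 8 powr (q + k - 1) * (R\<^sup>2 + 16 * (norm \<eta>)\<^sup>2) powr (- ((q + k - 1) / 2))"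
  proof -
    have 1: "R\<^sup>2 / 64 + (norm \<eta>)\<^sup>2 / 4 = 8 powr (-2) * (R\<^sup>2 + 16 * (norm \<eta>)\<^sup>2)"
      by (simp add: powr_minus field_simps)
    have 2: "(-2) * (- ((q + k - 1) / 2)) = q + k - 1" by argo
    show ?thesis unfolding 1 powr_mult powr_powr 2 ..
  qed
  finally show ?thesis by (simp add: riesz_const_def k_def mult_ac minus_divide_left)
qed

text \<open>The converse of \<open>cone_char\<close>, computed directly by writing the power as a
  Gamma mixture of Gaussians. The condition q > 1 is the integrability of the power over the whole
  space.\<close>

lemma char_radial_power:
  fixes \<eta> :: "'a::euclidean_space"
  assumes q: "q > 1" and R: "R > 0"
  shows "has_bochner_integral lborel
     (\<lambda>x. complex_of_real ((R\<^sup>2 + 16 * (norm x)\<^sup>2) powr (- (q + real DIM('a) - 1) / 2)) * cis (\<eta> \<bullet> x))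
     (complex_of_real ((2 * pi) powr real DIM('a) / riesz_const (real DIM('a)) q * cone q R (norm \<eta>)))"
proof -
  define k where "k = real DIM('a)"
  have k: "k \<ge> 1" using DIM_positive[where 'a='a] unfolding k_def by linarith
  define N where "N = q + k - 1"
  have N: "N > 0" using q k by (simp add: N_def)
  define \<phi> where "\<phi> = (\<lambda>w::real. w powr (N / 2 - 1) * exp (- (R\<^sup>2 / 16) * w powr 1))"
  have [measurable]: "\<phi> \<in> borel_measurable borel" by (simp add: \<phi>_def)
  \<comment> \<open>The factor 4^N comes from R^2 / 16 + s = (R^2 + 16 s) / 16.\<close>
  have G: "(LINT w|lborel. indicator {0<..} w * (\<phi> w * exp (- w * s))) = Gamma (N / 2) * 4 powr N * (R\<^sup>2 + 16 * s) powr (- N / 2)" if s: "s \<ge> 0" for s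
  proof -
    have p: "R\<^sup>2 / 16 + s > 0" using R s by (intro add_pos_nonneg) auto
    have "indicator {0<..} w * (\<phi> w * exp (- w * s)) = indicator {0<..} w * (w powr (N / 2 - 1) * exp (- (R\<^sup>2 / 16 + s) * w powr 1))" for w
      by (cases "w > 0") (auto simp: \<phi>_def mult_exp_exp algebra_simps)
    then have "(LINT w|lborel. indicator {0<..} w * (\<phi> w * exp (- w * s))) =
        (LINT w|lborel. indicator {0<..} w * (w powr (N / 2 - 1) * exp (- (R\<^sup>2 / 16 + s) * w powr 1)))"
      by (simp only:)
    also have "\<dots> = enn2real (\<integral>\<^sup>+w. ennreal (indicator {0<..} w * (w powr (N / 2 - 1) * exp (- (R\<^sup>2 / 16 + s) * w powr 1))) \<partial>lborel)"
      by (rule integral_eq_nn_integral) auto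
    also have "\<dots> = Gamma (N / 2) * (R\<^sup>2 / 16 + s) powr (- N / 2)"
      using p N by (subst nn_integral_powr_exp) (auto simp: Gamma_real_pos less_imp_le)
    finally have "(LINT w|lborel. indicator {0<..} w * (\<phi> w * exp (- w * s))) = Gamma (N / 2) * (R\<^sup>2 / 16 + s) powr (- N / 2)" .
    moreover have 1: "R\<^sup>2 / 16 + s = 4 powr (-2) * (R\<^sup>2 + 16 * s)" by (simp add: powr_minus field_simps)
    moreover have 2: "(-2) * (- N / 2) = N" by simp
    ultimately show ?thesis unfolding 1 powr_mult powr_powr 2 by simp
  qed
  have expo: "w powr (N / 2 - 1) * (pi / w) powr (k / 2) = pi powr (k / 2) * w powr ((q - 1) / 2 - 1)" if "w > 0" for w
  proof -
    have f1: "(pi / w) powr (k / 2) = pi powr (k / 2) * w powr (- (k / 2))"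
      using that by (simp add: powr_divide powr_minus_divide)
    have f2: "w powr (N / 2 - 1) * w powr (- (k / 2)) = w powr ((q - 1) / 2 - 1)"
      by (subst powr_add[symmetric]) (rule arg_cong[of _ _ "\<lambda>e. w powr e"], simp add: N_def field_simps)
    show ?thesis unfolding f1 f2[symmetric] by (rule mult.left_commute)
  qed
  have "(\<integral>\<^sup>+w. ennreal (indicator {0<..} w * (\<phi> w * (pi / w) powr (k / 2))) \<partial>lborel)
     = (\<integral>\<^sup>+w. ennreal (pi powr (k / 2)) * ennreal (indicator {0<..} w * (w powr ((q - 1) / 2 - 1) * exp (- (R\<^sup>2 / 16) * w powr 1))) \<partial>lborel)"
  proof (intro nn_integral_cong)
    fix w :: real
    show "ennreal (indicator {0<..} w * (\<phi> w * (pi / w) powr (k / 2))) =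
      ennreal (pi powr (k / 2)) * ennreal (indicator {0<..} w * (w powr ((q - 1) / 2 - 1) * exp (- (R\<^sup>2 / 16) * w powr 1)))"
    proof (cases "w > 0")
      case True
      have "\<phi> w * (pi / w) powr (k / 2) = (w powr (N / 2 - 1) * (pi / w) powr (k / 2)) * exp (- (R\<^sup>2 / 16) * w powr 1)"
        by (simp add: \<phi>_def)
      then show ?thesis using True unfolding expo[OF True] by (simp add: ennreal_mult'[symmetric] mult.assoc)
    qed simp
  qed
  also have "\<dots> < \<infinity>"
    using q R
    by (subst nn_integral_cmult, simp, subst nn_integral_powr_exp) (auto simp: ennreal_mult_less_top)
  finally have fin: "(\<integral>\<^sup>+w. ennreal (indicator {0<..} w * (\<phi> w * (pi / w) powr (k / 2))) \<partial>lborel) < \<infinity>" .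
  \<comment> \<open>The substitution w -> 1 / (4 w) changes exp (- s^2 / (4 w)) into exp (- w s^2)
    and exp (- R^2 w / 16) into exp (- (R^2 / 64) / w), so the transformed mixture is again
    \<open>bessel_int\<close>.\<close>
  have val: "(LINT w|lborel. indicator {0<..} w * (\<phi> w * (pi / w) powr (k / 2) * exp (- s\<^sup>2 / (4 * w))))
     = pi powr (k / 2) * 2 powr (1 - q) * bessel_int q R s" for s
  proof -
    have "(\<integral>\<^sup>+w. ennreal (indicator {0<..} w * (2 powr (1 - q) * (w powr (- (q + 1) / 2) * exp (- (R\<^sup>2 / 64) / w) * exp (- w * s\<^sup>2)))) \<partial>lborel)
      = (\<integral>\<^sup>+w. ennreal (indicator {0<..} w * (w powr ((q - 1) / 2 - 1) * exp (- (R\<^sup>2 / 16) * w) * exp (- s\<^sup>2 / (4 * w)))) \<partial>lborel)"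
    proof (rule nn_integral_change_of_variables_1[where g = "\<lambda>w. 1 / (4 * w)" and g' = "\<lambda>w. - 1 / (4 * w\<^sup>2)"])
      show "((\<lambda>w. 1 / (4 * w)) has_real_derivative - 1 / (4 * w\<^sup>2)) (at w)" if "w \<in> {0<..}" for w :: real
        using that by (auto intro!: derivative_eq_intros simp: divide_simps power2_eq_square)
      show "inj_on (\<lambda>w::real. 1 / (4 * w)) {0<..}" by (auto simp: inj_on_def)
      show "(\<lambda>w. 1 / (4 * w)) ` {0<..} = ({0<..} :: real set)"
      proof (intro set_eqI iffI)
        fix y :: real assume y: "y \<in> {0<..}"
        then have "y = 1 / (4 * (1 / (4 * y)))" by simp
        then show "y \<in> (\<lambda>w. 1 / (4 * w)) ` {0<..}" by (rule image_eqI) (use y in auto)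
      qed auto
      show "2 powr (1 - q) * (w powr (- (q + 1) / 2) * exp (- (R\<^sup>2 / 64) / w) * exp (- w * s\<^sup>2)) =
         \<bar>- 1 / (4 * w\<^sup>2)\<bar> * ((1 / (4 * w)) powr ((q - 1) / 2 - 1) * exp (- (R\<^sup>2 / 16) * (1 / (4 * w))) * exp (- s\<^sup>2 / (4 * (1 / (4 * w)))))"
        if "w \<in> {0<..}" for w
      proof -
        have w: "w > 0" using that by simp
        have "4 * w\<^sup>2 = 2 powr 2 * w powr 2" using w by simp
        moreover have "1 / (4 * w) = 2 powr (-2) * w powr (-1)" using w by (simp add: powr_minus field_simps)
        then have "(1 / (4 * w)) powr ((q - 1) / 2 - 1) = 2 powr (-2 * ((q - 1) / 2 - 1)) * w powr (- ((q - 1) / 2 - 1))"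
          by (simp only: powr_mult powr_powr) simp
        ultimately have "\<bar>- 1 / (4 * w\<^sup>2)\<bar> * (1 / (4 * w)) powr ((q - 1) / 2 - 1) =
           (2 powr (-2 * ((q - 1) / 2 - 1)) / 2 powr 2) * (w powr (- ((q - 1) / 2 - 1)) / w powr 2)"
          using w by simp
        also have "\<dots> = 2 powr (-2 * ((q - 1) / 2 - 1) - 2) * w powr (- ((q - 1) / 2 - 1) - 2)"
          by (simp only: powr_diff)
        also have "-2 * ((q - 1) / 2 - 1) - 2 = 1 - q" by argo
        also have "- ((q - 1) / 2 - 1) - 2 = - (q + 1) / 2" by argo
        finally show ?thesis using w by (simp add: mult.assoc[symmetric])
      qed
    qed auto
    then have "2 powr (1 - q) * bessel_int q R s = (LINT w|lborel. indicator {0<..} w * (w powr ((q - 1) / 2 - 1) * exp (- (R\<^sup>2 / 16) * w) * exp (- s\<^sup>2 / (4 * w))))"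
      unfolding bessel_int_def integral_mult_right_zero[symmetric]
      by (subst (1 2) integral_eq_nn_integral) (auto simp: mult_ac)
    then have "pi powr (k / 2) * 2 powr (1 - q) * bessel_int q R s =
      (LINT w|lborel. pi powr (k / 2) * (indicator {0<..} w * (w powr ((q - 1) / 2 - 1) * exp (- (R\<^sup>2 / 16) * w) * exp (- s\<^sup>2 / (4 * w)))))"
      by (simp add: mult.assoc)
    also have "\<dots> = (LINT w|lborel. indicator {0<..} w * (\<phi> w * (pi / w) powr (k / 2) * exp (- s\<^sup>2 / (4 * w))))"
    proof (intro Bochner_Integration.integral_cong refl)
      fix w :: real
      show "pi powr (k / 2) * (indicator {0<..} w * (w powr ((q - 1) / 2 - 1) * exp (- (R\<^sup>2 / 16) * w) * exp (- s\<^sup>2 / (4 * w))))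
        = indicator {0<..} w * (\<phi> w * (pi / w) powr (k / 2) * exp (- s\<^sup>2 / (4 * w)))"
      proof (cases "w > 0")
        case True
        have "\<phi> w * (pi / w) powr (k / 2) = (w powr (N / 2 - 1) * (pi / w) powr (k / 2)) * exp (- (R\<^sup>2 / 16) * w)"
          using True by (simp add: \<phi>_def)
        then show ?thesis using True unfolding expo[OF True] by simp
      qed simp
    qed
    finally show ?thesis by simp
  qed
  have "has_bochner_integral lborel
     (\<lambda>x. complex_of_real (LINT w|lborel. indicator {0<..} w * (\<phi> w * exp (- w * (norm x)\<^sup>2))) * cis (\<eta> \<bullet> x))
     (complex_of_real (LINT w|lborel. indicator {0<..} w * (\<phi> w * (pi / w) powr (real DIM('a) / 2) * exp (- (norm \<eta>)\<^sup>2 / (4 * w)))))"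
    by (rule gauss_mixture_char) (use fin in \<open>auto simp: k_def \<phi>_def\<close>)
  then have h: "has_bochner_integral lborel
     (\<lambda>x. complex_of_real (Gamma (N / 2) * 4 powr N * (R\<^sup>2 + 16 * (norm x)\<^sup>2) powr (- N / 2)) * cis (\<eta> \<bullet> x))
     (complex_of_real (pi powr (k / 2) * 2 powr (1 - q) * bessel_int q R (norm \<eta>)))"
    by (simp only: k_def[symmetric] val G zero_le_power2)
  define C where "C = Gamma (N / 2) * 4 powr N"
  have C: "C > 0" using N by (simp add: C_def Gamma_real_pos)
  have "has_bochner_integral lborel
     (\<lambda>x. complex_of_real (1 / C) * (complex_of_real (C * (R\<^sup>2 + 16 * (norm x)\<^sup>2) powr (- N / 2)) * cis (\<eta> \<bullet> x)))
     (complex_of_real (1 / C) * (complex_of_real (pi powr (k / 2) * 2 powr (1 - q) * bessel_int q R (norm \<eta>))))"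
    using h unfolding C_def[symmetric] by (rule has_bochner_integral_mult_right)
  moreover have "(\<lambda>x. complex_of_real (1 / C) * (complex_of_real (C * (R\<^sup>2 + 16 * (norm x)\<^sup>2) powr (- N / 2)) * cis (\<eta> \<bullet> x)))
     = (\<lambda>x. complex_of_real ((R\<^sup>2 + 16 * (norm x)\<^sup>2) powr (- N / 2)) * cis (\<eta> \<bullet> x))"
    using C by (auto simp: fun_eq_iff)
  moreover have "1 / C * (pi powr (k / 2) * 2 powr (1 - q) * bessel_int q R (norm \<eta>)) = (2 * pi) powr k / riesz_const k q * cone q R (norm \<eta>)"
  proof -
    \<comment> \<open>The powers of 2 have to be matched: 4^N stems from the Gamma mixture, 2^(1 -
      q) from the substitution, and 8^N sits in \<open>riesz_const\<close>.\<close>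
    have "8 powr N = 2 powr (3 * N)" "4 powr N = 2 powr (2 * N)" 
      using powr_powr[of 2 3 N] powr_powr[of 2 2 N] by simp_all
    moreover have "1 - q + 3 * N = k + 2 * N" by (simp add: N_def)
    ultimately have "2 powr (1 - q) * 8 powr N = 2 powr k * 4 powr N"
      by (simp only: powr_add[symmetric])
    then have t: "2 powr (1 - q) / 4 powr N = 2 powr k / 8 powr N" by (simp add: field_simps)
    have g: "Gamma (N / 2) \<noteq> 0" using Gamma_real_pos[of "N / 2"] N by linarith
    have cc: "cone_const q \<noteq> 0" using cone_const_pos[of q] q by linarith
    have pp: "pi powr k = pi powr (k/2) * pi powr (k/2)" by (simp add: powr_add[symmetric])
    have "1 / C * (pi powr (k / 2) * 2 powr (1 - q) * bessel_int q R (norm \<eta>)) =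
       (2 powr (1 - q) / 4 powr N) * (pi powr (k / 2) / Gamma (N / 2) * bessel_int q R (norm \<eta>))" by (simp add: C_def mult_ac)
    also have "\<dots> = (2 powr k / 8 powr N) * (pi powr (k / 2) / Gamma (N / 2) * bessel_int q R (norm \<eta>))" by (simp only: t)
    also have "\<dots> = (2 * pi) powr k / riesz_const k q * cone q R (norm \<eta>)"
      using cc q R g
      by (simp add: riesz_const_def cone_eq_bessel_int N_def[symmetric] powr_mult pp)
    finally show ?thesis .
  qed
  ultimately show ?thesis
    unfolding k_def[symmetric] N_def[symmetric] by (simp only: of_real_mult[symmetric])
qed

section \<open>The regularised time integral\<close>

text \<open>For a nonnegative integrand the one-sided limits of a primitive already force absolute
  integrability, so singular endpoints are allowed.\<close>

lemma has_bochner_integral_FTC_Ioo: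
  fixes f F :: "real \<Rightarrow> real"
  assumes "a < b"
    and F: "\<And>x. a < x \<Longrightarrow> x < b \<Longrightarrow> (F has_real_derivative f x) (at x)"
    and f: "\<And>x. a < x \<Longrightarrow> x < b \<Longrightarrow> isCont f x"
    and f0: "\<And>x. a < x \<Longrightarrow> x < b \<Longrightarrow> 0 \<le> f x"
    and A: "(F \<longlongrightarrow> A) (at_right a)" and B: "(F \<longlongrightarrow> B) (at_left b)"
  shows "has_bochner_integral lborel (\<lambda>x. indicator {a<..<b} x * f x) (B - A)"
proof -
  have "set_integrable lborel (einterval a b) f" "(LBINT x=a..b. f x) = B - A"
    by (rule interval_integral_FTC_nonneg[where F = F and A = A and B = B]; use assms in \<open>auto simp: ereal_tendsto_simps\<close>)+
  then show ?thesis
    using \<open>a < b\<close> by (simp add: has_bochner_integral_iff set_integrable_def interval_lebesgue_integral_def set_lebesgue_integral_def)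
qed

lemma has_bochner_integral_FTC_Ioi:
  fixes f F :: "real \<Rightarrow> real"
  assumes F: "\<And>x. a < x \<Longrightarrow> (F has_real_derivative f x) (at x)"
    and f: "\<And>x. a < x \<Longrightarrow> isCont f x"
    and f0: "\<And>x. a < x \<Longrightarrow> 0 \<le> f x"
    and A: "(F \<longlongrightarrow> A) (at_right a)" and B: "(F \<longlongrightarrow> B) at_top"
  shows "has_bochner_integral lborel (\<lambda>x. indicator {a<..} x * f x) (B - A)"
proof -
  have "set_integrable lborel (einterval a \<infinity>) f" "(LBINT x=a..\<infinity>. f x) = B - A"
    by (rule interval_integral_FTC_nonneg[where F = F and A = A and B = B]; use assms in \<open>auto simp: ereal_tendsto_simps\<close>)+
  then show ?thesis
    by (simp add: has_bochner_integral_iff set_integrable_def interval_lebesgue_integral_def set_lebesgue_integral_def)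
qed

lemma nn_integral_has_bochner:
  assumes "has_bochner_integral M f (x::real)" "\<And>t. 0 \<le> f t"
  shows "(\<integral>\<^sup>+t. ennreal (f t) \<partial>M) = ennreal x"
  using assms by (simp add: has_bochner_integral_iff nn_integral_eq_integral)

text \<open>Integration by parts in the form of Tonelli: 1 - exp (- v) is the integral of exp (- r)
  over 0 < r < v, and integrating v^(- s - 1) over v > r first leaves Gamma (1 - s) / s.\<close>

lemma nn_integral_powr_one_minus_exp:
  fixes s :: real assumes s: "0 < s" "s < 1"
  shows "(\<integral>\<^sup>+v. ennreal (indicator {0<..} v * (v powr (- s - 1) * (1 - exp (- v)))) \<partial>lborel) = ennreal (Gamma (1 - s) / s)"
proof -
  have a: "(\<integral>\<^sup>+r. ennreal (indicator {0<..<v} r * exp (- r)) \<partial>lborel) = ennreal (1 - exp (- v))" if "v > 0" for v :: real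
  proof (rule nn_integral_has_bochner)
    have "has_bochner_integral lborel (\<lambda>r. indicator {0<..<v} r * exp (- r)) (- exp (- v) - (- exp (- 0)))"
    proof (rule has_bochner_integral_FTC_Ioo)
      show "((\<lambda>r. - exp (- r)) has_real_derivative exp (- x)) (at x)" for x :: real
        by (auto intro!: derivative_eq_intros)
      show "((\<lambda>r::real. - exp (- r)) \<longlongrightarrow> - exp (- 0)) (at_right 0)"
        by (intro tendsto_intros)
      show "((\<lambda>r::real. - exp (- r)) \<longlongrightarrow> - exp (- v)) (at_left v)"
        by (intro tendsto_intros)
    qed (use that in auto)
    then show "has_bochner_integral lborel (\<lambda>r. indicator {0<..<v} r * exp (- r)) (1 - exp (- v))" by simp
  qed auto
  have b: "(\<integral>\<^sup>+v. ennreal (indicator {r<..} v * v powr (- s - 1)) \<partial>lborel) = ennreal (r powr (- s) / s)" if "r > 0" for r :: real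
  proof (rule nn_integral_has_bochner)
    have "has_bochner_integral lborel (\<lambda>v. indicator {r<..} v * v powr (- s - 1)) (0 - (- (r powr (- s) / s)))"
    proof (rule has_bochner_integral_FTC_Ioi)
      show "((\<lambda>v. - (v powr - s / s)) has_real_derivative v powr (- s - 1)) (at v)" if "r < v" for v
        using that \<open>r > 0\<close> s by (auto intro!: derivative_eq_intros)
      show "((\<lambda>v. - (v powr - s / s)) \<longlongrightarrow> - (r powr - s / s)) (at_right r)"
        using that s by (intro tendsto_intros) auto
      show "((\<lambda>v. - (v powr - s / s)) \<longlongrightarrow> 0) at_top"
      proof -
        have "((\<lambda>v::real. v powr - s) \<longlongrightarrow> 0) at_top"
          by (rule tendsto_neg_powr) (use s in \<open>auto intro: filterlim_ident\<close>)
        from tendsto_minus[OF tendsto_divide[OF this tendsto_const[of s]]] s show ?thesis by simp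
      qed
    qed (use that in \<open>auto intro!: continuous_intros\<close>)
    then show "has_bochner_integral lborel (\<lambda>v. indicator {r<..} v * v powr (- s - 1)) (r powr (- s) / s)" by simp
  qed auto
  have "(\<integral>\<^sup>+v. ennreal (indicator {0<..} v * (v powr (- s - 1) * (1 - exp (- v)))) \<partial>lborel)
    = (\<integral>\<^sup>+v. (\<integral>\<^sup>+r. ennreal (if 0 < r \<and> r < v then v powr (- s - 1) * exp (- r) else 0) \<partial>lborel) \<partial>lborel)"
  proof (intro nn_integral_cong)
    fix v :: real
    show "ennreal (indicator {0<..} v * (v powr (- s - 1) * (1 - exp (- v)))) = (\<integral>\<^sup>+r. ennreal (if 0 < r \<and> r < v then v powr (- s - 1) * exp (- r) else 0) \<partial>lborel)"
    proof (cases "v > 0")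
      case True
      have "(\<integral>\<^sup>+r. ennreal (if 0 < r \<and> r < v then v powr (- s - 1) * exp (- r) else 0) \<partial>lborel)
        = (\<integral>\<^sup>+r. ennreal (v powr (- s - 1)) * ennreal (indicator {0<..<v} r * exp (- r)) \<partial>lborel)"
        by (intro nn_integral_cong) (auto simp: ennreal_mult'[symmetric])
      also have "\<dots> = ennreal (v powr (- s - 1)) * ennreal (1 - exp (- v))"
        by (subst nn_integral_cmult) (auto simp: a[OF True])
      finally show ?thesis using True by (simp add: ennreal_mult'[symmetric])
    next
      case False
      then have "(\<integral>\<^sup>+r. ennreal (if 0 < r \<and> r < v then v powr (- s - 1) * exp (- r) else 0) \<partial>lborel) = (\<integral>\<^sup>+(r::real). 0 \<partial>lborel)"
        by (intro nn_integral_cong) auto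
      then show ?thesis using False by simp
    qed
  qed
  also have "\<dots> = (\<integral>\<^sup>+r. (\<integral>\<^sup>+v. ennreal (if 0 < r \<and> r < v then v powr (- s - 1) * exp (- r) else 0) \<partial>lborel) \<partial>lborel)"
    by (rule lborel_pair.Fubini') measurable
  also have "\<dots> = (\<integral>\<^sup>+r. ennreal (1 / s) * ennreal (indicator {0<..} r * (r powr ((1 - s) - 1) * exp (- 1 * r powr 1))) \<partial>lborel)"
  proof (intro nn_integral_cong)
    fix r :: real
    show "(\<integral>\<^sup>+v. ennreal (if 0 < r \<and> r < v then v powr (- s - 1) * exp (- r) else 0) \<partial>lborel)
       = ennreal (1 / s) * ennreal (indicator {0<..} r * (r powr ((1 - s) - 1) * exp (- 1 * r powr 1)))"
    proof (cases "r > 0")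
      case True
      have "(\<integral>\<^sup>+v. ennreal (if 0 < r \<and> r < v then v powr (- s - 1) * exp (- r) else 0) \<partial>lborel)
        = (\<integral>\<^sup>+v. ennreal (exp (- r)) * ennreal (indicator {r<..} v * v powr (- s - 1)) \<partial>lborel)"
        using True by (intro nn_integral_cong) (auto simp: ennreal_mult'[symmetric])
      also have "\<dots> = ennreal (exp (- r)) * ennreal (r powr (- s) / s)"
        by (subst nn_integral_cmult) (auto simp: b[OF True])
      finally show ?thesis using True s by (simp add: ennreal_mult'[symmetric] mult.commute)
    qed simp
  qed
  also have "\<dots> = ennreal (1 / s) * ennreal (Gamma (1 - s))"
    using s by (subst nn_integral_cmult, simp, subst nn_integral_powr_exp) auto
  also have "\<dots> = ennreal (Gamma (1 - s) / s)"
    using s by (simp add: ennreal_mult'[symmetric])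
  finally show ?thesis .
qed

section \<open>The time parameter w = l coth (l t)\<close>

definition lcoth :: "real \<Rightarrow> real \<Rightarrow> real" where
  "lcoth l t = l / tanh (t * l)"

lemma tanh_measurable [measurable]:
  "f \<in> borel_measurable M \<Longrightarrow> (\<lambda>x. tanh (f x) :: real) \<in> borel_measurable M"
  by (rule measurable_compose[where g = tanh]) (auto intro!: borel_measurable_continuous_onI continuous_intros)

lemma lcoth_measurable [measurable]:
  assumes [measurable]: "f \<in> borel_measurable M" "g \<in> borel_measurable M"
  shows "(\<lambda>x. lcoth (f x) (g x)) \<in> borel_measurable M"
  unfolding lcoth_def by measurable

lemma sinh_real_ge_self: "x \<ge> 0 \<Longrightarrow> sinh x \<ge> (x::real)"
proof -
  assume "x \<ge> 0"
  have "(\<lambda>x. sinh x - x) 0 \<le> (\<lambda>x. sinh x - x) x"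
    by (rule DERIV_nonneg_imp_nondecreasing[OF \<open>x \<ge> 0\<close>])
       (auto intro!: exI derivative_eq_intros simp: cosh_real_ge_1)
  then show ?thesis by simp
qed

lemma lcoth_sq: "l > 0 \<Longrightarrow> t > 0 \<Longrightarrow> (lcoth l t)\<^sup>2 - l\<^sup>2 = (l / sinh (t * l))\<^sup>2"
proof -
  assume "l > 0" "t > 0"
  then have S: "sinh (t * l) \<noteq> 0" by simp
  have "(l * c / S)\<^sup>2 - l\<^sup>2 = (l / S)\<^sup>2" if "S \<noteq> 0" "c\<^sup>2 = S\<^sup>2 + 1" for c S :: real
    using that by (simp add: power_divide power_mult_distrib) (simp add: field_simps)
  from this[OF S cosh_square_eq] show ?thesis
    by (simp add: lcoth_def tanh_def)
qed

lemma lcoth_gt: "l > 0 \<Longrightarrow> t > 0 \<Longrightarrow> l < lcoth l t"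
  using tanh_real_lt_1[of "t * l"] by (simp add: lcoth_def field_simps)

text \<open>The Riccati equation w' = l^2 - w^2. It makes w usable as a time coordinate: the factor
  w^2 - l^2 in front of the heat factor is its Jacobian.\<close>

lemma lcoth_deriv:
  assumes "l > 0" "t > 0"
  shows "(lcoth l has_real_derivative - ((lcoth l t)\<^sup>2 - l\<^sup>2)) (at t)"
proof -
  have T: "tanh (t * l) \<noteq> 0" and c: "cosh (t * l) \<noteq> 0" using assms by (auto simp: cosh_real_nonzero)
  have "- (l * ((1 - T\<^sup>2) * l)) / (T * T) = - ((l / T)\<^sup>2 - l\<^sup>2)" if "T \<noteq> 0" for T :: real
    using that by (simp add: field_simps power2_eq_square)
  from this[OF T] show ?thesis unfolding lcoth_def[abs_def]
    using T c by (auto intro!: derivative_eq_intros)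
qed

lemma lcoth_ge: assumes "l > 0" "t > 0" shows "1 / t \<le> lcoth l t"
proof -
  have "tanh (t * l) > 0" using assms by simp
  moreover have "tanh (t * l) \<le> t * l"
  proof -
    have "(\<lambda>x. x - tanh x) 0 \<le> (\<lambda>x. x - tanh x) (t * l)"
      by (rule DERIV_nonneg_imp_nondecreasing)
         (use assms in \<open>auto intro!: exI derivative_eq_intros simp: cosh_real_nonzero\<close>)
    then show ?thesis by simp
  qed
  ultimately show ?thesis using assms by (simp add: lcoth_def field_simps)
qed

text \<open>Since x (cosh x - sinh x) = x exp (- x) \<le> x \<le> sinh x, one has x coth x \<le> 1 +
  x. Together with \<open>lcoth_ge\<close> this confines w to [1 / t, 1 / t + l], which makes w^s -
  t^(- s) vanish as t tends to 0.\<close>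

lemma lcoth_le: assumes "l > 0" "t > 0" shows "lcoth l t \<le> 1 / t + l"
proof -
  define x where "x = t * l"
  have x: "x > 0" using assms by (simp add: x_def)
  have "x * (cosh x - sinh x) \<le> x * 1" using x by (intro mult_left_mono) (auto simp: cosh_minus_sinh)
  also have "\<dots> \<le> sinh x" using sinh_real_ge_self[of x] x by simp
  finally have "x * cosh x / sinh x \<le> 1 + x" using x by (simp add: field_simps)
  moreover have "lcoth l t = (x * cosh x / sinh x) / t" using assms x by (simp add: lcoth_def tanh_def x_def)
  moreover have "1 / t + l = (1 + x) / t" using assms by (simp add: x_def field_simps)
  ultimately show ?thesis using assms by (simp only: divide_right_mono)
qed

lemma lcoth_decreasing:
  assumes "l > 0" "0 < t" "t < t'" shows "lcoth l t' < lcoth l t"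
proof -
  have "tanh (t * l) > 0" "tanh (t * l) < tanh (t' * l)" using assms by auto
  then show ?thesis using assms unfolding lcoth_def by (intro divide_strict_left_mono) auto
qed

lemma tanh_artanh_real:
  fixes x :: real assumes "-1 < x" "x < 1" shows "tanh (artanh x) = x"
proof -
  have "exp (- 2 * artanh x) = inverse (exp (ln ((1 + x) / (1 - x))))"
    by (simp add: artanh_def exp_minus)
  also have "\<dots> = (1 - x) / (1 + x)" using assms by simp
  finally have e: "exp (- 2 * artanh x) = (1 - x) / (1 + x)" .
  have "(1 - (1 - x) / (1 + x)) / (1 + (1 - x) / (1 + x)) = x"
    using assms by (simp add: divide_simps)
  then show ?thesis unfolding tanh_real_altdef e .
qed

lemma lcoth_surj:
  assumes "l > 0" "l < V" obtains t where "t > 0" "lcoth l t = V"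
proof
  have "0 < l / V" "l / V < 1" using assms by auto
  then show "artanh (l / V) / l > 0" using assms 
    by (auto simp: artanh_def intro!: divide_pos_pos ln_gt_zero)
  show "lcoth l (artanh (l / V) / l) = V"
  proof -
    have "tanh (artanh (l / V)) = l / V"
      using \<open>0 < l / V\<close> \<open>l / V < 1\<close> by (intro tanh_artanh_real) linarith+
    then show ?thesis using assms by (simp add: lcoth_def)
  qed
qed

lemma lcoth_at_0: assumes "l > 0" shows "filterlim (lcoth l) at_top (at_right 0)"
proof (rule filterlim_at_top_mono)
  show "filterlim (\<lambda>t. 1 / t :: real) at_top (at_right 0)" by real_asymp
  show "\<forall>\<^sub>F t in at_right 0. 1 / t \<le> lcoth l t"
    using lcoth_ge[OF assms] by (auto simp: eventually_at_right_less eventually_at_filter)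
qed

lemma lcoth_at_top: assumes "l > 0" shows "(lcoth l \<longlongrightarrow> l) at_top"
proof -
  have "((\<lambda>t. l / tanh (t * l)) \<longlongrightarrow> l / 1) at_top"
    using assms by (intro tendsto_intros filterlim_compose[OF tanh_real_at_top] filterlim_at_top_mult_tendsto_pos[of _ l]
       filterlim_ident) (auto intro: tendsto_const)
  then show ?thesis by (simp add: lcoth_def[abs_def])
qed

section \<open>The regularised integral of the heat factor\<close>

lemma powr_add_const_diff_tendsto_0:
  fixes c s :: real assumes "0 < s" "s < 1"
  shows "((\<lambda>x. (x + c) powr s - x powr s) \<longlongrightarrow> 0) at_top"
  using assms by real_asymp

text \<open>The factor by which the kernel at time t multiplies the cone density at V, after
  removing t^(1 + s). It vanishes for V \<ge> w because the Moebius map v -> (w v + l^2) / (w + v)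
  sends (l, \<infinity>) only onto (l, w).\<close>

definition heat_factor :: "real \<Rightarrow> real \<Rightarrow> real \<Rightarrow> real \<Rightarrow> real \<Rightarrow> real" where
  "heat_factor s A l V t =
     (if V < lcoth l t then ((lcoth l t)\<^sup>2 - l\<^sup>2) * (lcoth l t - V) powr (s - 1) * exp (- A / (lcoth l t - V)) else 0)"

text \<open>The subtracted power is the contribution of - u, whose Fourier transform is an integral
  of the same cone density.\<close>

definition frac_kernel :: "real \<Rightarrow> real \<Rightarrow> real \<Rightarrow> real \<Rightarrow> real \<Rightarrow> real" where
  "frac_kernel s A l V t = heat_factor s A l V t - t powr (- s - 1)"

text \<open>The two singular terms of \<open>frac_kernel\<close> are each compared with \<open>(w\<^sup>2 - l\<^sup>2) w powr (s - 1)\<close>,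
  \<open>w = lcoth l t\<close>: both differences have a constant sign and an elementary primitive.\<close>

lemma frac_kernel_integral:
  assumes s: "0 < s" "s < 1" and l: "0 < l" "l < V" and A: "A > 0"
  shows "has_bochner_integral lborel (\<lambda>t. indicator {0<..} t * frac_kernel s A l V t) (- (Gamma (1 - s) / s * A powr s))"
    and "(\<integral>\<^sup>+t. ennreal \<bar>indicator {0<..} t * frac_kernel s A l V t\<bar> \<partial>lborel) \<le> ennreal (Gamma (1 - s) / s * A powr s + 2 * V powr s / s)"
proof -
  define w where "w = lcoth l"
  have [measurable]: "w \<in> borel_measurable borel" by (simp add: w_def)
  define D where "D = (\<lambda>t. (w t)\<^sup>2 - l\<^sup>2)"
  have [measurable]: "D \<in> borel_measurable borel" by (simp add: D_def)
  have wl: "w t > l" if "t > 0" for t using lcoth_gt[of l t] that l by (simp add: w_def)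
  have w0: "w t > 0" if "t > 0" for t using wl[OF that] l by simp
  have D0: "D t > 0" if "t > 0" for t
    using wl[OF that] l by (simp add: D_def power_strict_mono)
  have dw: "(w has_real_derivative - D t) (at t)" if "t > 0" for t
    using lcoth_deriv[of l t] that l by (simp add: w_def D_def)
  have cw: "isCont w t" if "t > 0" for t using dw[OF that] by (rule DERIV_isCont)
  have cD: "isCont D t" if "t > 0" for t unfolding D_def using cw[OF that] by (intro continuous_intros)
  \<comment> \<open>The time at which w crosses V: the heat factor lives on (0, T), and beyond T
    only the subtracted power is left.\<close>
  obtain T where T: "T > 0" "w T = V" using lcoth_surj[of l V] l by (auto simp: w_def)
  have wV: "w t > V" if "0 < t" "t < T" for t
    using lcoth_decreasing[of l t T] that l T by (simp add: w_def)
  have wV': "w t < V" if "T < t" for t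
    using lcoth_decreasing[of l T t] that l T by (simp add: w_def)
  have wTop: "filterlim w at_top (at_right 0)" unfolding w_def by (rule lcoth_at_0) (rule l)
  have winf: "(w \<longlongrightarrow> l) at_top" unfolding w_def by (rule lcoth_at_top) (rule l)
  have wT: "(w \<longlongrightarrow> V) (at T)" using cw[OF T(1)] T by (simp add: isCont_def)
  have wT': "(w \<longlongrightarrow> V) (at_left T)" "(w \<longlongrightarrow> V) (at_right T)"
    using wT by (auto simp: filterlim_at_split)
  \<comment> \<open>On (0, T) the kernel equals n1 - n2 - h1, beyond T it equals - n2 - n3. As dw =
    - D dt, the first three have primitives built from w^s, (w - V)^s and t^(- s); only h1 involves
    A.\<close>
  define n1 where "n1 = (\<lambda>t. D t * ((w t - V) powr (s - 1) - w t powr (s - 1)))"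
  define n2 where "n2 = (\<lambda>t. t powr (- s - 1) - D t * w t powr (s - 1))"
  define n3 where "n3 = (\<lambda>t. D t * w t powr (s - 1))"
  define h1 where "h1 = (\<lambda>t. D t * (w t - V) powr (s - 1) * (1 - exp (- A / (w t - V))))"
  have n1p: "n1 t \<ge> 0" if "0 < t" "t < T" for t
    using wV[OF that] D0[of t] that l s unfolding n1_def by (intro mult_nonneg_nonneg) (auto intro!: powr_mono2')
  have n2p: "n2 t \<ge> 0" if "0 < t" for t
  proof -
    \<comment> \<open>Both factors of the subtracted product are compared with powers of 1 / t: D =
      (l / sinh (t l))^2 \<le> 1 / t^2, and w \<ge> 1 / t with the negative exponent s - 1.\<close>
    have "l / sinh (t * l) \<le> 1 / t" "0 \<le> l / sinh (t * l)"
      using sinh_real_ge_self[of "t * l"] that l by (auto simp: field_simps)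
    then have "D t \<le> (1 / t)\<^sup>2"
      using lcoth_sq[of l t] that l unfolding D_def w_def by (simp only: power_mono)
    moreover have "w t powr (s - 1) \<le> (1 / t) powr (s - 1)"
      using lcoth_ge[of l t] that l s unfolding w_def by (intro powr_mono2') auto
    ultimately have "D t * w t powr (s - 1) \<le> (1 / t)\<^sup>2 * (1 / t) powr (s - 1)"
      by (intro mult_mono) auto
    also have "(1 / t)\<^sup>2 = (1 / t) powr 2" using that by simp
    also have "(1 / t) powr 2 * (1 / t) powr (s - 1) = (1 / t) powr (1 + s)" by (simp add: powr_add[symmetric])
    also have "\<dots> = t powr (- s - 1)" 
    proof -
      have e: "- s - 1 = - (1 + s)" by simp
      show ?thesis unfolding e powr_minus_divide using that by (simp add: powr_divide)
    qed
    finally show ?thesis by (simp add: n2_def)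
  qed
  have n3p: "n3 t \<ge> 0" if "0 < t" for t using D0[OF that] by (simp add: n3_def)
  have h1p: "h1 t \<ge> 0" if "0 < t" "t < T" for t
    using D0[of t] wV[OF that] A that unfolding h1_def by (intro mult_nonneg_nonneg) auto
  have I1: "has_bochner_integral lborel (\<lambda>t. indicator {0<..<T} t * n1 t) (V powr s / s - 0)"
  proof (rule has_bochner_integral_FTC_Ioo[where F = "\<lambda>t. (w t powr s - (w t - V) powr s) / s"])
    show "((\<lambda>t. (w t powr s - (w t - V) powr s) / s) has_real_derivative n1 x) (at x)" if "0 < x" "x < T" for x
      using wV[OF that] l s that unfolding n1_def
      by (auto intro!: derivative_eq_intros dw simp: field_simps)
    show "isCont n1 x" if "0 < x" "x < T" for x
      using wV[OF that] l s that unfolding n1_def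
      by (auto intro!: continuous_intros cw cD)
    \<comment> \<open>With x = w - V tending to \<infinity>, the boundary term is (x + V)^s - x^s,
      which vanishes because s < 1.\<close>
    have "((\<lambda>t. ((w t - V + V) powr s - (w t - V) powr s) / s) \<longlongrightarrow> 0 / s) (at_right 0)"
    proof (intro tendsto_divide tendsto_const filterlim_compose[OF powr_add_const_diff_tendsto_0[OF s]])
      show "filterlim (\<lambda>t. w t - V) at_top (at_right 0)"
        using filterlim_tendsto_add_at_top[OF tendsto_const[of "- V"] wTop] by simp
    qed (use s in auto)
    then show "((\<lambda>t. (w t powr s - (w t - V) powr s) / s) \<longlongrightarrow> 0) (at_right 0)" by simp
    \<comment> \<open>At T the base w - V tends to 0, where the power is still continuous because s
      > 0; this is the integrability of the singularity (w - V)^(s - 1).\<close>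
    have "((\<lambda>t. (w t powr s - (w t - V) powr s) / s) \<longlongrightarrow> (V powr s - (V - V) powr s) / s) (at_left T)"
    proof (intro tendsto_intros tendsto_powr' wT')
    qed (use l s wV T in \<open>auto simp: eventually_at_left_field intro!: exI[of _ 0] less_imp_le\<close>)
    then show "((\<lambda>t. (w t powr s - (w t - V) powr s) / s) \<longlongrightarrow> V powr s / s) (at_left T)" using s by simp
  qed (use T n1p in auto)
  have I2: "has_bochner_integral lborel (\<lambda>t. indicator {0<..} t * n2 t) (l powr s / s - 0)"
  proof (rule has_bochner_integral_FTC_Ioi[where F = "\<lambda>t. (w t powr s - t powr (- s)) / s"])
    show "((\<lambda>t. (w t powr s - t powr (- s)) / s) has_real_derivative n2 x) (at x)" if "0 < x" for x
      using w0[OF that] s that unfolding n2_def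
      by (auto intro!: derivative_eq_intros dw simp: field_simps)
    show "isCont n2 x" if "0 < x" for x
      using w0[OF that] s that unfolding n2_def by (auto intro!: continuous_intros cw cD)
    have "((\<lambda>t. w t powr s - t powr (- s)) \<longlongrightarrow> 0) (at_right 0)"
    proof (rule tendsto_sandwich[of "\<lambda>_. 0" _ _ "\<lambda>t. (1 / t + l) powr s - (1 / t) powr s"])
      have "w t powr s \<le> (1 / t + l) powr s" "t powr (- s) \<le> w t powr s" "(1 / t) powr s = t powr (- s)" if "t > 0" for t
      proof -
        show e: "(1 / t) powr s = t powr (- s)" using that by (simp add: powr_divide powr_minus_divide)
        show "w t powr s \<le> (1 / t + l) powr s" using lcoth_le[of l t] l that w0[OF that] s by (intro powr_mono2) (auto simp: w_def)
        show "t powr (- s) \<le> w t powr s"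
          unfolding e[symmetric] using lcoth_ge[of l t] l that s by (intro powr_mono2) (auto simp: w_def)
      qed
      then show "\<forall>\<^sub>F t in at_right 0. w t powr s - t powr (- s) \<le> (1 / t + l) powr s - (1 / t) powr s"
        "\<forall>\<^sub>F t in at_right 0. 0 \<le> w t powr s - t powr (- s)"
        by (auto simp: eventually_at_filter)
      have "filterlim (\<lambda>t. 1 / t :: real) at_top (at_right 0)" by real_asymp
      from filterlim_compose[OF powr_add_const_diff_tendsto_0[OF s] this]
      show "((\<lambda>t. (1 / t + l) powr s - (1 / t) powr s) \<longlongrightarrow> 0) (at_right 0)" .
    qed auto
    from tendsto_divide[OF this tendsto_const[of s]]
    show "((\<lambda>t. (w t powr s - t powr (- s)) / s) \<longlongrightarrow> 0) (at_right 0)" using s by simp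
    have "((\<lambda>t::real. t powr - s) \<longlongrightarrow> 0) at_top"
      by (rule tendsto_neg_powr) (use s in \<open>auto intro: filterlim_ident\<close>)
    then have "((\<lambda>t. (w t powr s - t powr (- s)) / s) \<longlongrightarrow> (l powr s - 0) / s) at_top"
      by (intro tendsto_intros winf) (use l s in auto)
    then show "((\<lambda>t. (w t powr s - t powr (- s)) / s) \<longlongrightarrow> l powr s / s) at_top" by simp
  qed (use n2p in auto)
  have I3: "has_bochner_integral lborel (\<lambda>t. indicator {T<..} t * n3 t) (- (l powr s / s) - (- (V powr s / s)))"
  proof (rule has_bochner_integral_FTC_Ioi[where F = "\<lambda>t. - (w t powr s / s)"])
    show "((\<lambda>t. - (w t powr s / s)) has_real_derivative n3 x) (at x)" if "T < x" for x
      using w0[of x] s that T unfolding n3_def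
      by (auto intro!: derivative_eq_intros dw simp: field_simps)
    show "isCont n3 x" if "T < x" for x
      using w0[of x] s that T unfolding n3_def by (auto intro!: continuous_intros cw cD)
    show "((\<lambda>t. - (w t powr s / s)) \<longlongrightarrow> - (V powr s / s)) (at_right T)"
      by (intro tendsto_intros wT') (use l s in auto)
    show "((\<lambda>t. - (w t powr s / s)) \<longlongrightarrow> - (l powr s / s)) at_top"
      by (intro tendsto_intros winf) (use l s in auto)
  qed (use n3p T in auto)
  \<comment> \<open>The substitution v = A / (w - V) maps (0, T) onto the half-line and removes A
    and V from the integrand, up to the factor A^s.\<close>
  have I4nn: "(\<integral>\<^sup>+t. ennreal (indicator {0<..<T} t * h1 t) \<partial>lborel) = ennreal (Gamma (1 - s) / s * A powr s)"
  proof -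
    have "(\<integral>\<^sup>+t. ennreal (indicator {0<..<T} t * (A powr (- s) * h1 t)) \<partial>lborel)
       = (\<integral>\<^sup>+v. ennreal (indicator {0<..} v * (v powr (- s - 1) * (1 - exp (- v)))) \<partial>lborel)"
    proof (rule nn_integral_change_of_variables_1[where g = "\<lambda>t. A / (w t - V)" and g' = "\<lambda>t. A * D t / (w t - V)\<^sup>2"])
      show "((\<lambda>t. A / (w t - V)) has_real_derivative A * D t / (w t - V)\<^sup>2) (at t)" if "t \<in> {0<..<T}" for t
        using wV[of t] that by (auto intro!: derivative_eq_intros dw simp: power2_eq_square)
      have winj: "x = y" if "0 < x" "0 < y" "w x = w y" for x y
        using lcoth_decreasing[of l x y] lcoth_decreasing[of l y x] that l
        by (cases x y rule: linorder_cases) (auto simp: w_def)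
      show "inj_on (\<lambda>t. A / (w t - V)) {0<..<T}"
      proof (rule inj_onI)
        fix x y assume "x \<in> {0<..<T}" "y \<in> {0<..<T}" "A / (w x - V) = A / (w y - V)"
        then show "x = y" using wV[of x] wV[of y] A by - (rule winj[of x y], auto)
      qed
      show "(\<lambda>t. A / (w t - V)) ` {0<..<T} = {0<..}"
      proof (intro set_eqI iffI)
        fix v :: real assume v: "v \<in> {0<..}"
        then have "V + A / v > V" using A by simp
        then obtain t where t: "t > 0" "w t = V + A / v"
          using lcoth_surj[of l "V + A / v"] l by (auto simp: w_def)
        moreover have "t < T" using t wV'[of t] T \<open>V + A / v > V\<close> by (cases t T rule: linorder_cases) auto
        ultimately show "v \<in> (\<lambda>t. A / (w t - V)) ` {0<..<T}" using v A by (intro image_eqI[of _ _ t]) auto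
      qed (use wV A in auto)
      show "A powr (- s) * h1 t = \<bar>A * D t / (w t - V)\<^sup>2\<bar> * ((A / (w t - V)) powr (- s - 1) * (1 - exp (- (A / (w t - V)))))"
        if "t \<in> {0<..<T}" for t
      proof -
        define x where "x = w t - V"
        have x: "x > 0" using wV[of t] that by (simp add: x_def)
        have a1: "A powr (- s) = A * A powr (- s - 1)" using A powr_add[of A 1 "- s - 1"] by simp
        have a2: "x powr (s - 1) = x powr (s + 1) / x\<^sup>2"
          using x powr_diff[of x "s + 1" 2] by simp
        have "x powr (s + 1) * x powr (- s - 1) = 1" using x powr_add[of x "s + 1" "- s - 1"] by simp
        then have "1 / x powr (- s - 1) = x powr (s + 1)" using x by (simp add: divide_eq_eq)
        moreover have "(A / x) powr (- s - 1) = A powr (- s - 1) * (1 / x powr (- s - 1))"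
          using x A by (simp add: powr_divide)
        ultimately have a3: "(A / x) powr (- s - 1) = A powr (- s - 1) * x powr (s + 1)"
          by simp
        have a4: "A powr (- s) * x powr (s - 1) = A / x\<^sup>2 * (A / x) powr (- s - 1)"
          unfolding a1 a2 a3 by simp
        have "\<bar>A * D t / x\<^sup>2\<bar> = D t * (A / x\<^sup>2)" using D0[of t] that A by simp
        then have "\<bar>A * D t / x\<^sup>2\<bar> * ((A / x) powr (- s - 1) * (1 - exp (- (A / x)))) =
            D t * (A / x\<^sup>2 * (A / x) powr (- s - 1)) * (1 - exp (- (A / x)))"
          by (simp only: mult.assoc)
        also have "\<dots> = A powr (- s) * (D t * x powr (s - 1) * (1 - exp (- A / x)))"
          unfolding a4[symmetric] by simp
        finally show ?thesis unfolding h1_def x_def ..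
      qed
      show "(\<lambda>t. A powr (- s) * h1 t) \<in> borel_measurable borel" unfolding h1_def by measurable
    qed auto
    also have "\<dots> = ennreal (Gamma (1 - s) / s)" by (rule nn_integral_powr_one_minus_exp[OF s])
    finally have e: "(\<integral>\<^sup>+t. ennreal (indicator {0<..<T} t * (A powr (- s) * h1 t)) \<partial>lborel) = ennreal (Gamma (1 - s) / s)" .
    have "(\<integral>\<^sup>+t. ennreal (indicator {0<..<T} t * h1 t) \<partial>lborel)
       = (\<integral>\<^sup>+t. ennreal (A powr s) * ennreal (indicator {0<..<T} t * (A powr (- s) * h1 t)) \<partial>lborel)"
    proof (intro nn_integral_cong)
      fix t
      have "A powr s * A powr (- s) = 1" using A by (simp add: powr_minus)
      then have f: "A powr s * (A powr (- s) * h1 t) = h1 t" by (simp only: mult.assoc[symmetric] mult_1_left)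
      show "ennreal (indicator {0<..<T} t * h1 t) = ennreal (A powr s) * ennreal (indicator {0<..<T} t * (A powr (- s) * h1 t))"
        by (simp only: ennreal_mult'[symmetric, OF powr_ge_zero] mult.left_commute[of "A powr s" "indicator {0<..<T} t"] f)
    qed
    also have "\<dots> = ennreal (A powr s) * ennreal (Gamma (1 - s) / s)"
      unfolding e[symmetric] by (rule nn_integral_cmult) (auto simp: h1_def)
    finally show ?thesis by (simp add: ennreal_mult'[symmetric] mult.commute)
  qed
  have I4: "has_bochner_integral lborel (\<lambda>t. indicator {0<..<T} t * h1 t) (Gamma (1 - s) / s * A powr s)"
    by (rule has_bochner_integral_nn_integral[OF _ _ _ I4nn])
       (use h1p s in \<open>auto simp: h1_def indicator_def Gamma_real_pos less_imp_le\<close>)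
  have Dt: "(w t)\<^sup>2 - l\<^sup>2 = D t" for t by (simp add: D_def)
  \<comment> \<open>Only almost everywhere: at t = T none of the open intervals (0, T) and (T,
    \<infinity>) applies.\<close>
  have dec: "AE t in lborel. indicator {0<..} t * frac_kernel s A l V t
     = indicator {0<..<T} t * n1 t - indicator {0<..} t * n2 t - indicator {T<..} t * n3 t - indicator {0<..<T} t * h1 t"
    using AE_lborel_singleton[of T]
  proof eventually_elim
    case (elim t)
    then consider "t \<le> 0" | "0 < t" "t < T" | "T < t" by linarith
    then show ?case
    proof cases
      case 2
      then show ?thesis using wV[of t] unfolding frac_kernel_def heat_factor_def n1_def n2_def h1_def w_def[symmetric] Dt
        by (simp add: algebra_simps)
    next
      case 3
      then show ?thesis using wV'[of t] T unfolding frac_kernel_def heat_factor_def n2_def n3_def w_def[symmetric] Dt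
        by (simp add: algebra_simps)
    qed (use T in auto)
  qed
  have [measurable]: "(\<lambda>t. frac_kernel s A l V t) \<in> borel_measurable borel" unfolding frac_kernel_def heat_factor_def by measurable
  have [measurable]: "n1 \<in> borel_measurable borel" "n2 \<in> borel_measurable borel" "n3 \<in> borel_measurable borel" "h1 \<in> borel_measurable borel"
    unfolding n1_def n2_def n3_def h1_def by measurable
  have "has_bochner_integral lborel (\<lambda>t. indicator {0<..<T} t * n1 t - indicator {0<..} t * n2 t - indicator {T<..} t * n3 t - indicator {0<..<T} t * h1 t)
     ((V powr s / s - 0) - (l powr s / s - 0) - (- (l powr s / s) - (- (V powr s / s))) - Gamma (1 - s) / s * A powr s)"
    by (intro has_bochner_integral_diff I1 I2 I3 I4)
  \<comment> \<open>All boundary terms in V^s and l^s cancel, so the comparison functions contribute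
    nothing and only h1 survives.\<close>
  also have "((V powr s / s - 0) - (l powr s / s - 0) - (- (l powr s / s) - (- (V powr s / s))) - Gamma (1 - s) / s * A powr s) = - (Gamma (1 - s) / s * A powr s)"
    by simp
  finally have I: "has_bochner_integral lborel (\<lambda>t. indicator {0<..<T} t * n1 t - indicator {0<..} t * n2 t - indicator {T<..} t * n3 t - indicator {0<..<T} t * h1 t)
     (- (Gamma (1 - s) / s * A powr s))" .
  show "has_bochner_integral lborel (\<lambda>t. indicator {0<..} t * frac_kernel s A l V t) (- (Gamma (1 - s) / s * A powr s))"
    by (rule has_bochner_integralI_AE[OF I]) (use dec in \<open>auto\<close>)
  \<comment> \<open>The same four integrals, now added: the terms in l^s cancel and those in V^s
    double, which gives the bound 2 V^s / s.\<close>
  have S: "has_bochner_integral lborel (\<lambda>t. indicator {0<..<T} t * n1 t + indicator {0<..} t * n2 t + indicator {T<..} t * n3 t + indicator {0<..<T} t * h1 t)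
     ((V powr s / s - 0) + (l powr s / s - 0) + (- (l powr s / s) - (- (V powr s / s))) + Gamma (1 - s) / s * A powr s)"
    by (intro has_bochner_integral_add I1 I2 I3 I4)
  have "(\<integral>\<^sup>+t. ennreal \<bar>indicator {0<..} t * frac_kernel s A l V t\<bar> \<partial>lborel)
     \<le> (\<integral>\<^sup>+t. ennreal (indicator {0<..<T} t * n1 t + indicator {0<..} t * n2 t + indicator {T<..} t * n3 t + indicator {0<..<T} t * h1 t) \<partial>lborel)"
    using dec
  proof (intro nn_integral_mono_AE, eventually_elim)
    case (elim t)
    have "0 \<le> indicator {0<..<T} t * n1 t" "0 \<le> indicator {0<..} t * n2 t" "0 \<le> indicator {T<..} t * n3 t" "0 \<le> indicator {0<..<T} t * h1 t"
      using n1p n2p n3p h1p T by (auto simp: indicator_def)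
    then show ?case unfolding elim by (intro ennreal_leI) linarith
  qed
  also have "\<dots> = ennreal ((V powr s / s - 0) + (l powr s / s - 0) + (- (l powr s / s) - (- (V powr s / s))) + Gamma (1 - s) / s * A powr s)"
    by (rule nn_integral_has_bochner[OF S]) (use n1p n2p n3p h1p T in \<open>auto simp: indicator_def\<close>)
  also have "\<dots> = ennreal (Gamma (1 - s) / s * A powr s + 2 * V powr s / s)" by (simp add: field_simps)
  finally show "(\<integral>\<^sup>+t. ennreal \<bar>indicator {0<..} t * frac_kernel s A l V t\<bar> \<partial>lborel) \<le> ennreal (Gamma (1 - s) / s * A powr s + 2 * V powr s / s)" .
qed

section \<open>Translated Gaussians with a phase, and exponential bounds\<close>

lemma has_bochner_integral_lborel_shift:
  fixes f :: "'a::euclidean_space \<Rightarrow> 'b::{banach, second_countable_topology}"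
  assumes "has_bochner_integral lborel f x"
  shows "has_bochner_integral lborel (\<lambda>y. f (c + y)) x"
proof -
  have [measurable]: "f \<in> borel_measurable borel" using assms by (auto simp: has_bochner_integral_iff)
  have "has_bochner_integral (distr lborel borel ((+) c)) f x"
    using assms by (simp add: lborel_distr_plus)
  then show ?thesis
    by (simp add: has_bochner_integral_iff integrable_distr_eq integral_distr)
qed

lemma integral_lborel_scale:
  fixes f :: "'a::euclidean_space \<Rightarrow> complex"
  assumes [measurable]: "f \<in> borel_measurable borel" and t: "t > 0"
  shows "(LINT x|lborel. f x) = of_real (t ^ DIM('a)) * (LINT x|lborel. f (t *\<^sub>R x))"
proof -
  have "(LINT x|lborel. f x) = (LINT x|density (distr lborel borel (\<lambda>x. 0 + t *\<^sub>R x)) (\<lambda>_. ennreal (\<bar>t\<bar> ^ DIM('a))). f x)"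
    using lborel_affine[of t "0::'a"] t by (simp add: ennreal_power)
  also have "\<dots> = (LINT x|distr lborel borel (\<lambda>x. 0 + t *\<^sub>R x). (\<bar>t\<bar> ^ DIM('a)) *\<^sub>R f x)"
    by (subst integral_density) auto
  also have "\<dots> = (LINT x|lborel. (\<bar>t\<bar> ^ DIM('a)) *\<^sub>R f (t *\<^sub>R x))"
    by (subst integral_distr) auto
  finally show ?thesis using t by (simp add: scaleR_conv_of_real)
qed

text \<open>The square is completed around c z with c = w / (w + v), which splits off exp (- w v
  |z|^2 / (4 (w + v))). Translating by c z leaves the phase unchanged because \<eta> is orthogonal
  to z.\<close>

lemma gauss_char_shift:
  fixes z \<eta> :: "'a::euclidean_space"
  assumes w: "w > 0" and v: "v > 0" and perp: "\<eta> \<bullet> z = 0"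
  shows "has_bochner_integral lborel
     (\<lambda>x. complex_of_real (exp (- (w * (norm (z - x))\<^sup>2 + v * (norm x)\<^sup>2) / 4)) * cis (\<eta> \<bullet> x))
     (complex_of_real ((4 * pi / (w + v)) powr (real DIM('a) / 2) * exp (- (w * v * (norm z)\<^sup>2 / 4 + (norm \<eta>)\<^sup>2) / (w + v))))"
proof -
  define c where "c = w / (w + v)"
  have "has_bochner_integral lborel (\<lambda>x. complex_of_real (exp (- ((w + v) / 4) * (norm (- (c *\<^sub>R z) + x))\<^sup>2)) * cis (\<eta> \<bullet> (- (c *\<^sub>R z) + x)))
     (complex_of_real ((pi / ((w + v) / 4)) powr (real DIM('a) / 2) * exp (- (norm \<eta>)\<^sup>2 / (4 * ((w + v) / 4)))))"
    by (rule has_bochner_integral_lborel_shift[OF gauss_char]) (use w v in auto)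
  then have "has_bochner_integral lborel (\<lambda>x. complex_of_real (exp (- (w * v * (norm z)\<^sup>2 / 4) / (w + v))) * (complex_of_real (exp (- ((w + v) / 4) * (norm (- (c *\<^sub>R z) + x))\<^sup>2)) * cis (\<eta> \<bullet> (- (c *\<^sub>R z) + x))))
     (complex_of_real (exp (- (w * v * (norm z)\<^sup>2 / 4) / (w + v))) * complex_of_real ((pi / ((w + v) / 4)) powr (real DIM('a) / 2) * exp (- (norm \<eta>)\<^sup>2 / (4 * ((w + v) / 4)))))"
    by (rule has_bochner_integral_mult_right)
  moreover have "complex_of_real (exp (- (w * v * (norm z)\<^sup>2 / 4) / (w + v))) * (complex_of_real (exp (- ((w + v) / 4) * (norm (- (c *\<^sub>R z) + x))\<^sup>2)) * cis (\<eta> \<bullet> (- (c *\<^sub>R z) + x)))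
     = complex_of_real (exp (- (w * (norm (z - x))\<^sup>2 + v * (norm x)\<^sup>2) / 4)) * cis (\<eta> \<bullet> x)" for x
  proof -
    have n: "(norm (a - b))\<^sup>2 = (norm a)\<^sup>2 - 2 * (a \<bullet> b) + (norm b)\<^sup>2" for a b :: 'a
      unfolding power2_norm_eq_inner by (simp only: inner_diff_left inner_diff_right inner_commute[of b a])
    note n2 = n[of z x]
    have n1: "(norm (- (c *\<^sub>R z) + x))\<^sup>2 = c\<^sup>2 * (norm z)\<^sup>2 - 2 * c * (z \<bullet> x) + (norm x)\<^sup>2"
      using n[of x "c *\<^sub>R z"] by (simp add: power_mult_distrib inner_commute[of x z])
    have wv: "w + v \<noteq> 0" using w v by simp
    have c: "(w + v) * c = w" using wv by (simp add: c_def)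
    have e0: "(w + v) * c\<^sup>2 = w * c" using c by (simp add: power2_eq_square)
    have e1: "w * v / (w + v) = w - w * c" using wv by (simp add: c_def field_simps)
    have e2: "(w + v) * (norm (- (c *\<^sub>R z) + x))\<^sup>2 = ((w + v) * c\<^sup>2) * (norm z)\<^sup>2 - 2 * ((w + v) * c) * (z \<bullet> x) + (w + v) * (norm x)\<^sup>2"
      unfolding n1 by (simp add: algebra_simps)
    have "w * v / (w + v) * (norm z)\<^sup>2 + (w + v) * (norm (- (c *\<^sub>R z) + x))\<^sup>2 = w * (norm (z - x))\<^sup>2 + v * (norm x)\<^sup>2"
      unfolding e1 e2 e0 n2 c by (simp add: algebra_simps)
    moreover have "- (w * v * Z / 4) / (w + v) + - ((w + v) / 4) * P = - (w * v / (w + v) * Z + (w + v) * P) / 4" for Z P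
      using w v by (simp add: divide_simps) (simp add: algebra_simps)
    ultimately have "- (w * v * (norm z)\<^sup>2 / 4) / (w + v) + - ((w + v) / 4) * (norm (- (c *\<^sub>R z) + x))\<^sup>2 = - (w * (norm (z - x))\<^sup>2 + v * (norm x)\<^sup>2) / 4"
      by simp
    then have "exp (- (w * v * (norm z)\<^sup>2 / 4) / (w + v)) * exp (- ((w + v) / 4) * (norm (- (c *\<^sub>R z) + x))\<^sup>2) = exp (- (w * (norm (z - x))\<^sup>2 + v * (norm x)\<^sup>2) / 4)"
      by (simp only: mult_exp_exp)
    moreover have "\<eta> \<bullet> (- (c *\<^sub>R z) + x) = \<eta> \<bullet> x" using perp by (simp add: inner_add_right inner_diff_right)
    ultimately show ?thesis by (simp only: mult.assoc[symmetric] of_real_mult[symmetric])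
  qed
  moreover have "exp (- (w * v * (norm z)\<^sup>2 / 4) / (w + v)) * exp (- (norm \<eta>)\<^sup>2 / (4 * ((w + v) / 4))) = exp (- (w * v * (norm z)\<^sup>2 / 4 + (norm \<eta>)\<^sup>2) / (w + v))"
    by (simp add: mult_exp_exp add_divide_distrib diff_divide_distrib)
  then have "exp (- (w * v * (norm z)\<^sup>2 / 4) / (w + v)) * ((pi / ((w + v) / 4)) powr (real DIM('a) / 2) * exp (- (norm \<eta>)\<^sup>2 / (4 * ((w + v) / 4))))
     = (4 * pi / (w + v)) powr (real DIM('a) / 2) * exp (- (w * v * (norm z)\<^sup>2 / 4 + (norm \<eta>)\<^sup>2) / (w + v))"
    by (simp add: mult_ac)
  ultimately show ?thesis by (simp only: of_real_mult[symmetric])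
qed

text \<open>For q = 2 the power in the cone density is trivial and the cone integral is exp (- c l)
  / c, so integrability in any dimension is a case of \<open>cone_char\<close>.\<close>

lemma integrable_exp_norm:
  fixes c :: real assumes c: "c > 0"
  shows "integrable lborel (\<lambda>x::'a::euclidean_space. exp (- c * norm x))"
proof -
  have cone: "cone 2 (4 * c) l = exp (- c * l) / c" if "l \<ge> 0" for l
  proof -
    have "has_bochner_integral lborel (\<lambda>v. indicator {l<..} v * exp (- c * v)) (0 - (- (exp (- c * l) / c)))"
    proof (rule has_bochner_integral_FTC_Ioi)
      show "((\<lambda>v. - (exp (- c * v) / c)) has_real_derivative exp (- c * x)) (at x)" for x
        using c by (auto intro!: derivative_eq_intros)
      show "((\<lambda>v. - (exp (- c * v) / c)) \<longlongrightarrow> - (exp (- c * l) / c)) (at_right l)"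
        using c by (intro tendsto_intros) auto
      show "((\<lambda>v. - (exp (- c * v) / c)) \<longlongrightarrow> 0) at_top"
        using c by real_asymp
    qed (use c in \<open>auto intro!: continuous_intros\<close>)
    moreover have "cone_density 2 (4 * c) l v = indicator {l<..} v * exp (- c * v)" for v
    proof (cases "v > l")
      case True
      then have "v\<^sup>2 - l\<^sup>2 > 0" using that by (simp add: power_strict_mono)
      then show ?thesis using True by (simp add: cone_density_def mult.commute)
    qed (simp add: cone_density_def)
    ultimately show ?thesis by (simp add: cone_def has_bochner_integral_iff)
  qed
  have "integrable lborel (\<lambda>x::'a. complex_of_real (cone 2 (4 * c) (norm x)))"
    using cone_char[of 2 "4 * c" "0::'a"] c by (simp add: has_bochner_integral_iff)
  then have "integrable lborel (\<lambda>x::'a. cone 2 (4 * c) (norm x))"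
    by (simp only: complex_of_real_integrable_eq)
  then have "integrable lborel (\<lambda>x::'a. c * cone 2 (4 * c) (norm x))"
    by simp
  then show ?thesis using c by (simp add: cone)
qed

text \<open>By the double-angle formula sinh x = 2 sinh (x / 2) cosh (x / 2), where sinh (x / 2)
  \<ge> x / 2 and cosh (x / 2) \<ge> exp (x / 2) / 2. It gives the exponential decay of the kernel
  symbol.\<close>

lemma div_sinh_le:
  fixes x :: real assumes "x \<ge> 0" shows "x / sinh x \<le> 2 * exp (- x / 2)"
proof (cases "x = 0")
  case False
  then have x: "x > 0" using assms by simp
  have "exp (x / 2) \<le> 2 * cosh (x / 2)" by (simp add: cosh_field_def)
  then have "(x / 2) * (exp (x / 2) / 2) \<le> sinh (x / 2) * cosh (x / 2)"
    using x sinh_real_ge_self[of "x / 2"] by (intro mult_mono) auto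
  also have "\<dots> = sinh x / 2" using sinh_double[of "x / 2"] by simp
  finally have "x * exp (x / 2) \<le> 2 * sinh x" by simp
  then have "x * exp (x / 2) * exp (- x / 2) \<le> 2 * sinh x * exp (- x / 2)"
    by (rule mult_right_mono) simp
  moreover have "x * exp (x / 2) * exp (- x / 2) = x" by (simp add: mult.assoc mult_exp_exp)
  ultimately have "x \<le> 2 * exp (- x / 2) * sinh x" by (simp only: mult_ac)
  then show ?thesis using x by (simp add: field_simps)
qed simp

section \<open>Groups of Heisenberg type and the kernel\<close>

locale heisenberg_algebra =
  fixes br :: "'v::euclidean_space \<times> 'w::euclidean_space \<Rightarrow> 'v \<times> 'w \<Rightarrow> 'v \<times> 'w"
  assumes heis: "heisenberg_type br"
begin

definition bracket :: "'v \<Rightarrow> 'v \<Rightarrow> 'w" where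
  "bracket x z = snd (br (x, 0) (z, 0))"

lemma bilinear_br: "bilinear br"
  using heis by (simp add: heisenberg_type_def lie_bracket_def)

lemma br_swap: "br x y = - br y x"
proof -
  have s: "br x x = 0" for x using heis unfolding heisenberg_type_def lie_bracket_def by blast
  have "br (x + y) (x + y) = br x x + br x y + (br y x + br y y)"
    using bilinear_br by (simp add: bilinear_ladd bilinear_radd)
  then show ?thesis by (simp add: s eq_neg_iff_add_eq_0)
qed

lemma bracket_swap: "bracket x z = - bracket z x"
  unfolding bracket_def using br_swap[of "(x, 0)" "(z, 0)"] by simp

lemma kaplan_inner: "kaplan br \<mu> x \<bullet> z = bracket x z \<bullet> \<mu>"
  by (simp add: inner_kaplan[OF bilinear_br] bracket_def inner_prod_def)

lemma bracket_inner: "bracket x z \<bullet> \<mu> = - (kaplan br \<mu> z \<bullet> x)"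
  by (subst bracket_swap) (simp add: kaplan_inner)

lemma kaplan_perp: "kaplan br \<mu> z \<bullet> z = 0"
  using kaplan_inner[of \<mu> z z] bracket_inner[of z z \<mu>] by simp

text \<open>Skew-symmetry of J(\<mu>) turns |J(\<mu>) z|^2 into the inner product of - J(\<mu>)^2 z
  with z, which the Heisenberg-type condition evaluates.\<close>

lemma norm_kaplan: "norm (kaplan br \<mu> z) = norm \<mu> * norm z"
proof -
  have J: "kaplan br \<mu> (kaplan br \<mu> z) = - (norm \<mu>)\<^sup>2 *\<^sub>R z"
    using heis by (simp add: heisenberg_type_def)
  have "(norm (kaplan br \<mu> z))\<^sup>2 = (norm \<mu> * norm z)\<^sup>2"
    using kaplan_inner[of \<mu> z "kaplan br \<mu> z"] bracket_inner[of z "kaplan br \<mu> z" \<mu>]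
    by (simp add: J power2_norm_eq_inner[symmetric] power_mult_distrib)
  then show ?thesis by (simp add: power2_eq_iff_nonneg)
qed

text \<open>In dimension one J(\<mu>) b, being orthogonal to b, would vanish, contradicting
  \<open>norm_kaplan\<close>. The bound gives q = m / 2 + 1 - s > 1, hence the integrability of u in
  the second layer.\<close>

lemma DIM_layer1_ge_2: "DIM('v) \<ge> 2"
proof (rule ccontr)
  assume "\<not> ?thesis"
  then have 1: "DIM('v) = 1" using DIM_positive[where 'a='v] by linarith
  then obtain b :: 'v where b: "Basis = {b}" by (meson card_1_singletonE)
  obtain \<mu> :: 'w where \<mu>: "\<mu> \<in> Basis" using nonempty_Basis by blast
  have "kaplan br \<mu> b = 0"
  proof (rule euclidean_eqI)
    fix i :: 'v assume "i \<in> Basis"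
    then have "i = b" using b by blast
    then show "kaplan br \<mu> b \<bullet> i = 0 \<bullet> i" using kaplan_perp[of \<mu> b] by simp
  qed
  moreover have "norm b = 1" "norm \<mu> = 1" using b \<mu> by (auto intro: norm_Basis)
  ultimately show False using norm_kaplan[of \<mu> b] by simp
qed

lemma linear_bracket_left: "linear (\<lambda>x. bracket x z)"
  unfolding bracket_def
proof (rule linearI)
  fix a b :: 'v
  show "snd (br (a + b, 0) (z, 0)) = snd (br (a, 0) (z, 0)) + snd (br (b, 0) (z, 0))"
    using bilinear_ladd[OF bilinear_br, of "(a, 0)" "(b, 0)" "(z, 0)"] by simp
next
  fix c :: real and a :: 'v
  show "snd (br (c *\<^sub>R a, 0) (z, 0)) = c *\<^sub>R snd (br (a, 0) (z, 0))"
    using bilinear_lmul[OF bilinear_br, of c "(a, 0)" "(z, 0)"] by simp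
qed

lemma bracket_measurable [measurable]:
  assumes "f \<in> borel_measurable M"
  shows "(\<lambda>x. bracket (f x) z) \<in> borel_measurable M"
  using linear_bracket_left[of z] assms
  by (intro borel_measurable_continuous_on[of "\<lambda>x. bracket x z"] linear_continuous_on linear_conv_bounded_linear[THEN iffD1])

lemma group_mult_inv:
  "group_mult br (group_inv (x, \<tau>)) (z, \<sigma>) = (z - x, \<sigma> - \<tau> - (1/2) *\<^sub>R bracket x z)"
proof -
  have "(\<Sum>\<epsilon>\<in>Basis. (kaplan br \<epsilon> (- x) \<bullet> z) *\<^sub>R \<epsilon>) = bracket (- x) z"
    by (simp add: kaplan_inner euclidean_representation)
  also have "\<dots> = - bracket x z" using linear_neg[OF linear_bracket_left] by blast
  finally show ?thesis by (simp add: group_mult_def group_inv_def)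
qed

end

section \<open>The kernel in the rescaled frequency \<mu> = \<xi> / t\<close>

definition kernel_symbol :: "real \<Rightarrow> real \<Rightarrow> real \<Rightarrow> real \<Rightarrow> real" where
  "kernel_symbol s m t l = (l / sinh (t * l)) powr (m / 2) * (t * l / sinh (t * l)) powr (1 + s)"

lemma sinh_measurable [measurable]:
  "f \<in> borel_measurable M \<Longrightarrow> (\<lambda>x. sinh (f x) :: real) \<in> borel_measurable M"
  by (rule measurable_compose[where g = sinh]) (auto intro!: borel_measurable_continuous_onI continuous_intros)

lemma kernel_symbol_measurable [measurable]:
  assumes [measurable]: "f \<in> borel_measurable M" "g \<in> borel_measurable M"
  shows "(\<lambda>x. kernel_symbol s m (f x) (g x)) \<in> borel_measurable M"
  unfolding kernel_symbol_def by measurable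

lemma kernel_symbol_nonneg [simp]: "0 \<le> kernel_symbol s m t l"
  by (simp add: kernel_symbol_def)

lemma kernel_symbol_0 [simp]: "kernel_symbol s m t 0 = 0"
  by (simp add: kernel_symbol_def)

text \<open>The definition splits the exponent m / 2 + 1 + s so that t^(1 + s) is the only explicit
  power of t: the remaining factors l / sinh (t l) are square roots of w^2 - l^2. The right-hand
  side is the form that occurs in \<open>kernel_integrand\<close>.\<close>

lemma kernel_symbol_eq:
  assumes "t > 0" "l \<ge> 0"
  shows "kernel_symbol s m t l = t powr (- m / 2) * (t * l / sinh (t * l)) powr (m / 2 + 1 + s)"
proof -
  have "(l / sinh (t * l)) = (1 / t) * (t * l / sinh (t * l))" using assms by simp
  then have "(l / sinh (t * l)) powr (m / 2) = (1 / t) powr (m / 2) * (t * l / sinh (t * l)) powr (m / 2)"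
    by (simp only: powr_mult)
  moreover have "(1 / t) powr (m / 2) = t powr (- m / 2)"
    using assms powr_minus_divide[of t "m / 2"] by (simp add: powr_divide)
  ultimately show ?thesis
    unfolding kernel_symbol_def by (simp add: powr_add mult_ac)
qed

lemma integrable_kernel_symbol:
  assumes t: "t > 0" and m: "m > 0" and s: "s > 0"
  shows "integrable lborel (\<lambda>x::'a::euclidean_space. kernel_symbol s m t (norm x))"
proof (rule Bochner_Integration.integrable_bound)
  define p where "p = m / 2 + 1 + s"
  have p: "p > 0" using m s by (simp add: p_def)
  show "integrable lborel (\<lambda>x::'a. t powr (- m / 2) * (2 powr p * exp (- (p * t / 2) * norm x)))"
    using p t by (intro integrable_mult_right integrable_exp_norm) auto
  have "kernel_symbol s m t (norm x) \<le> t powr (- m / 2) * (2 powr p * exp (- (p * t / 2) * norm x))" for x :: 'a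
  proof -
    have "(t * norm x / sinh (t * norm x)) powr p \<le> (2 * exp (- (t * norm x) / 2)) powr p"
      using p t by (intro powr_mono2 div_sinh_le) auto
    also have "\<dots> = 2 powr p * exp (- (p * t / 2) * norm x)"
      by (simp add: powr_mult exp_powr_real mult_ac)
    finally show ?thesis
      using t by (simp add: kernel_symbol_eq p_def[symmetric] mult_left_mono)
  qed
  then show "AE x in lborel. norm (kernel_symbol s m t (norm (x::'a))) \<le> norm (t powr (- m / 2) * (2 powr p * exp (- (p * t / 2) * norm x)))"
    by (auto simp: abs_mult)
qed simp

lemma kernel_integrand_scale:
  fixes z :: "'v::euclidean_space" and \<rho> \<mu> :: "'w::euclidean_space"
  assumes t: "t > 0"
  shows "kernel_integrand s (z, \<rho>) t (t *\<^sub>R \<mu>) =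
    of_real (t powr (real DIM('v) / 2)) * (of_real (kernel_symbol s (real DIM('v)) t (norm \<mu>) * exp (- (norm z)\<^sup>2 * lcoth (norm \<mu>) t / 4)) * cis (- (\<rho> \<bullet> \<mu>)))"
proof -
  have "t powr (real DIM('v) / 2) * t powr (- real DIM('v) / 2) = 1"
    using t by (simp add: powr_add[symmetric])
  then have 1: "(t * norm \<mu> / sinh (t * norm \<mu>)) powr (real DIM('v) / 2 + 1 + s) = t powr (real DIM('v) / 2) * kernel_symbol s (real DIM('v)) t (norm \<mu>)"
    using t by (simp add: kernel_symbol_eq mult.assoc[symmetric])
  have 2: "- ((norm z)\<^sup>2 / (4 * t)) * (t * norm \<mu> / tanh (t * norm \<mu>)) = - (norm z)\<^sup>2 * lcoth (norm \<mu>) t / 4"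
    using t by (simp add: lcoth_def)
  have 3: "exp (- (\<i> / complex_of_real t) * complex_of_real (\<rho> \<bullet> (t *\<^sub>R \<mu>))) = cis (- (\<rho> \<bullet> \<mu>))"
    using t by (simp add: cis_conv_exp)
  show ?thesis
  proof -
    have n: "norm (t *\<^sub>R \<mu>) = t * norm \<mu>" using t by simp
    show ?thesis
      unfolding kernel_integrand_def case_prod_conv n 1 2 3 by simp
  qed
qed

text \<open>The Jacobian t^k of \<xi> = t \<mu> and the power t^(m / 2) released by the symbol
  cancel the time dependence of the prefactor. What remains is (2 pi)^(- k) from Fourier inversion
  times the heat-kernel constant (4 pi)^(- m / 2).\<close>

lemma kernel_eq:
  fixes z :: "'v::euclidean_space" and \<rho> :: "'w::euclidean_space"
  assumes t: "t > 0"
  shows "kernel s (z, \<rho>) t =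
    of_real ((2 * pi) powr (- real DIM('w)) * (4 * pi) powr (- real DIM('v) / 2)) *
      (LINT \<mu>|lborel. of_real (kernel_symbol s (real DIM('v)) t (norm \<mu>) * exp (- (norm z)\<^sup>2 * lcoth (norm \<mu>) t / 4)) * cis (- (\<rho> \<bullet> \<mu>)))"
proof -
  define k where "k = real DIM('w)"
  define m where "m = real DIM('v)"
  have [measurable]: "kernel_integrand s (z, \<rho>) t \<in> borel_measurable borel"
    unfolding kernel_integrand_def by simp
  have "(LINT \<xi>|lborel. kernel_integrand s (z, \<rho>) t \<xi>) = of_real (t ^ DIM('w)) * (LINT \<mu>|lborel. kernel_integrand s (z, \<rho>) t (t *\<^sub>R \<mu>))"
    by (rule integral_lborel_scale) (use t in simp_all)
  also have "\<dots> = of_real (t ^ DIM('w)) * (of_real (t powr (m / 2)) * (LINT \<mu>|lborel. of_real (kernel_symbol s m t (norm \<mu>) * exp (- (norm z)\<^sup>2 * lcoth (norm \<mu>) t / 4)) * cis (- (\<rho> \<bullet> \<mu>))))"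
    unfolding kernel_integrand_scale[OF t] m_def by (subst integral_mult_right_zero) simp
  finally have *: "(LINT \<xi>|lborel. kernel_integrand s (z, \<rho>) t \<xi>) = \<dots>" .
  have "2 ^ DIM('w) / (4 * pi * t) powr (m / 2 + k) * t ^ DIM('w) * t powr (m / 2) = (2 * pi) powr (- k) * (4 * pi) powr (- m / 2)"
  proof -
    have "(2::real) ^ DIM('w) = 2 powr k" "t ^ DIM('w) = t powr k" using t by (auto simp: k_def powr_realpow)
    moreover have "(4 * pi * t) powr (m / 2 + k) = (4 * pi) powr (m / 2) * (4 * pi) powr k * (t powr (m / 2) * t powr k)"
      using t by (simp add: powr_mult powr_add)
    moreover have "(4 * pi) powr k = 2 powr k * (2 * pi) powr k"
      by (simp add: powr_mult[symmetric])
    moreover have "(2 * pi) powr (- k) = 1 / (2 * pi) powr k" by (rule powr_minus_divide)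
    moreover have "(4 * pi) powr (- m / 2) = 1 / (4 * pi) powr (m / 2)"
      using powr_minus_divide[of "4 * pi" "m / 2"] by simp
    ultimately show ?thesis using t by (simp add: field_simps)
  qed
  then have "complex_of_real (2 ^ DIM('w) / (4 * pi * t) powr (m / 2 + k)) * (of_real (t ^ DIM('w)) * (of_real (t powr (m / 2)) * X))
     = of_real ((2 * pi) powr (- k) * (4 * pi) powr (- m / 2)) * X" for X
    by (simp only: mult.assoc[symmetric] of_real_mult[symmetric])
  then show ?thesis unfolding kernel_def * k_def m_def .
qed

lemma integrable_kernel_integrand:
  fixes h :: "'v::euclidean_space \<times> 'w::euclidean_space"
  assumes t: "t > 0" and s: "s > 0"
  shows "integrable lborel (kernel_integrand s h t)"
proof -
  obtain z \<rho> where h: "h = (z, \<rho>)" by fastforce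
  have "integrable lborel (\<lambda>\<xi>::'w. (norm \<xi> / sinh (norm \<xi>)) powr (real DIM('v) / 2 + 1 + s))"
    using integrable_kernel_symbol[of 1 "real DIM('v)" s, where 'a='w] s DIM_positive[where 'a='v]
    by (simp add: kernel_symbol_eq)
  then show ?thesis
  proof (rule Bochner_Integration.integrable_bound)
    show "kernel_integrand s h t \<in> borel_measurable lborel"
      unfolding h kernel_integrand_def by simp
    show "AE \<xi> in lborel. norm (kernel_integrand s h t \<xi>) \<le> norm ((norm \<xi> / sinh (norm \<xi>)) powr (real DIM('v) / 2 + 1 + s))"
    proof (intro AE_I2)
      fix \<xi> :: 'w
      have "norm (exp (- (\<i> / complex_of_real t) * complex_of_real (\<rho> \<bullet> \<xi>))) = 1"
        by (simp add: norm_exp_eq_Re)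
      moreover have "exp (- ((norm z)\<^sup>2 / (4 * t)) * (norm \<xi> / tanh (norm \<xi>))) \<le> 1"
        using t by (simp add: mult_nonneg_nonneg)
      ultimately show "norm (kernel_integrand s h t \<xi>) \<le> norm ((norm \<xi> / sinh (norm \<xi>)) powr (real DIM('v) / 2 + 1 + s))"
        unfolding h kernel_integrand_def by (simp add: norm_mult mult_left_le)
    qed
  qed
qed

section \<open>The action of the kernel\<close>

lemma heat_factor_measurable [measurable]:
  assumes [measurable]: "a \<in> borel_measurable M" "b \<in> borel_measurable M" "c \<in> borel_measurable M" "d \<in> borel_measurable M"
  shows "(\<lambda>x. heat_factor s (a x) (b x) (c x) (d x)) \<in> borel_measurable M"
  unfolding heat_factor_def by measurable

lemma integrable_mult_pair:
  fixes a :: "'a::euclidean_space \<Rightarrow> real" and b :: "'b::euclidean_space \<Rightarrow> real"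
  assumes a: "integrable lborel a" and b: "integrable lborel b"
  shows "integrable (lborel \<Otimes>\<^sub>M lborel) (\<lambda>(x, y). a x * b y)"
proof (rule lborel_pair.Fubini_integrable)
  have [measurable]: "a \<in> borel_measurable borel" "b \<in> borel_measurable borel"
    using a b by (auto dest: borel_measurable_integrable)
  show "(\<lambda>(x, y). a x * b y) \<in> borel_measurable (lborel \<Otimes>\<^sub>M lborel)" by measurable
  have "integrable lborel (\<lambda>x. \<bar>a x\<bar> * (LINT y|lborel. \<bar>b y\<bar>))"
    using a by (intro integrable_mult_left integrable_abs)
  then show "integrable lborel (\<lambda>x. LINT y|lborel. norm (case (x, y) of (x, y) \<Rightarrow> a x * b y))"
    by (simp add: abs_mult)
  show "AE x in lborel. integrable lborel (\<lambda>y. case (x, y) of (x, y) \<Rightarrow> a x * b y)"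
    using b by simp
qed

text \<open>The change of variables is carried out with the inverse Moebius map \<open>g\<close>,
  from (l, w) onto (l, \<infinity>). In terms of a = w^2 - l^2, b = w - V, c = V^2 - l^2 one has w +
  g = a / b, g = V + c / b and g^2 - l^2 = a c / b^2, so every factor of the integrand
  splits.\<close>

lemma heat_factor_substitution:
  fixes s y t l m r :: real
  assumes s: "0 < s" "s < 1" and t: "t > 0" and l: "l > 0" and m: "m > 0" and q: "q = m / 2 + 1 - s"
  defines "w \<equiv> lcoth l t"
  shows "(\<integral>\<^sup>+v. ennreal (kernel_symbol s m t l * (cone_density q (y\<^sup>2) l v * ((1 / (w + v)) powr (m / 2) * exp (- (r\<^sup>2 / 4) * ((w * v + l\<^sup>2) / (w + v)))))) \<partial>lborel)
    = (\<integral>\<^sup>+V. ennreal (t powr (1 + s) * (cone_density q (r\<^sup>2 + y\<^sup>2) l V * heat_factor s (y\<^sup>2 / 4 * (V\<^sup>2 - l\<^sup>2)) l V t)) \<partial>lborel)"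
proof -
  have w: "w > l" unfolding w_def using l t by (rule lcoth_gt)
  define a where "a = w\<^sup>2 - l\<^sup>2"
  have a: "a > 0" using w l by (simp add: a_def power_strict_mono)
  define g where "g = (\<lambda>V. (w * V - l\<^sup>2) / (w - V))"
  have ks: "kernel_symbol s m t l = t powr (1 + s) * a powr (m / 4 + (1 + s) / 2)"
  proof -
    have S: "l / sinh (t * l) > 0" using l t by simp
    have "(l / sinh (t * l))\<^sup>2 = a" using lcoth_sq[OF l t] by (simp add: a_def w_def)
    then have la: "l / sinh (t * l) = a powr (1 / 2)"
      using S by (metis less_imp_le powr_half_sqrt real_sqrt_unique zero_le_power2)
    have tla: "t * l / sinh (t * l) = t * a powr (1 / 2)" unfolding la[symmetric] by simp
    have "m / 4 + (1 + s) / 2 = 1 / 2 * (m / 2) + 1 / 2 * (1 + s)" by argo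
    then have "a powr (m / 4 + (1 + s) / 2) = a powr (1 / 2 * (m / 2)) * a powr (1 / 2 * (1 + s))"
      by (simp only: powr_add)
    then show ?thesis unfolding kernel_symbol_def tla unfolding la powr_mult powr_powr
      by (simp only: mult_ac)
  qed
  define f where "f = (\<lambda>v. kernel_symbol s m t l * ((v\<^sup>2 - l\<^sup>2) powr (q / 2 - 1) * exp (- v * (y\<^sup>2 / 4)) * ((1 / (w + v)) powr (m / 2) * exp (- (r\<^sup>2 / 4) * ((w * v + l\<^sup>2) / (w + v))))))"
  define F where "F = (\<lambda>V. t powr (1 + s) * ((V\<^sup>2 - l\<^sup>2) powr (q / 2 - 1) * exp (- V * ((r\<^sup>2 + y\<^sup>2) / 4)) * (a * (w - V) powr (s - 1) * exp (- (y\<^sup>2 / 4 * (V\<^sup>2 - l\<^sup>2)) / (w - V)))))"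
  have "(\<integral>\<^sup>+V. ennreal (indicator {l<..<w} V * F V) \<partial>lborel) = (\<integral>\<^sup>+v. ennreal (indicator {l<..} v * f v) \<partial>lborel)"
  proof (rule nn_integral_change_of_variables_1[where g = g and g' = "\<lambda>V. a / (w - V)\<^sup>2"])
    show "(g has_real_derivative a / (w - V)\<^sup>2) (at V)" if "V \<in> {l<..<w}" for V
      unfolding g_def a_def using that by (auto intro!: derivative_eq_intros simp: power2_eq_square algebra_simps)
    \<comment> \<open>After translation by w the map is the reciprocal a / (w - V); this gives
      injectivity and the preimages.\<close>
    have shift: "g V + w = a / (w - V)" if "V \<in> {l<..<w}" for V
      using that by (simp add: g_def a_def divide_simps) (simp add: power2_eq_square algebra_simps)
    show "inj_on g {l<..<w}"
    proof (rule inj_onI)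
      fix x x' assume x: "x \<in> {l<..<w}" "x' \<in> {l<..<w}" "g x = g x'"
      then have "a / (w - x) = a / (w - x')" using shift by metis
      then show "x = x'" using a by simp
    qed
    show "g ` {l<..<w} = {l<..}"
    proof (intro set_eqI iffI)
      fix v assume "v \<in> g ` {l<..<w}"
      then obtain V where V: "V \<in> {l<..<w}" "v = g V" by auto
      have "l * (w - V) < w * V - l\<^sup>2"
      proof -
        have "(w + l) * (V - l) > 0" using V w l by (intro mult_pos_pos) auto
        then show ?thesis by (simp add: power2_eq_square algebra_simps)
      qed
      then show "v \<in> {l<..}" using V by (simp add: g_def pos_less_divide_eq)
    next
      fix v assume v: "v \<in> {l<..}"
      define V where "V = (w * v + l\<^sup>2) / (w + v)"
      have p: "w + v > 0" using v w l by simp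
      have "l * (w + v) < w * v + l\<^sup>2"
      proof -
        have "(w - l) * (v - l) > 0" using v w by (intro mult_pos_pos) auto
        then show ?thesis by (simp add: power2_eq_square algebra_simps)
      qed
      moreover have "w * v + l\<^sup>2 < w * (w + v)" using w l by (simp add: power2_eq_square algebra_simps mult_strict_mono)
      ultimately have V: "V \<in> {l<..<w}" using p by (simp add: V_def pos_less_divide_eq pos_divide_less_eq)
      have wV: "w - V = a / (w + v)" using p by (simp add: V_def a_def divide_simps) (simp add: power2_eq_square algebra_simps)
      have "g V + w = w + v" using shift[OF V] a p unfolding wV by simp
      then have "v = g V" by simp
      then show "v \<in> g ` {l<..<w}" using V by (rule image_eqI)
    qed
    show "F V = \<bar>a / (w - V)\<^sup>2\<bar> * f (g V)" if V: "V \<in> {l<..<w}" for V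
    proof -
      define b where "b = w - V"
      define c where "c = V\<^sup>2 - l\<^sup>2"
      have b: "b > 0" using V by (simp add: b_def)
      have c: "c > 0" using V l by (simp add: c_def power_strict_mono)
      have e1: "w + g V = a / b" using shift[OF V] by (simp add: b_def add.commute)
      \<comment> \<open>This splitting of g breaks exp (- g y^2 / 4) into exp (- V y^2 / 4), which
        restores R = r^2 + y^2 in the density, and the exponential of the heat factor.\<close>
      have e2: "g V = V + c / b" using b unfolding g_def b_def[symmetric]
        by (simp add: divide_simps) (simp add: b_def c_def power2_eq_square algebra_simps)
      have e3: "(g V)\<^sup>2 - l\<^sup>2 = a * c / b\<^sup>2"
      proof -
        have "g V = (w * V - l\<^sup>2) / b" by (simp add: g_def b_def)
        then have "(g V)\<^sup>2 = (w * V - l\<^sup>2)\<^sup>2 / b\<^sup>2" by (simp only: power_divide)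
        moreover have "X / b\<^sup>2 - l\<^sup>2 = (X - l\<^sup>2 * b\<^sup>2) / b\<^sup>2" for X using b by (simp add: field_simps)
        ultimately have "(g V)\<^sup>2 - l\<^sup>2 = ((w * V - l\<^sup>2)\<^sup>2 - l\<^sup>2 * b\<^sup>2) / b\<^sup>2" by simp
        also have "(w * V - l\<^sup>2)\<^sup>2 - l\<^sup>2 * b\<^sup>2 = a * c"
          by (simp add: a_def b_def c_def power2_eq_square algebra_simps)
        finally show ?thesis .
      qed
      have e4: "(w * g V + l\<^sup>2) / (a / b) = V"
      proof -
        have "w * g V + l\<^sup>2 = a * V / b"
          using b unfolding g_def b_def[symmetric] by (simp add: divide_simps) (simp add: a_def b_def power2_eq_square algebra_simps)
        then show ?thesis using a b by simp
      qed
      \<comment> \<open>The Jacobian, the symbol, the density and the Gaussian normalisation are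
        collected. The value of q makes the exponent of a equal to 1 and that of b equal to s -
        1.\<close>
      have pw: "a / b\<^sup>2 * (a powr (m / 4 + (1 + s) / 2) * ((a * c / b\<^sup>2) powr (q / 2 - 1) * (1 / (a / b)) powr (m / 2)))
          = c powr (q / 2 - 1) * (a * b powr (s - 1))"
      proof -
        have "(a * c / b\<^sup>2) powr (q / 2 - 1) = a powr (q / 2 - 1) * c powr (q / 2 - 1) * b powr (-2 * (q / 2 - 1))"
        proof -
          have "a * c / b\<^sup>2 = a * c * b powr (-2)" using b by (simp add: powr_minus_divide)
          then show ?thesis by (simp only: powr_mult powr_powr)
        qed
        moreover have "(1 / (a / b)) powr (m / 2) = a powr (- (m / 2)) * b powr (m / 2)"
          using a b by (simp add: powr_divide powr_minus_divide)
        moreover have "a / b\<^sup>2 = a powr 1 * b powr (-2)" using a b by (simp add: powr_minus_divide)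
        ultimately have "a / b\<^sup>2 * (a powr (m / 4 + (1 + s) / 2) * ((a * c / b\<^sup>2) powr (q / 2 - 1) * (1 / (a / b)) powr (m / 2)))
          = c powr (q / 2 - 1) * ((a powr 1 * a powr (m / 4 + (1 + s) / 2) * a powr (q / 2 - 1) * a powr (- (m / 2))) * (b powr (-2) * b powr (-2 * (q / 2 - 1)) * b powr (m / 2)))"
          by (simp only: mult_ac)
        also have "a powr 1 * a powr (m / 4 + (1 + s) / 2) * a powr (q / 2 - 1) * a powr (- (m / 2)) = a powr (1 + (m / 4 + (1 + s) / 2) + (q / 2 - 1) + - (m / 2))"
          by (simp only: powr_add)
        also have "1 + (m / 4 + (1 + s) / 2) + (q / 2 - 1) + - (m / 2) = 1" unfolding q by argo
        also have "b powr (-2) * b powr (-2 * (q / 2 - 1)) * b powr (m / 2) = b powr (-2 + -2 * (q / 2 - 1) + m / 2)"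
          by (simp only: powr_add)
        also have "-2 + -2 * (q / 2 - 1) + m / 2 = s - 1" unfolding q by argo
        finally show ?thesis using a by simp
      qed
      have ex: "exp (- g V * (y\<^sup>2 / 4)) * exp (- (r\<^sup>2 / 4) * V) = exp (- V * ((r\<^sup>2 + y\<^sup>2) / 4)) * exp (- (y\<^sup>2 / 4 * c) / b)"
        unfolding mult_exp_exp e2 using b by (simp add: field_simps)
      have "\<bar>a / (w - V)\<^sup>2\<bar> * f (g V) = a / b\<^sup>2 * (t powr (1 + s) * a powr (m / 4 + (1 + s) / 2) * ((a * c / b\<^sup>2) powr (q / 2 - 1) * exp (- g V * (y\<^sup>2 / 4)) * ((1 / (a / b)) powr (m / 2) * exp (- (r\<^sup>2 / 4) * V))))"
        unfolding f_def e1 e3 e4 ks using a by (simp add: b_def)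
      also have "\<dots> = t powr (1 + s) * ((a / b\<^sup>2 * (a powr (m / 4 + (1 + s) / 2) * ((a * c / b\<^sup>2) powr (q / 2 - 1) * (1 / (a / b)) powr (m / 2)))) * (exp (- g V * (y\<^sup>2 / 4)) * exp (- (r\<^sup>2 / 4) * V)))"
        by (simp only: mult_ac)
      also have "\<dots> = F V"
        unfolding pw ex unfolding F_def b_def[symmetric] c_def[symmetric] by (simp only: mult_ac)
      finally show ?thesis ..
    qed
    show "f \<in> borel_measurable borel" unfolding f_def by measurable
    show "F \<in> borel_measurable borel" unfolding F_def by measurable
    show "0 \<le> f v" for v by (simp add: f_def)
  qed auto
  moreover have "indicator {l<..<w} V * F V = t powr (1 + s) * (cone_density q (r\<^sup>2 + y\<^sup>2) l V * heat_factor s (y\<^sup>2 / 4 * (V\<^sup>2 - l\<^sup>2)) l V t)" for V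
    unfolding F_def cone_density_def heat_factor_def w_def[symmetric] a_def[symmetric] by (simp add: indicator_def)
  moreover have "indicator {l<..} v * f v = kernel_symbol s m t l * (cone_density q (y\<^sup>2) l v * ((1 / (w + v)) powr (m / 2) * exp (- (r\<^sup>2 / 4) * ((w * v + l\<^sup>2) / (w + v)))))" for v
    unfolding f_def cone_density_def by (simp add: indicator_def)
  ultimately show ?thesis by simp
qed

text \<open>For fixed v the x-integral is a translated Gaussian with a phase, so Fubini reduces the
  claim to \<open>heat_factor_substitution\<close>. Integrability in V is recorded as well, since
  the cone integral is later subtracted under the integral sign.\<close>

lemma cone_gauss_integral:
  fixes z \<eta> :: "'a::euclidean_space" and s y t l q :: real
  assumes s: "0 < s" "s < 1" and y: "y > 0" and t: "t > 0" and l: "l > 0" and q: "q = real DIM('a) / 2 + 1 - s"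
    and q0: "q > 0" and perp: "\<eta> \<bullet> z = 0" and \<eta>: "norm \<eta> = l * norm z / 2"
  shows "(LINT x|lborel. complex_of_real (kernel_symbol s (real DIM('a)) t l * exp (- (norm (z - x))\<^sup>2 * lcoth l t / 4) * cone q ((norm x)\<^sup>2 + y\<^sup>2) l) * cis (\<eta> \<bullet> x))
     = complex_of_real ((4 * pi) powr (real DIM('a) / 2) *
        (LINT V|lborel. t powr (1 + s) * (cone_density q ((norm z)\<^sup>2 + y\<^sup>2) l V * heat_factor s (y\<^sup>2 / 4 * (V\<^sup>2 - l\<^sup>2)) l V t)))"
    and "integrable lborel (\<lambda>V. t powr (1 + s) * (cone_density q ((norm z)\<^sup>2 + y\<^sup>2) l V * heat_factor s (y\<^sup>2 / 4 * (V\<^sup>2 - l\<^sup>2)) l V t))"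
proof -
  define m where "m = real DIM('a)"
  have m: "m > 0" unfolding m_def by simp
  define w where "w = lcoth l t"
  have w: "w > 0" using lcoth_gt[OF l t] l by (simp add: w_def)
  define K where "K = kernel_symbol s m t l"
  define c where "c = cone_density q (y\<^sup>2) l"
  have c0: "c v = 0" if "v \<le> l" for v using that by (simp add: c_def cone_density_def)
  have c_nn: "c v \<ge> 0" for v by (simp add: c_def)
  have [measurable]: "c \<in> borel_measurable borel" unfolding c_def by measurable
  have ci: "integrable lborel c" unfolding c_def using q0 y l by (intro integrable_cone_density) auto
  have cs: "cone_density q ((norm x)\<^sup>2 + y\<^sup>2) l v = c v * exp (- v * ((norm x)\<^sup>2 / 4))" for x :: 'a and v
    by (simp add: c_def cone_density_def mult_exp_exp algebra_simps add_divide_distrib)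
  define E where "E = (\<lambda>v. (1 / (w + v)) powr (m / 2) * exp (- ((norm z)\<^sup>2 / 4) * ((w * v + l\<^sup>2) / (w + v))))"
  have [measurable]: "E \<in> borel_measurable borel" unfolding E_def by measurable
  define f where "f = (\<lambda>x v. complex_of_real (exp (- (norm (z - x))\<^sup>2 * w / 4) * (c v * exp (- v * ((norm x)\<^sup>2 / 4)))) * cis (\<eta> \<bullet> x))"
  have [measurable]: "case_prod f \<in> borel_measurable (lborel \<Otimes>\<^sub>M lborel)" unfolding f_def by measurable
  have "integrable lborel (\<lambda>x. exp (- (w / 4) * (norm (- z + x))\<^sup>2))"
    using has_bochner_integral_lborel_shift[OF gauss_char[of "w / 4" "0::'a"], of "- z"] w
    unfolding has_bochner_integral_iff by (auto simp: complex_of_real_integrable_eq)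
  then have ei: "integrable lborel (\<lambda>x. exp (- (norm (z - x))\<^sup>2 * w / 4))"
    by (simp add: norm_minus_commute mult.commute)
  \<comment> \<open>On the support of the density v > l > 0, so the Gaussian in x coming from the
    density is at most 1 and the integrand is dominated by a product of functions of x and of
    v.\<close>
  have int: "integrable (lborel \<Otimes>\<^sub>M lborel) (case_prod f)"
  proof (rule Bochner_Integration.integrable_bound[OF integrable_mult_pair[OF ei ci]])
    have "norm (f x v) \<le> norm (exp (- (norm (z - x))\<^sup>2 * w / 4) * c v)" for x v
    proof (cases "v > l")
      case True
      then have "exp (- v * ((norm x)\<^sup>2 / 4)) \<le> 1" using l by simp
      then show ?thesis using c_nn[of v] unfolding f_def by (simp add: norm_mult abs_mult mult_left_le mult_left_mono)
    qed (simp add: f_def c0)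
    then show "AE p in lborel \<Otimes>\<^sub>M lborel. norm (case_prod f p) \<le> norm (case p of (x, v) \<Rightarrow> exp (- (norm (z - x))\<^sup>2 * w / 4) * c v)"
      by auto
  qed simp
  have "(LINT x|lborel. complex_of_real (exp (- (norm (z - x))\<^sup>2 * w / 4) * cone q ((norm x)\<^sup>2 + y\<^sup>2) l) * cis (\<eta> \<bullet> x))
     = (LINT x|lborel. LINT v|lborel. f x v)"
  proof (intro Bochner_Integration.integral_cong refl)
    fix x
    show "complex_of_real (exp (- (norm (z - x))\<^sup>2 * w / 4) * cone q ((norm x)\<^sup>2 + y\<^sup>2) l) * cis (\<eta> \<bullet> x) = (LINT v|lborel. f x v)"
      unfolding f_def cone_def cs by (simp only: integral_mult_left_zero integral_complex_of_real integral_mult_right_zero)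
  qed
  also have "\<dots> = (LINT v|lborel. LINT x|lborel. f x v)"
    by (rule lborel_pair.Fubini_integral[OF int, symmetric])
  also have "\<dots> = (LINT v|lborel. complex_of_real ((4 * pi) powr (m / 2) * (c v * E v)))"
  proof (intro Bochner_Integration.integral_cong refl)
    fix v
    show "(LINT x|lborel. f x v) = complex_of_real ((4 * pi) powr (m / 2) * (c v * E v))"
    proof (cases "v > l")
      case True
      then have v: "v > 0" using l by simp
      have "f x v = complex_of_real (c v) * (complex_of_real (exp (- (w * (norm (z - x))\<^sup>2 + v * (norm x)\<^sup>2) / 4)) * cis (\<eta> \<bullet> x))" for x
      proof -
        have "exp (- (norm (z - x))\<^sup>2 * w / 4) * exp (- v * ((norm x)\<^sup>2 / 4)) = exp (- (w * (norm (z - x))\<^sup>2 + v * (norm x)\<^sup>2) / 4)"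
          by (simp add: mult_exp_exp add_divide_distrib algebra_simps)
        then have "exp (- (norm (z - x))\<^sup>2 * w / 4) * (c v * exp (- v * ((norm x)\<^sup>2 / 4))) = c v * exp (- (w * (norm (z - x))\<^sup>2 + v * (norm x)\<^sup>2) / 4)"
          by (simp only: mult.left_commute)
        then show ?thesis unfolding f_def by (simp only: of_real_mult mult.assoc)
      qed
      then have "(LINT x|lborel. f x v) = complex_of_real (c v) * complex_of_real ((4 * pi / (w + v)) powr (real DIM('a) / 2) * exp (- (w * v * (norm z)\<^sup>2 / 4 + (norm \<eta>)\<^sup>2) / (w + v)))"
        by (simp only: integral_mult_right_zero has_bochner_integral_integral_eq[OF gauss_char_shift[OF w v perp]])
      also have "(4 * pi / (w + v)) powr (real DIM('a) / 2) * exp (- (w * v * (norm z)\<^sup>2 / 4 + (norm \<eta>)\<^sup>2) / (w + v)) = (4 * pi) powr (m / 2) * E v"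
      proof -
        have "4 * pi / (w + v) = 4 * pi * (1 / (w + v))" by simp
        then have "(4 * pi / (w + v)) powr (m / 2) = (4 * pi) powr (m / 2) * (1 / (w + v)) powr (m / 2)"
          by (simp only: powr_mult)
        moreover have "- (w * v * (norm z)\<^sup>2 / 4 + (norm \<eta>)\<^sup>2) / (w + v) = - ((norm z)\<^sup>2 / 4) * ((w * v + l\<^sup>2) / (w + v))"
        proof -
          \<comment> \<open>The norm condition supplies the term l^2 that completes w v to w v +
            l^2.\<close>
          have "(norm \<eta>)\<^sup>2 = l\<^sup>2 * (norm z)\<^sup>2 / 4" by (simp add: \<eta> power_mult_distrib power_divide)
          moreover have "- (w * v * Z / 4 + l\<^sup>2 * Z / 4) / (w + v) = - (Z / 4) * ((w * v + l\<^sup>2) / (w + v))" for Z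
            using w v by (simp add: divide_simps) (simp add: algebra_simps)
          ultimately show ?thesis by (simp only:)
        qed
        ultimately show ?thesis by (simp only: E_def m_def mult.assoc)
      qed
      finally show ?thesis by (simp add: mult_ac)
    qed (simp add: f_def c0)
  qed
  also have "\<dots> = complex_of_real ((4 * pi) powr (m / 2) * (LINT v|lborel. c v * E v))"
    by (simp only: integral_complex_of_real integral_mult_right_zero)
  finally have A: "(LINT x|lborel. complex_of_real (exp (- (norm (z - x))\<^sup>2 * w / 4) * cone q ((norm x)\<^sup>2 + y\<^sup>2) l) * cis (\<eta> \<bullet> x)) = \<dots>" .
  have Kn: "K \<ge> 0" by (simp add: K_def)
  have En: "E v \<ge> 0" for v by (simp add: E_def)
  have Ei: "integrable lborel (\<lambda>v. K * (c v * E v))"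
  proof (rule integrable_mult_right, rule Bochner_Integration.integrable_bound[OF integrable_mult_right[OF ci, of "(1 / w) powr (m / 2)"]])
    have "c v * E v \<le> (1 / w) powr (m / 2) * c v" for v
    proof (cases "v > l")
      case True
      then have "(1 / (w + v)) powr (m / 2) \<le> (1 / w) powr (m / 2)"
        using m w l by (intro powr_mono2) (auto intro!: divide_left_mono mult_pos_pos)
      moreover have "exp (- ((norm z)\<^sup>2 / 4) * ((w * v + l\<^sup>2) / (w + v))) \<le> 1"
        using True w l by (simp add: mult_nonneg_nonneg)
      ultimately have "E v \<le> (1 / w) powr (m / 2) * 1" unfolding E_def by (intro mult_mono) auto
      from mult_left_mono[OF this c_nn[of v]] show ?thesis by (simp add: mult.commute)
    qed (simp add: c0)
    then show "AE v in lborel. norm (c v * E v) \<le> norm ((1 / w) powr (m / 2) * c v)"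
      using c_nn En by (simp add: abs_mult)
  qed simp
  define G where "G = (\<lambda>V. t powr (1 + s) * (cone_density q ((norm z)\<^sup>2 + y\<^sup>2) l V * heat_factor s (y\<^sup>2 / 4 * (V\<^sup>2 - l\<^sup>2)) l V t))"
  have [measurable]: "G \<in> borel_measurable borel" unfolding G_def by measurable
  have Gn: "G V \<ge> 0" for V
    using lcoth_gt[OF l t] l unfolding G_def heat_factor_def by (auto intro!: mult_nonneg_nonneg power_mono)
  have sub: "(\<integral>\<^sup>+v. ennreal (K * (c v * E v)) \<partial>lborel) = (\<integral>\<^sup>+V. ennreal (G V) \<partial>lborel)"
    unfolding K_def c_def E_def G_def w_def by (rule heat_factor_substitution) (use s t l m q in \<open>auto simp: m_def\<close>)
  have Gi: "integrable lborel G"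
  proof (rule integrableI_nonneg)
    have "(\<integral>\<^sup>+v. ennreal (K * (c v * E v)) \<partial>lborel) < \<infinity>"
      using Ei by (subst nn_integral_eq_integral) (auto simp: Kn c_nn En)
    then show "(\<integral>\<^sup>+V. ennreal (G V) \<partial>lborel) < \<infinity>" using sub by simp
  qed (use Gn in auto)
  have "(LINT v|lborel. K * (c v * E v)) = (LINT V|lborel. G V)"
    using sub Kn c_nn En Gn by (subst (1 2) integral_eq_nn_integral) auto
  then have B: "K * (LINT v|lborel. c v * E v) = (LINT V|lborel. G V)" by simp
  have "(LINT x|lborel. complex_of_real (K * exp (- (norm (z - x))\<^sup>2 * w / 4) * cone q ((norm x)\<^sup>2 + y\<^sup>2) l) * cis (\<eta> \<bullet> x))
    = (LINT x|lborel. complex_of_real K * (complex_of_real (exp (- (norm (z - x))\<^sup>2 * w / 4) * cone q ((norm x)\<^sup>2 + y\<^sup>2) l) * cis (\<eta> \<bullet> x)))"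
    by (simp only: of_real_mult mult.assoc)
  also have "\<dots> = complex_of_real K * complex_of_real ((4 * pi) powr (m / 2) * (LINT v|lborel. c v * E v))"
    by (simp only: integral_mult_right_zero A)
  also have "\<dots> = complex_of_real ((4 * pi) powr (m / 2) * (LINT V|lborel. G V))"
    unfolding B[symmetric] by (simp only: of_real_mult mult_ac)
  finally show "(LINT x|lborel. complex_of_real (kernel_symbol s (real DIM('a)) t l * exp (- (norm (z - x))\<^sup>2 * lcoth l t / 4) * cone q ((norm x)\<^sup>2 + y\<^sup>2) l) * cis (\<eta> \<bullet> x))
     = complex_of_real ((4 * pi) powr (real DIM('a) / 2) *
        (LINT V|lborel. t powr (1 + s) * (cone_density q ((norm z)\<^sup>2 + y\<^sup>2) l V * heat_factor s (y\<^sup>2 / 4 * (V\<^sup>2 - l\<^sup>2)) l V t)))"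
    unfolding K_def w_def m_def G_def .
  show "integrable lborel (\<lambda>V. t powr (1 + s) * (cone_density q ((norm z)\<^sup>2 + y\<^sup>2) l V * heat_factor s (y\<^sup>2 / 4 * (V\<^sup>2 - l\<^sup>2)) l V t))"
    using Gi unfolding G_def .
qed

context heisenberg_algebra
begin

text \<open>With the \<mu>-integral moved outside, the \<tau>-integral is the radial transform of u
  and the x-integral is \<open>cone_gauss_integral\<close>. The operator thus multiplies the cone
  density of u by t^(1 + s) times the heat factor.\<close>

lemma P_op_eq:
  fixes z :: 'v and \<sigma> :: 'w and s y t :: real
  assumes s: "0 < s" "s < 1" and y: "y > 0" and t: "t > 0"
  defines "q \<equiv> real DIM('v) / 2 + 1 - s"
  defines "u \<equiv> \<lambda>(x::'v, \<tau>::'w). complex_of_real ((((norm x)\<^sup>2 + y\<^sup>2)\<^sup>2 + 16 * (norm \<tau>)\<^sup>2) powr (- (q + real DIM('w) - 1) / 2))"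
  defines "G \<equiv> \<lambda>l V. t powr (1 + s) * (cone_density q ((norm z)\<^sup>2 + y\<^sup>2) l V * heat_factor s (y\<^sup>2 / 4 * (V\<^sup>2 - l\<^sup>2)) l V t)"
  shows "integrable lborel (\<lambda>g'. kernel s (group_mult br (group_inv g') (z, \<sigma>)) t * u g')"
    and "integrable lborel (\<lambda>\<mu>::'w. complex_of_real (LINT V|lborel. G (norm \<mu>) V) * cis ((- \<sigma>) \<bullet> \<mu>))"
    and "P_op br s t u (z, \<sigma>) = complex_of_real (1 / riesz_const (real DIM('w)) q) *
        (LINT \<mu>|lborel. complex_of_real (LINT V|lborel. G (norm \<mu>) V) * cis ((- \<sigma>) \<bullet> \<mu>))"
proof -
  define m where "m = real DIM('v)"
  define k where "k = real DIM('w)"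
  have m: "m \<ge> 2" using DIM_layer1_ge_2 by (simp add: m_def)
  have k: "k > 0" by (simp add: k_def)
  have q1: "q > 1" using m s unfolding q_def m_def[symmetric] by simp
  define uf where "uf = (\<lambda>(x::'v) (\<tau>::'w). (((norm x)\<^sup>2 + y\<^sup>2)\<^sup>2 + 16 * (norm \<tau>)\<^sup>2) powr (- (q + k - 1) / 2))"
  have u: "u (x, \<tau>) = complex_of_real (uf x \<tau>)" for x \<tau> by (simp add: u_def uf_def k_def)
  have uf_nn: "uf x \<tau> \<ge> 0" for x \<tau> by (simp add: uf_def)
  have uf_le: "uf x \<tau> \<le> uf 0 \<tau>" for x \<tau>
  proof -
    have "(y\<^sup>2)\<^sup>2 \<le> ((norm x)\<^sup>2 + y\<^sup>2)\<^sup>2" by (intro power_mono) auto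
    moreover have "(y\<^sup>2)\<^sup>2 + 16 * (norm \<tau>)\<^sup>2 > 0" using y by (intro add_pos_nonneg) auto
    ultimately show ?thesis unfolding uf_def using q1 k by (intro powr_mono2') auto
  qed
  have Rpos: "(norm x)\<^sup>2 + y\<^sup>2 > 0" for x :: 'v using y by (simp add: add_nonneg_pos)
  have uchar: "has_bochner_integral lborel (\<lambda>\<tau>. complex_of_real (uf x \<tau>) * cis (\<mu> \<bullet> \<tau>))
     (complex_of_real ((2 * pi) powr k / riesz_const k q * cone q ((norm x)\<^sup>2 + y\<^sup>2) (norm \<mu>)))" for x \<mu>
    unfolding uf_def k_def by (rule char_radial_power[OF q1 Rpos])
  have u0i: "integrable lborel (uf 0)"
    using uchar[of 0 0] unfolding has_bochner_integral_iff by (auto simp: complex_of_real_integrable_eq)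
  define ks where "ks = kernel_symbol s m t"
  have [measurable]: "ks \<in> borel_measurable borel" unfolding ks_def by measurable
  have ks_nn: "ks l \<ge> 0" for l by (simp add: ks_def)
  have ksi: "integrable lborel (\<lambda>\<mu>::'w. ks (norm \<mu>))"
    unfolding ks_def by (rule integrable_kernel_symbol) (use t m s in auto)
  define C0 where "C0 = (2 * pi) powr (- k) * (4 * pi) powr (- m / 2)"
  define f where "f = (\<lambda>p \<mu>. complex_of_real (ks (norm \<mu>) * exp (- (norm (z - fst p))\<^sup>2 * lcoth (norm \<mu>) t / 4) * uf (fst p) (snd p))
       * cis (- ((\<sigma> - snd p - (1/2) *\<^sub>R bracket (fst p) z) \<bullet> \<mu>)))"
  \<comment> \<open>A majorant in which the variables separate: u is largest at x = 0, and
    \<open>lcoth\<close> is at least 1 / t whatever the frequency, so b times the symbol dominates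
    the integrand.\<close>
  define b where "b = (\<lambda>(x, \<tau>). exp (- (norm (z - x))\<^sup>2 * (1 / t) / 4) * uf 0 \<tau>)"
  have "integrable lborel (\<lambda>x. exp (- ((1 / t) / 4) * (norm (- z + x))\<^sup>2))"
    using has_bochner_integral_lborel_shift[OF gauss_char[of "(1 / t) / 4" "0::'v"], of "- z"] t
    unfolding has_bochner_integral_iff by (auto simp: complex_of_real_integrable_eq)
  then have "integrable lborel (\<lambda>x. exp (- (norm (z - x))\<^sup>2 * (1 / t) / 4))"
    by (simp add: norm_minus_commute mult.commute)
  from integrable_mult_pair[OF this u0i] have bi': "integrable (lborel \<Otimes>\<^sub>M lborel) b" by (simp add: b_def)
  then have bi: "integrable lborel b" by (simp add: lborel_prod)
  have [measurable]: "case_prod f \<in> borel_measurable ((lborel \<Otimes>\<^sub>M lborel) \<Otimes>\<^sub>M lborel)"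
    unfolding f_def uf_def by measurable
  have f_le: "norm (f p \<mu>) \<le> b p * ks (norm \<mu>)" for p \<mu>
  proof -
    obtain x \<tau> where p: "p = (x, \<tau>)" by fastforce
    show ?thesis
    \<comment> \<open>At \<mu> = 0 division by zero makes \<open>lcoth\<close> equal to 0, so the
      lower bound 1 / t fails there; but the symbol is 0 too.\<close>
    proof (cases "\<mu> = 0")
      case False
      have "norm (f p \<mu>) = (ks (norm \<mu>) * exp (- (norm (z - x))\<^sup>2 * lcoth (norm \<mu>) t / 4)) * uf x \<tau>"
        unfolding p f_def using ks_nn uf_nn by (simp add: norm_mult abs_mult)
      also have "\<dots> \<le> (ks (norm \<mu>) * exp (- (norm (z - x))\<^sup>2 * (1 / t) / 4)) * uf 0 \<tau>"
      proof (intro mult_mono uf_le order_refl)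
        have "(norm (z - x))\<^sup>2 * (1 / t) \<le> (norm (z - x))\<^sup>2 * lcoth (norm \<mu>) t"
          using lcoth_ge[of "norm \<mu>" t] t False by (intro mult_left_mono) auto
        then show "exp (- (norm (z - x))\<^sup>2 * lcoth (norm \<mu>) t / 4) \<le> exp (- (norm (z - x))\<^sup>2 * (1 / t) / 4)" by simp
      qed (auto simp: ks_nn uf_nn)
      finally show ?thesis by (simp add: p b_def mult_ac)
    qed (simp add: p f_def ks_def)
  qed
  have b_nn: "b p \<ge> 0" for p by (auto simp: b_def uf_nn split: prod.split)
  have fint: "integrable (lborel \<Otimes>\<^sub>M lborel) (case_prod f)"
  proof (rule Bochner_Integration.integrable_bound[OF integrable_mult_pair[OF bi ksi]])
    show "AE p in lborel \<Otimes>\<^sub>M lborel. norm (case_prod f p) \<le> norm (case p of (x, xa) \<Rightarrow> b x * ks (norm xa))"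
      using f_le b_nn ks_nn by (auto simp: abs_mult)
  qed (simp add: lborel_prod[symmetric])
  have fint2: "integrable (lborel \<Otimes>\<^sub>M lborel) (\<lambda>p. f p \<mu>)" for \<mu>
  proof (rule Bochner_Integration.integrable_bound[OF integrable_mult_left[OF bi', of "ks (norm \<mu>)"]])
    show "AE p in lborel \<Otimes>\<^sub>M lborel. norm (f p \<mu>) \<le> norm (b p * ks (norm \<mu>))"
      using f_le b_nn ks_nn by (auto simp: abs_mult)
  qed (unfold f_def uf_def, measurable)
  have ker: "kernel s (group_mult br (group_inv p) (z, \<sigma>)) t * u p = complex_of_real C0 * (LINT \<mu>|lborel. f p \<mu>)" for p
  proof -
    obtain x \<tau> where p: "p = (x, \<tau>)" by fastforce
    define \<rho> where "\<rho> = \<sigma> - \<tau> - (1/2) *\<^sub>R bracket x z"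
    have "kernel s (group_mult br (group_inv p) (z, \<sigma>)) t * u p = 
      complex_of_real C0 * (LINT \<mu>|lborel. of_real (ks (norm \<mu>) * exp (- (norm (z - x))\<^sup>2 * lcoth (norm \<mu>) t / 4)) * cis (- (\<rho> \<bullet> \<mu>))) * complex_of_real (uf x \<tau>)"
      unfolding p group_mult_inv \<rho>_def[symmetric] kernel_eq[OF t] u C0_def ks_def k_def m_def ..
    also have "\<dots> = complex_of_real C0 * (LINT \<mu>|lborel. of_real (ks (norm \<mu>) * exp (- (norm (z - x))\<^sup>2 * lcoth (norm \<mu>) t / 4)) * cis (- (\<rho> \<bullet> \<mu>)) * complex_of_real (uf x \<tau>))"
      by (simp only: mult.assoc integral_mult_left_zero[symmetric])
    also have "\<dots> = complex_of_real C0 * (LINT \<mu>|lborel. f p \<mu>)"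
      unfolding f_def p \<rho>_def by (simp add: mult_ac)
    finally show ?thesis .
  qed
  show "integrable lborel (\<lambda>g'. kernel s (group_mult br (group_inv g') (z, \<sigma>)) t * u g')"
    unfolding ker by (intro integrable_mult_right lborel_pair.integrable_fst[OF fint])
  define D where "D = (2 * pi) powr k / riesz_const k q"
  have inner: "(LINT p|lborel. f p \<mu>) = complex_of_real (D * (4 * pi) powr (m / 2)) * (complex_of_real (LINT V|lborel. G (norm \<mu>) V) * cis ((- \<sigma>) \<bullet> \<mu>))"
    if \<mu>: "\<mu> \<noteq> 0" for \<mu>
  proof -
    \<comment> \<open>The group law shifts the second coordinate by half the bracket of x and z;
      skew-symmetry of J(\<mu>) converts its pairing with \<mu> into the inner product of \<eta>
      with x.\<close>
    define \<eta> where "\<eta> = - (1/2) *\<^sub>R kaplan br \<mu> z"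
    have perp: "\<eta> \<bullet> z = 0" by (simp add: \<eta>_def kaplan_perp)
    have n\<eta>: "norm \<eta> = norm \<mu> * norm z / 2" by (simp add: \<eta>_def norm_kaplan)
    define E where "E = (\<lambda>x. ks (norm \<mu>) * exp (- (norm (z - x))\<^sup>2 * lcoth (norm \<mu>) t / 4))"
    have ph: "cis (- ((\<sigma> - \<tau> - (1/2) *\<^sub>R bracket x z) \<bullet> \<mu>)) = cis ((- \<sigma>) \<bullet> \<mu>) * cis (\<eta> \<bullet> x) * cis (\<mu> \<bullet> \<tau>)" for x \<tau>
      unfolding cis_mult
      by (rule arg_cong[of _ _ cis]) (simp add: \<eta>_def inner_diff_left bracket_inner inner_commute[of \<tau> \<mu>])
    have "(LINT p|lborel. f p \<mu>) = (LINT x|lborel. LINT \<tau>|lborel. f (x, \<tau>) \<mu>)"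
      using lborel_pair.integral_fst'[OF fint2[of \<mu>]] by (simp add: lborel_prod)
    also have "\<dots> = (LINT x|lborel. complex_of_real (D * (E x * cone q ((norm x)\<^sup>2 + y\<^sup>2) (norm \<mu>))) * (cis ((- \<sigma>) \<bullet> \<mu>) * cis (\<eta> \<bullet> x)))"
    proof (intro Bochner_Integration.integral_cong refl)
      fix x
      have "(LINT \<tau>|lborel. f (x, \<tau>) \<mu>) = (LINT \<tau>|lborel. (complex_of_real (E x) * (cis ((- \<sigma>) \<bullet> \<mu>) * cis (\<eta> \<bullet> x))) * (complex_of_real (uf x \<tau>) * cis (\<mu> \<bullet> \<tau>)))"
        unfolding f_def fst_conv snd_conv ph E_def by (simp only: of_real_mult mult_ac)
      also have "\<dots> = (complex_of_real (E x) * (cis ((- \<sigma>) \<bullet> \<mu>) * cis (\<eta> \<bullet> x))) * complex_of_real (D * cone q ((norm x)\<^sup>2 + y\<^sup>2) (norm \<mu>))"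
        unfolding D_def by (simp only: integral_mult_right_zero has_bochner_integral_integral_eq[OF uchar])
      finally show "(LINT \<tau>|lborel. f (x, \<tau>) \<mu>) = complex_of_real (D * (E x * cone q ((norm x)\<^sup>2 + y\<^sup>2) (norm \<mu>))) * (cis ((- \<sigma>) \<bullet> \<mu>) * cis (\<eta> \<bullet> x))"
        by (simp only: of_real_mult mult_ac)
    qed
    also have "\<dots> = (LINT x|lborel. (complex_of_real D * cis ((- \<sigma>) \<bullet> \<mu>)) * (complex_of_real (E x * cone q ((norm x)\<^sup>2 + y\<^sup>2) (norm \<mu>)) * cis (\<eta> \<bullet> x)))"
      by (simp only: of_real_mult mult_ac)
    also have "\<dots> = (complex_of_real D * cis ((- \<sigma>) \<bullet> \<mu>)) * complex_of_real ((4 * pi) powr (m / 2) * (LINT V|lborel. G (norm \<mu>) V))"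
      unfolding integral_mult_right_zero E_def ks_def m_def G_def
      by (subst cone_gauss_integral(1)) (use s y t \<mu> q1 perp n\<eta> in \<open>auto simp: q_def\<close>)
    finally show ?thesis by (simp only: of_real_mult mult_ac)
  qed
  define d where "d = riesz_const k q"
  have d: "d \<noteq> 0"
  proof -
    have "d > 0" using q1 k unfolding d_def riesz_const_def by (auto intro!: mult_pos_pos Gamma_real_pos)
    then show ?thesis by simp
  qed
  \<comment> \<open>The kernel constant cancels the factor (2 pi)^k of the radial transform and the
    factor (4 pi)^(m / 2) of the Gaussian integral.\<close>
  have DC: "C0 * (D * (4 * pi) powr (m / 2)) = 1 / d"
  proof -
    have "(2 * pi) powr (- k) * (2 * pi) powr k = 1" "(4 * pi) powr (- m / 2) * (4 * pi) powr (m / 2) = 1"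
      by (simp_all add: powr_add[symmetric])
    moreover have "C0 * (D * (4 * pi) powr (m / 2)) = ((2 * pi) powr (- k) * (2 * pi) powr k) * ((4 * pi) powr (- m / 2) * (4 * pi) powr (m / 2)) / d"
      by (simp add: C0_def D_def d_def)
    ultimately show ?thesis by simp
  qed
  have D0: "D * (4 * pi) powr (m / 2) \<noteq> 0" using d by (simp add: D_def d_def)
  have AE0: "AE \<mu> in lborel. \<mu> \<noteq> (0::'w)" by (rule AE_lborel_singleton)
  have meas: "(\<lambda>\<mu>::'w. complex_of_real (LINT V|lborel. G (norm \<mu>) V) * cis ((- \<sigma>) \<bullet> \<mu>)) \<in> borel_measurable lborel"
    unfolding G_def by measurable
  have "integrable lborel (\<lambda>\<mu>. LINT p|lborel. f p \<mu>)"
    by (rule lborel_pair.integrable_snd[OF fint])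
  then have "integrable lborel (\<lambda>\<mu>. complex_of_real (1 / (D * (4 * pi) powr (m / 2))) * (LINT p|lborel. f p \<mu>))"
    by (rule integrable_mult_right)
  then show "integrable lborel (\<lambda>\<mu>::'w. complex_of_real (LINT V|lborel. G (norm \<mu>) V) * cis ((- \<sigma>) \<bullet> \<mu>))"
  proof (rule integrable_cong_AE_imp[OF _ meas])
    show "AE \<mu> in lborel. complex_of_real (1 / (D * (4 * pi) powr (m / 2))) * (LINT p|lborel. f p \<mu>) = complex_of_real (LINT V|lborel. G (norm \<mu>) V) * cis ((- \<sigma>) \<bullet> \<mu>)"
      using AE0 D0 by (auto simp: inner)
  qed
  have "P_op br s t u (z, \<sigma>) = complex_of_real C0 * (LINT p|lborel. LINT \<mu>|lborel. f p \<mu>)"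
    unfolding P_op_def ker by (rule integral_mult_right_zero)
  also have "(LINT p|lborel. LINT \<mu>|lborel. f p \<mu>) = (LINT \<mu>|lborel. LINT p|lborel. f p \<mu>)"
    by (rule lborel_pair.Fubini_integral[OF fint, symmetric])
  also have "\<dots> = (LINT \<mu>|lborel. complex_of_real (D * (4 * pi) powr (m / 2)) * (complex_of_real (LINT V|lborel. G (norm \<mu>) V) * cis ((- \<sigma>) \<bullet> \<mu>)))"
  proof (rule integral_cong_AE)
    show "AE \<mu> in lborel. (LINT p|lborel. f p \<mu>) = complex_of_real (D * (4 * pi) powr (m / 2)) * (complex_of_real (LINT V|lborel. G (norm \<mu>) V) * cis ((- \<sigma>) \<bullet> \<mu>))"
      using AE0 by eventually_elim (rule inner)
    show "(\<lambda>\<mu>. LINT p|lborel. f p \<mu>) \<in> borel_measurable lborel"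
      using lborel_pair.integrable_snd[OF fint] by auto
    show "(\<lambda>\<mu>. complex_of_real (D * (4 * pi) powr (m / 2)) * (complex_of_real (LINT V|lborel. G (norm \<mu>) V) * cis ((- \<sigma>) \<bullet> \<mu>))) \<in> borel_measurable lborel"
      using meas by measurable
  qed
  also have "\<dots> = complex_of_real (D * (4 * pi) powr (m / 2)) * (LINT \<mu>|lborel. complex_of_real (LINT V|lborel. G (norm \<mu>) V) * cis ((- \<sigma>) \<bullet> \<mu>))"
    by (rule integral_mult_right_zero)
  finally show "P_op br s t u (z, \<sigma>) = complex_of_real (1 / riesz_const (real DIM('w)) q) *
        (LINT \<mu>|lborel. complex_of_real (LINT V|lborel. G (norm \<mu>) V) * cis ((- \<sigma>) \<bullet> \<mu>))"
    unfolding k_def[symmetric] d_def[symmetric] DC[symmetric] by (simp only: of_real_mult mult.assoc)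
qed

end

section \<open>The fractional Laplacian\<close>

text \<open>Fubini for a against the pair (b, c). The hypothesis has the a-integral innermost
  because, with a the time, that integral is where cancellation is available.\<close>

lemma Fubini_triple:
  fixes f :: "'a::euclidean_space \<Rightarrow> 'b::euclidean_space \<Rightarrow> 'c::euclidean_space \<Rightarrow> complex"
  assumes meas[measurable]: "(\<lambda>(a, b, c). f a b c) \<in> borel_measurable (lborel \<Otimes>\<^sub>M (lborel \<Otimes>\<^sub>M lborel))"
    and fin: "(\<integral>\<^sup>+b. (\<integral>\<^sup>+c. (\<integral>\<^sup>+a. ennreal (norm (f a b c)) \<partial>lborel) \<partial>lborel) \<partial>lborel) < \<infinity>"
  shows "integrable lborel (\<lambda>a. LINT b|lborel. LINT c|lborel. f a b c)" (is ?I)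
    and "(LINT a|lborel. LINT b|lborel. LINT c|lborel. f a b c) = (LINT b|lborel. LINT c|lborel. LINT a|lborel. f a b c)" (is ?E)
proof -
  define F where "F = (\<lambda>a (p :: 'b \<times> 'c). f a (fst p) (snd p))"
  have Fm [measurable]: "case_prod F \<in> borel_measurable (lborel \<Otimes>\<^sub>M (lborel \<Otimes>\<^sub>M lborel))"
    using meas by (simp add: F_def split_beta')
  have Fm' [measurable]: "case_prod F \<in> borel_measurable (lborel \<Otimes>\<^sub>M lborel)"
    using Fm by (simp only: lborel_prod)
  have int: "integrable (lborel \<Otimes>\<^sub>M lborel) (case_prod F)"
  proof (rule integrableI_bounded)
    have "(\<integral>\<^sup>+p. ennreal (norm (case_prod F p)) \<partial>(lborel \<Otimes>\<^sub>M lborel)) = (\<integral>\<^sup>+p. (\<integral>\<^sup>+a. ennreal (norm (F a p)) \<partial>lborel) \<partial>lborel)"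
      by (subst lborel_pair.nn_integral_snd[symmetric]) (auto simp: split_beta')
    also have "\<dots> = (\<integral>\<^sup>+p. (\<integral>\<^sup>+a. ennreal (norm (F a p)) \<partial>lborel) \<partial>(lborel \<Otimes>\<^sub>M lborel))"
      by (simp only: lborel_prod)
    also have "\<dots> = (\<integral>\<^sup>+b. (\<integral>\<^sup>+c. (\<integral>\<^sup>+a. ennreal (norm (F a (b, c))) \<partial>lborel) \<partial>lborel) \<partial>lborel)"
      by (rule lborel.nn_integral_fst[symmetric]) measurable
    finally show "(\<integral>\<^sup>+p. ennreal (norm (case_prod F p)) \<partial>(lborel \<Otimes>\<^sub>M lborel)) < \<infinity>" using fin by (simp add: F_def)
  qed (rule Fm')
  have m1: "(\<lambda>a. LINT b|lborel. LINT c|lborel. f a b c) \<in> borel_measurable lborel"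
  proof -
    have "(\<lambda>((a, b), c). f a b c) \<in> borel_measurable ((lborel \<Otimes>\<^sub>M lborel) \<Otimes>\<^sub>M lborel)"
      using measurable_compose[OF _ meas, of "\<lambda>((a, b), c). (a, b, c)" "(lborel \<Otimes>\<^sub>M lborel) \<Otimes>\<^sub>M lborel"]
      by (simp add: split_beta')
    then have "(\<lambda>(a, b). LINT c|lborel. f a b c) \<in> borel_measurable (lborel \<Otimes>\<^sub>M lborel)"
      using lborel.borel_measurable_lebesgue_integral[of "\<lambda>(a, b) c. f a b c"] by (simp add: split_beta')
    then show ?thesis
      by (rule lborel.borel_measurable_lebesgue_integral)
  qed
  \<comment> \<open>The pair integral splits into iterated integrals only for almost every a; the
    separate measurability \<open>m1\<close> lets integrability and value pass to the iterated
    form.\<close>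
  have eq: "AE a in lborel. (LINT p|lborel. F a p) = (LINT b|lborel. LINT c|lborel. f a b c)"
    using lborel_pair.AE_integrable_fst[OF int]
  proof eventually_elim
    case (elim a)
    then have "integrable (lborel \<Otimes>\<^sub>M lborel) (F a)" by (simp only: lborel_prod)
    from lborel_pair.integral_fst'[OF this] show ?case by (simp add: F_def lborel_prod)
  qed
  have i1: "integrable lborel (\<lambda>a. LINT p|lborel. F a p)" by (rule lborel_pair.integrable_fst[OF int])
  show ?I by (rule integrable_cong_AE_imp[OF i1 m1]) (use eq in \<open>auto elim: eventually_mono\<close>)
  have "(LINT a|lborel. LINT b|lborel. LINT c|lborel. f a b c) = (LINT a|lborel. LINT p|lborel. F a p)"
    by (rule integral_cong_AE[OF m1]) (use i1 eq in \<open>auto elim: eventually_mono\<close>)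
  also have "\<dots> = (LINT p|lborel. LINT a|lborel. F a p)"
    by (rule lborel_pair.Fubini_integral[OF int, symmetric])
  also have "\<dots> = integral\<^sup>L (lborel \<Otimes>\<^sub>M lborel) (\<lambda>p. LINT a|lborel. F a p)"
    by (simp only: lborel_prod)
  also have "\<dots> = (LINT b|lborel. LINT c|lborel. LINT a|lborel. F a (b, c))"
  proof -
    have "integrable (lborel \<Otimes>\<^sub>M lborel) (\<lambda>p. LINT a|lborel. F a p)"
      using lborel_pair.integrable_snd[OF int] by (simp only: lborel_prod)
    from lborel_pair.integral_fst'[OF this] show ?thesis by simp
  qed
  finally show ?E by (simp add: F_def)
qed

section \<open>Bounds that justify interchanging the integrals\<close>

lemma integrable_cone:
  assumes "q > 0" "R > 0"
  shows "integrable lborel (\<lambda>x::'a::euclidean_space. cone q R (norm x))"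
  using cone_char[OF assms, of "0::'a"] unfolding has_bochner_integral_iff
  by (auto simp: complex_of_real_integrable_eq)

lemma frac_kernel_measurable [measurable]:
  assumes [measurable]: "a \<in> borel_measurable M" "b \<in> borel_measurable M" "c \<in> borel_measurable M" "d \<in> borel_measurable M"
  shows "(\<lambda>x. frac_kernel s (a x) (b x) (c x) (d x)) \<in> borel_measurable M"
  unfolding frac_kernel_def by measurable

lemma cone_density_mult_powr:
  assumes "l \<ge> 0"
  shows "cone_density q R l V * (a * (V\<^sup>2 - l\<^sup>2)) powr s = a powr s * cone_density (q + 2 * s) R l V"
proof (cases "l < V")
  case True
  then have "V\<^sup>2 - l\<^sup>2 > 0" using assms by (simp add: power_strict_mono)
  then have "(V\<^sup>2 - l\<^sup>2) powr (q / 2 - 1) * (V\<^sup>2 - l\<^sup>2) powr s = (V\<^sup>2 - l\<^sup>2) powr ((q + 2 * s) / 2 - 1)"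
    by (subst powr_add[symmetric]) (rule arg_cong[of _ _ "\<lambda>e. (V\<^sup>2 - l\<^sup>2) powr e"], simp add: field_simps)
  then show ?thesis using True by (simp add: cone_density_def powr_mult) 
qed (simp add: cone_density_def)

text \<open>The growth V^s \<le> 1 + V is paid for with half of the exponential decay: 1 + V \<le>
  (1 + 8 / R) exp (V R / 8), and exp (- V R / 4) exp (V R / 8) is the exponential belonging to R /
  2.\<close>

lemma cone_density_mult_powr_le:
  assumes s: "0 < s" "s < 1" and R: "R > 0" and l: "l \<ge> 0"
  shows "cone_density q R l V * V powr s \<le> (1 + 8 / R) * cone_density q (R / 2) l V"
proof (cases "l < V")
  case True
  then have V: "V > 0" using l by simp
  have "V powr s \<le> 1 + V"
  proof (cases "V \<le> 1")
    case True
    then have "V powr s \<le> 1" using V s by (simp add: powr_le1)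
    then show ?thesis using V by simp
  next
    case False
    then have "V powr s \<le> V powr 1" using s by (intro powr_mono) auto
    then show ?thesis using V by simp
  qed
  also have "1 + V \<le> (1 + 8 / R) * exp (V * R / 8)"
  proof -
    have "V * R / 8 \<le> exp (V * R / 8)" "1 \<le> exp (V * R / 8)"
      using exp_ge_add_one_self[of "V * R / 8"] mult_pos_pos[OF V R] by linarith+
    then have "(8 / R) * (V * R / 8) \<le> (8 / R) * exp (V * R / 8)" using R by (intro mult_left_mono) auto
    then have "V \<le> (8 / R) * exp (V * R / 8)" using R by simp
    with \<open>1 \<le> exp (V * R / 8)\<close> have "1 + V \<le> exp (V * R / 8) + (8 / R) * exp (V * R / 8)"
      by (rule add_mono)
    then show ?thesis by (simp only: distrib_right mult_1_left)
  qed
  finally have "exp (- V * (R / 4)) * V powr s \<le> exp (- V * (R / 4)) * ((1 + 8 / R) * exp (V * R / 8))"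
    by (intro mult_left_mono) auto
  also have "\<dots> = (1 + 8 / R) * exp (- V * (R / 2 / 4))"
    by (simp add: mult_exp_exp mult.left_commute)
  finally have "(V\<^sup>2 - l\<^sup>2) powr (q / 2 - 1) * (exp (- V * (R / 4)) * V powr s) \<le> (V\<^sup>2 - l\<^sup>2) powr (q / 2 - 1) * ((1 + 8 / R) * exp (- V * (R / 2 / 4)))"
    by (intro mult_left_mono) auto
  then show ?thesis using True by (simp add: cone_density_def mult_ac)
qed (simp add: cone_density_def)

text \<open>The density does not depend on t and vanishes for V \<le> l, so only V > l calls for
  \<open>frac_kernel_integral\<close>. There A^s shifts q by 2 s, and the bound is a sum of cone
  densities, hence integrable in V and then in \<mu>.\<close>

lemma frac_kernel_cone_integrals:
  fixes s y R l q :: real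
  assumes s: "0 < s" "s < 1" and y: "y > 0" and R: "R > 0" and l: "l > 0" and q: "q > 0"
  defines "h \<equiv> \<lambda>t V. indicator {0<..} t * (cone_density q R l V * frac_kernel s (y\<^sup>2 / 4 * (V\<^sup>2 - l\<^sup>2)) l V t)"
  shows "(LINT t|lborel. h t V) = - (Gamma (1 - s) / s * (y\<^sup>2 / 4) powr s) * cone_density (q + 2 * s) R l V" (is "?A = ?B")
    and "(\<integral>\<^sup>+t. ennreal \<bar>h t V\<bar> \<partial>lborel) \<le> ennreal (Gamma (1 - s) / s * (y\<^sup>2 / 4) powr s * cone_density (q + 2 * s) R l V + 2 / s * ((1 + 8 / R) * cone_density q (R / 2) l V))" (is ?C)
proof -
  have "?A = ?B \<and> ?C"
  proof (cases "l < V")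
    case True
    define A where "A = y\<^sup>2 / 4 * (V\<^sup>2 - l\<^sup>2)"
    have A: "A > 0" using y True l by (simp add: A_def power_strict_mono)
    define c where "c = cone_density q R l V"
    have c: "c \<ge> 0" by (simp add: c_def)
    have h: "h t V = c * (indicator {0<..} t * frac_kernel s A l V t)" for t
      by (simp add: h_def c_def A_def)
    have cA: "c * A powr s = (y\<^sup>2 / 4) powr s * cone_density (q + 2 * s) R l V"
      unfolding c_def A_def using l by (intro cone_density_mult_powr) simp
    note fk = frac_kernel_integral[OF s l True A]
    have "?A = c * - (Gamma (1 - s) / s * A powr s)"
      unfolding h by (simp only: integral_mult_right_zero has_bochner_integral_integral_eq[OF fk(1)])
    also have "\<dots> = - (Gamma (1 - s) / s * (c * A powr s))" by simp
    also have "\<dots> = ?B" unfolding cA by simp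
    finally have 1: "?A = ?B" .
    have "(\<integral>\<^sup>+t. ennreal \<bar>h t V\<bar> \<partial>lborel) = ennreal c * (\<integral>\<^sup>+t. ennreal \<bar>indicator {0<..} t * frac_kernel s A l V t\<bar> \<partial>lborel)"
      unfolding h using c by (subst nn_integral_cmult[symmetric]) (auto simp: abs_mult ennreal_mult'[symmetric])
    also have "\<dots> \<le> ennreal c * ennreal (Gamma (1 - s) / s * A powr s + 2 * V powr s / s)"
      by (rule mult_left_mono[OF fk(2)]) simp
    also have "\<dots> = ennreal (Gamma (1 - s) / s * (c * A powr s) + 2 / s * (c * V powr s))"
      using c by (simp add: ennreal_mult'[symmetric] algebra_simps)
    also have "\<dots> \<le> ennreal (Gamma (1 - s) / s * (c * A powr s) + 2 / s * ((1 + 8 / R) * cone_density q (R / 2) l V))"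
      unfolding c_def using s l by (intro ennreal_leI add_left_mono mult_left_mono cone_density_mult_powr_le[OF s R]) auto
    finally show ?thesis using 1 unfolding cA by (simp add: mult.assoc)
  qed (simp add: h_def cone_density_def)
  then show "?A = ?B" ?C by auto
qed

theorem corollary3p3:
  fixes br :: "'v::euclidean_space \<times> 'w::euclidean_space \<Rightarrow> 'v \<times> 'w \<Rightarrow> 'v \<times> 'w"
    and s y m k :: real and z :: 'v and \<sigma> :: 'w and u :: "'v \<times> 'w \<Rightarrow> complex"
  assumes "heisenberg_type br"
    and "m = real DIM('v)" and "k = real DIM('w)"
    and "0 < s" and "s < 1" and "y > 0"
    and "u = (\<lambda>(z, \<sigma>). of_real
           ((((norm z)\<^sup>2 + y\<^sup>2)\<^sup>2 + 16 * (norm \<sigma>)\<^sup>2) powr (- (m + 2 * k - 2 * s) / 4)))"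
  shows "frac_lap_converges br s u (z, \<sigma>) \<and>
    frac_lap br s u (z, \<sigma>) = of_real
      (Gamma ((m + 2 + 2 * s) / 4) * Gamma ((m + 2 * k + 2 * s) / 4) /
       (Gamma ((m + 2 - 2 * s) / 4) * Gamma ((m + 2 * k - 2 * s) / 4)) *
       (4 * y) powr (2 * s) *
       (((norm z)\<^sup>2 + y\<^sup>2)\<^sup>2 + 16 * (norm \<sigma>)\<^sup>2) powr (- (m + 2 * k + 2 * s) / 4))"
proof -
  note s = \<open>0 < s\<close> \<open>s < 1\<close> and y = \<open>y > 0\<close>
  interpret heisenberg_algebra br by (rule heisenberg_algebra.intro) (rule assms(1))
  define q where "q = m / 2 + 1 - s"
  have m: "m \<ge> 2" using DIM_layer1_ge_2 assms(2) by simp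
  have k: "k > 0" using assms(3) by simp
  have q: "q > 0" "q > 1" using m s unfolding q_def by auto
  define R where "R = (norm z)\<^sup>2 + y\<^sup>2"
  have R: "R > 0" using y by (simp add: R_def add_nonneg_pos)
  define d where "d = riesz_const k q"
  have "d > 0" using q k unfolding d_def riesz_const_def by (auto intro!: mult_pos_pos Gamma_real_pos)
  then have d: "d \<noteq> 0" by simp
  \<comment> \<open>The exponent of u is that of a radial power with parameter q.\<close>
  have expo: "- (m + 2 * k - 2 * s) / 4 = - (q + k - 1) / 2" by (simp add: q_def field_simps)
  have u: "u = (\<lambda>(x, \<tau>). complex_of_real ((((norm x)\<^sup>2 + y\<^sup>2)\<^sup>2 + 16 * (norm \<tau>)\<^sup>2) powr (- (q + k - 1) / 2)))"
    unfolding assms(7) expo ..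
  define H where "H = (\<lambda>l V t. heat_factor s (y\<^sup>2 / 4 * (V\<^sup>2 - l\<^sup>2)) l V t)"
  define G where "G = (\<lambda>t l V. t powr (1 + s) * (cone_density q R l V * H l V t))"
  define e where "e = (\<lambda>\<mu>::'w. cis ((- \<sigma>) \<bullet> \<mu>))"
  have q_eq: "q = real DIM('v) / 2 + 1 - s" by (simp add: q_def assms(2))
  note P = P_op_eq[OF s y, of _ z \<sigma>, folded q_eq, folded R_def, folded assms(3) d_def]
  have P1: "integrable lborel (\<lambda>g'. kernel s (group_mult br (group_inv g') (z, \<sigma>)) t * u g')" if "t > 0" for t
    unfolding u by (rule P(1)[OF that])
  have P2: "integrable lborel (\<lambda>\<mu>. complex_of_real (LINT V|lborel. G t (norm \<mu>) V) * e \<mu>)" if "t > 0" for t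
    unfolding G_def H_def e_def by (rule P(2)[OF that])
  have P3: "P_op br s t u (z, \<sigma>) = complex_of_real (1 / d) * (LINT \<mu>|lborel. complex_of_real (LINT V|lborel. G t (norm \<mu>) V) * e \<mu>)" if "t > 0" for t
    unfolding u G_def H_def e_def by (rule P(3)[OF that])
  \<comment> \<open>The Fourier transform of the cone integral with parameter p: p = q gives back u
    up to the factor d, and p = q + 2 s gives the result.\<close>
  define X where "X = (\<lambda>p. complex_of_real (riesz_const k p * (R\<^sup>2 + 16 * (norm \<sigma>)\<^sup>2) powr (- (p + k - 1) / 2)))"
  have cone: "has_bochner_integral lborel (\<lambda>\<mu>. complex_of_real (cone p R (norm \<mu>)) * e \<mu>) (X p)" if "p > 0" for p
    using cone_char[OF that R, of "- \<sigma>"] unfolding X_def e_def assms(3) by simp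
  have uX: "u (z, \<sigma>) = complex_of_real (1 / d) * X q"
    unfolding u X_def d_def[symmetric] case_prod_conv R_def[symmetric] using d by simp
  \<comment> \<open>Up to the factor 1 / d, the t-integrand of the operator before integration over
    \<mu> and V. The heat factor and the power from - u are kept together in
    \<open>frac_kernel\<close>, as neither is integrable at t = 0 alone.\<close>
  define F where "F = (\<lambda>t (\<mu>::'w) V. complex_of_real (indicator {0<..} t * (cone_density q R (norm \<mu>) V * frac_kernel s (y\<^sup>2 / 4 * (V\<^sup>2 - (norm \<mu>)\<^sup>2)) (norm \<mu>) V t)) * e \<mu>)"
  have AE0: "AE \<mu> in lborel. \<mu> \<noteq> (0::'w)" by (rule AE_lborel_singleton)
  have Fm: "(\<lambda>(t, \<mu>, V). F t \<mu> V) \<in> borel_measurable (lborel \<Otimes>\<^sub>M (lborel \<Otimes>\<^sub>M lborel))"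
    unfolding F_def e_def by measurable
  define K where "K = Gamma (1 - s) / s * (y\<^sup>2 / 4) powr s"
  have K: "K \<ge> 0" using s by (simp add: K_def Gamma_real_pos less_imp_le)
  have e1: "norm (e \<mu>) = 1" for \<mu> by (simp add: e_def)
  have R2: "R / 2 > 0" and q2: "q + 2 * s > 0" using R q s by auto
  have "(\<integral>\<^sup>+\<mu>. (\<integral>\<^sup>+V. (\<integral>\<^sup>+t. ennreal (norm (F t \<mu> V)) \<partial>lborel) \<partial>lborel) \<partial>lborel)
     \<le> (\<integral>\<^sup>+(\<mu>::'w). ennreal (K * cone (q + 2 * s) R (norm \<mu>) + 2 / s * ((1 + 8 / R) * cone q (R / 2) (norm \<mu>))) \<partial>lborel)"
    using AE0
  proof (intro nn_integral_mono_AE, eventually_elim)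
    case (elim \<mu>)
    then have l: "norm \<mu> > 0" by simp
    define l where "l = norm \<mu>"
    have "(\<integral>\<^sup>+V. (\<integral>\<^sup>+t. ennreal (norm (F t \<mu> V)) \<partial>lborel) \<partial>lborel)
       \<le> (\<integral>\<^sup>+V. ennreal (K * cone_density (q + 2 * s) R l V + 2 / s * ((1 + 8 / R) * cone_density q (R / 2) l V)) \<partial>lborel)"
      unfolding F_def norm_mult e1 mult_1_right norm_of_real K_def l_def
      by (intro nn_integral_mono frac_kernel_cone_integrals(2)) (use s y R l q in auto)
    also have "\<dots> = (\<integral>\<^sup>+V. ennreal K * ennreal (cone_density (q + 2 * s) R l V) + ennreal (2 / s * (1 + 8 / R)) * ennreal (cone_density q (R / 2) l V) \<partial>lborel)"
      using K s R by (intro nn_integral_cong) (simp add: ennreal_mult'[symmetric] ennreal_plus[symmetric] mult.assoc del: ennreal_plus)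
    also have "\<dots> = ennreal K * ennreal (cone (q + 2 * s) R l) + ennreal (2 / s * (1 + 8 / R)) * ennreal (cone q (R / 2) l)"
      using nn_integral_cone[OF q2 R, of l] nn_integral_cone[OF q(1) R2, of l] l
      by (simp add: nn_integral_add nn_integral_cmult l_def)
    also have "\<dots> = ennreal (K * cone (q + 2 * s) R l + 2 / s * ((1 + 8 / R) * cone q (R / 2) l))"
      using K s R by (simp add: ennreal_mult'[symmetric] ennreal_plus[symmetric] mult.assoc del: ennreal_plus)
    finally show ?case unfolding l_def .
  qed
  also have "\<dots> < \<infinity>"
  proof -
    have "integrable lborel (\<lambda>\<mu>::'w. K * cone (q + 2 * s) R (norm \<mu>) + 2 / s * ((1 + 8 / R) * cone q (R / 2) (norm \<mu>)))"
      by (intro Bochner_Integration.integrable_add integrable_mult_right integrable_cone q q2 R R2)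
    then show ?thesis using K s R by (subst nn_integral_eq_integral) auto
  qed
  finally have fin: "(\<integral>\<^sup>+\<mu>. (\<integral>\<^sup>+V. (\<integral>\<^sup>+t. ennreal (norm (F t \<mu> V)) \<partial>lborel) \<partial>lborel) \<partial>lborel) < \<infinity>" .
  note Fub = Fubini_triple[OF Fm fin]
  \<comment> \<open>For fixed t > 0 the heat part and the identity part are each integrable in V, so
    the difference may be split; only the t-integral requires it to stay together.\<close>
  have FV: "(LINT V|lborel. F t \<mu> V) = complex_of_real (1 / t powr (1 + s)) * (complex_of_real (LINT V|lborel. G t (norm \<mu>) V) * e \<mu> - complex_of_real (cone q R (norm \<mu>)) * e \<mu>)"
    if t: "t > 0" and \<mu>: "\<mu> \<noteq> 0" for t \<mu>
  proof -
    have l: "norm \<mu> > 0" using \<mu> by simp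
    define c where "c = cone_density q R (norm \<mu>)"
    have ci: "integrable lborel c" unfolding c_def by (rule integrable_cone_density[OF q(1) R l])
    \<comment> \<open>The integrability claim does not involve \<eta>; this vector witnesses the
      hypotheses of orthogonality to z and norm l |z| / 2.\<close>
    have Gi: "integrable lborel (G t (norm \<mu>))"
      unfolding G_def H_def R_def
      by (rule cone_gauss_integral(2)[where \<eta> = "(1/2) *\<^sub>R kaplan br \<mu> z"])
         (use s y t l q in \<open>auto simp: q_eq kaplan_perp norm_kaplan\<close>)
    have pw: "t powr (- s - 1) = 1 / t powr (1 + s)"
    proof -
      have "- s - 1 = - (1 + s)" by simp
      then show ?thesis by (simp only: powr_minus_divide)
    qed
    have "c V * frac_kernel s (y\<^sup>2 / 4 * (V\<^sup>2 - (norm \<mu>)\<^sup>2)) (norm \<mu>) V t = 1 / t powr (1 + s) * (G t (norm \<mu>) V - c V)" for V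
      using t unfolding frac_kernel_def pw G_def H_def c_def[symmetric] by (simp add: field_simps)
    then have "F t \<mu> V = complex_of_real (1 / t powr (1 + s) * (G t (norm \<mu>) V - c V)) * e \<mu>" for V
      using t unfolding F_def c_def[symmetric] by simp
    then have "(LINT V|lborel. F t \<mu> V) = complex_of_real (1 / t powr (1 + s) * (LINT V|lborel. G t (norm \<mu>) V - c V)) * e \<mu>"
      by (simp only: integral_mult_left_zero integral_complex_of_real integral_mult_right_zero)
    also have "(LINT V|lborel. G t (norm \<mu>) V - c V) = (LINT V|lborel. G t (norm \<mu>) V) - cone q R (norm \<mu>)"
      unfolding cone_def c_def[symmetric] by (rule Bochner_Integration.integral_diff[OF Gi ci])
    finally show ?thesis by (simp only: of_real_mult of_real_diff mult.assoc left_diff_distrib)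
  qed
  \<comment> \<open>For t \<le> 0 both sides are 0 because of the indicators, so the identity
    extends to all real t and Fubini can be applied on the whole line.\<close>
  have main: "indicator {0<..} t *\<^sub>R frac_lap_integrand br s u (z, \<sigma>) t = complex_of_real (1 / d) * (LINT \<mu>|lborel. LINT V|lborel. F t \<mu> V)" for t
  proof (cases "t > 0")
    case True
    have "(\<lambda>(\<mu>, V). F t \<mu> V) \<in> borel_measurable (lborel \<Otimes>\<^sub>M lborel)"
      unfolding F_def e_def by measurable
    from lborel.borel_measurable_lebesgue_integral[OF this]
    have FVm: "(\<lambda>\<mu>. LINT V|lborel. F t \<mu> V) \<in> borel_measurable lborel" .
    let ?g = "\<lambda>\<mu>. complex_of_real (LINT V|lborel. G t (norm \<mu>) V) * e \<mu>"
    let ?c = "\<lambda>\<mu>::'w. complex_of_real (cone q R (norm \<mu>)) * e \<mu>"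
    note gi = P2[OF True]
    have ci: "integrable lborel ?c" "(LINT \<mu>|lborel. ?c \<mu>) = X q"
      using cone[OF q(1)] by (auto simp: has_bochner_integral_iff)
    have "(LINT \<mu>|lborel. LINT V|lborel. F t \<mu> V) = (LINT \<mu>|lborel. complex_of_real (1 / t powr (1 + s)) * (?g \<mu> - ?c \<mu>))"
    proof (rule integral_cong_AE[OF FVm])
      show "(\<lambda>\<mu>. complex_of_real (1 / t powr (1 + s)) * (?g \<mu> - ?c \<mu>)) \<in> borel_measurable lborel"
        using gi ci(1) by (intro borel_measurable_times borel_measurable_diff borel_measurable_const borel_measurable_integrable)
      show "AE \<mu> in lborel. (LINT V|lborel. F t \<mu> V) = complex_of_real (1 / t powr (1 + s)) * (?g \<mu> - ?c \<mu>)"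
        using AE0 by eventually_elim (rule FV[OF True])
    qed
    also have "\<dots> = complex_of_real (1 / t powr (1 + s)) * ((LINT \<mu>|lborel. ?g \<mu>) - X q)"
      by (simp only: integral_mult_right_zero Bochner_Integration.integral_diff[OF gi ci(1)] ci(2))
    finally have W: "(LINT \<mu>|lborel. LINT V|lborel. F t \<mu> V) = complex_of_real (1 / t powr (1 + s)) * ((LINT \<mu>|lborel. ?g \<mu>) - X q)" .
    show ?thesis
      unfolding frac_lap_integrand_def P3[OF True] uX W using True by (simp add: algebra_simps)
  qed (simp add: F_def)
  have conv: "set_integrable lborel {0<..} (frac_lap_integrand br s u (z, \<sigma>))"
    unfolding set_integrable_def main by (intro integrable_mult_right Fub(1))
  have "(LINT t:{0<..}|lborel. frac_lap_integrand br s u (z, \<sigma>) t) = complex_of_real (1 / d) * (LINT t|lborel. LINT \<mu>|lborel. LINT V|lborel. F t \<mu> V)"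
    unfolding set_lebesgue_integral_def main by (rule integral_mult_right_zero)
  also have "\<dots> = complex_of_real (1 / d) * (LINT \<mu>|lborel. LINT V|lborel. LINT t|lborel. F t \<mu> V)"
    by (simp only: Fub(2))
  \<comment> \<open>With the t-integral innermost, its value turns the density with parameter q into
    - K times the one with q + 2 s, and the V-integral is a cone integral again.\<close>
  also have "(LINT \<mu>|lborel. LINT V|lborel. LINT t|lborel. F t \<mu> V) = (LINT \<mu>|lborel. complex_of_real (- K) * (complex_of_real (cone (q + 2 * s) R (norm \<mu>)) * e \<mu>))"
  proof (rule integral_cong_AE)
    show "AE \<mu> in lborel. (LINT V|lborel. LINT t|lborel. F t \<mu> V) = complex_of_real (- K) * (complex_of_real (cone (q + 2 * s) R (norm \<mu>)) * e \<mu>)"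
      using AE0
    proof eventually_elim
      case (elim \<mu>)
      then have l: "norm \<mu> > 0" by simp
      have "(LINT t|lborel. F t \<mu> V) = complex_of_real (- K * cone_density (q + 2 * s) R (norm \<mu>) V) * e \<mu>" for V
        using frac_kernel_cone_integrals(1)[OF s y R l q(1), of V] unfolding F_def K_def
        by (simp only: integral_mult_left_zero integral_complex_of_real)
      then show ?case
        unfolding cone_def by (simp only: integral_mult_left_zero integral_complex_of_real integral_mult_right_zero of_real_mult mult.assoc)
    qed
    show "(\<lambda>\<mu>. complex_of_real (- K) * (complex_of_real (cone (q + 2 * s) R (norm \<mu>)) * e \<mu>)) \<in> borel_measurable lborel"
      unfolding e_def by measurable
    show "(\<lambda>\<mu>. LINT V|lborel. LINT t|lborel. F t \<mu> V) \<in> borel_measurable lborel"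
      unfolding F_def e_def by measurable
  qed
  also have "\<dots> = complex_of_real (- K) * X (q + 2 * s)"
    by (simp only: integral_mult_right_zero has_bochner_integral_integral_eq[OF cone[OF q2]])
  finally have val: "frac_lap br s u (z, \<sigma>) = complex_of_real (s / Gamma (1 - s) * (1 / d) * K * (riesz_const k (q + 2 * s) * (R\<^sup>2 + 16 * (norm \<sigma>)\<^sup>2) powr (- (q + 2 * s + k - 1) / 2)))"
    unfolding frac_lap_def X_def by simp
  have "Gamma (1 - s) \<noteq> 0" using s Gamma_real_pos[of "1 - s"] by linarith
  \<comment> \<open>The normalising constant in the definition of the operator cancels the Gamma
    factor of the regularised integral.\<close>
  then have "s / Gamma (1 - s) * K = (y\<^sup>2 / 4) powr s"
    using s by (simp add: K_def)
  moreover have "riesz_const k (q + 2 * s) / d = Gamma ((m + 2 + 2 * s) / 4) * Gamma ((m + 2 * k + 2 * s) / 4) /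
       (Gamma ((m + 2 - 2 * s) / 4) * Gamma ((m + 2 * k - 2 * s) / 4)) * 64 powr s"
  proof -
    have "(8::real) powr (q + 2 * s + k - 1) = 8 powr (2 * s) * 8 powr (q + k - 1)"
      by (subst powr_add[symmetric]) (simp add: algebra_simps)
    also have "(8::real) powr (2 * s) = (8 powr 2) powr s" by (simp only: powr_powr)
    finally have 8: "(8::real) powr (q + 2 * s + k - 1) = 64 powr s * 8 powr (q + k - 1)" by simp
    have g: "(q + 2 * s) / 2 = (m + 2 + 2 * s) / 4" "q / 2 = (m + 2 - 2 * s) / 4"
      "(q + 2 * s + k - 1) / 2 = (m + 2 * k + 2 * s) / 4" "(q + k - 1) / 2 = (m + 2 * k - 2 * s) / 4"
      by (simp_all add: q_def field_simps)
    show ?thesis unfolding d_def riesz_const_def cone_const_def 8 g by simp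
  qed
  \<comment> \<open>The factor 4 y combines y^2 / 4 from A with 64 = 8^2 from the ratio of the two
    Riesz constants.\<close>
  moreover have "(y\<^sup>2 / 4) powr s * 64 powr s = (4 * y) powr (2 * s)"
  proof -
    have "(y\<^sup>2 / 4) * 64 = (4 * y) powr 2" using y by (simp add: power2_eq_square)
    then show ?thesis by (simp only: powr_mult[symmetric] powr_powr)
  qed
  moreover have "- (q + 2 * s + k - 1) / 2 = - (m + 2 * k + 2 * s) / 4" by (simp add: q_def field_simps)
  ultimately have fin: "s / Gamma (1 - s) * (1 / d) * K * (riesz_const k (q + 2 * s) * (R\<^sup>2 + 16 * (norm \<sigma>)\<^sup>2) powr (- (q + 2 * s + k - 1) / 2))
    = Gamma ((m + 2 + 2 * s) / 4) * Gamma ((m + 2 * k + 2 * s) / 4) /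
       (Gamma ((m + 2 - 2 * s) / 4) * Gamma ((m + 2 * k - 2 * s) / 4)) * (4 * y) powr (2 * s) *
       (R\<^sup>2 + 16 * (norm \<sigma>)\<^sup>2) powr (- (m + 2 * k + 2 * s) / 4)"
    (is "_ = ?C * _ * ?W")
  proof -
    assume a: "s / Gamma (1 - s) * K = (y\<^sup>2 / 4) powr s" and b: "riesz_const k (q + 2 * s) / d = ?C * 64 powr s"
      and c: "(y\<^sup>2 / 4) powr s * 64 powr s = (4 * y) powr (2 * s)" and e: "- (q + 2 * s + k - 1) / 2 = - (m + 2 * k + 2 * s) / 4"
    have "s / Gamma (1 - s) * (1 / d) * K * (riesz_const k (q + 2 * s) * ?W) = (s / Gamma (1 - s) * K) * (riesz_const k (q + 2 * s) / d) * ?W"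
      by simp
    also have "\<dots> = ?C * ((y\<^sup>2 / 4) powr s * 64 powr s) * ?W" unfolding a b by (simp only: mult_ac)
    finally show ?thesis unfolding c e .
  qed
  have "frac_lap_converges br s u (z, \<sigma>)"
    unfolding frac_lap_converges_def using integrable_kernel_integrand s P1 conv by blast
  then show ?thesis unfolding val fin unfolding R_def by blast
qed

end
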